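(* Let $p$ be a prime and let $G$ be a (topologically) finitely generated nilpotent pro-$p$ group with $h(G)>1$. Then $\mathcal{S}(G)$ is homeomorphic to Pełczyński space $P$.
   Context: For a profinite group $G$, $\mathcal{S}(G)$ is the set of closed subgroups of $G$ with its natural profinite topology: a base of open neighbourhoods of $H\in\mathcal{S}(G)$ is given by the sets $B(H,N)=\{K \text{ closed subgroup of } G \mid KN=HN\}$, with $N$ ranging over the open normal subgroups of $G$. A profinite group is poly-procyclic if it has a finite series of closed subgroups $1=G_0\leqslant G_1\leqslant\dots\leqslant G_n=G$ with $G_{i-1}$ normal in $G_i$ and $G_i/G_{i-1}$ procyclic (topologically generated by one element). For a poly-procyclic pro-$p$ group $G$ (finitely generated nilpotent pro-$p$ groups are poly-procyclic), the Hirsch length $h(G)$ is the number of factors isomorphic to $\mathbb{Z}_p$ (the $p$-adic integers) in any such series. Pełczyński space $P$ is the subspace of $[0,1]$ consisting of the middle-third Cantor set together with the midpoints of all the open intervals deleted in its construction. *)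

theory Defs
  imports "HOL-Analysis.Analysis" "HOL-Algebra.Generated_Groups"
    "HOL-Computational_Algebra.Primes"
begin

section \<open>Profinite and pro-p groups\<close>

locale topological_group = group G
  for G :: "('a, 'b) monoid_scheme" (structure) and T :: "'a topology" +
  assumes topspace_eq: "topspace T = carrier G"
    and continuous_mult: "continuous_map (prod_topology T T) T (\<lambda>(x, y). x \<otimes> y)"
    and continuous_inv: "continuous_map T T (\<lambda>x. inv x)"

locale profinite_group = topological_group +
  assumes compact: "compact_space T"
    and Hausdorff: "Hausdorff_space T"
    and totally_disconnected: "connectedin T C \<Longrightarrow> x \<in> C \<Longrightarrow> y \<in> C \<Longrightarrow> x = y"

definition open_normal :: "('a, 'b) monoid_scheme \<Rightarrow> 'a topology \<Rightarrow> 'a set \<Rightarrow> bool"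
  where "open_normal G T N \<longleftrightarrow> N \<lhd> G \<and> openin T N"

definition closed_subgroup :: "('a, 'b) monoid_scheme \<Rightarrow> 'a topology \<Rightarrow> 'a set \<Rightarrow> bool"
  where "closed_subgroup G T H \<longleftrightarrow> subgroup H G \<and> closedin T H"

locale pro_p_group = profinite_group +
  fixes p :: nat
  assumes prime: "prime p"
    and open_index: "open_normal G T N \<Longrightarrow> \<exists>k. order (G Mod N) = p ^ k"

definition topologically_generates :: "('a, 'b) monoid_scheme \<Rightarrow> 'a topology \<Rightarrow> 'a set \<Rightarrow> bool"
  where "topologically_generates G T S \<longleftrightarrow>
    S \<subseteq> carrier G \<and> T closure_of (generate G S) = carrier G"

definition topologically_fin_gen :: "('a, 'b) monoid_scheme \<Rightarrow> 'a topology \<Rightarrow> bool"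
  where "topologically_fin_gen G T \<longleftrightarrow> (\<exists>S. finite S \<and> topologically_generates G T S)"

definition procyclic :: "('a, 'b) monoid_scheme \<Rightarrow> 'a topology \<Rightarrow> bool"
  where "procyclic G T \<longleftrightarrow> (\<exists>x. topologically_generates G T {x})"

fun lower_central :: "('a, 'b) monoid_scheme \<Rightarrow> nat \<Rightarrow> 'a set"
  where
    "lower_central G 0 = carrier G"
  | "lower_central G (Suc n) =
      generate G (\<Union>x \<in> lower_central G n. \<Union>y \<in> carrier G.
        {x \<otimes>\<^bsub>G\<^esub> y \<otimes>\<^bsub>G\<^esub> inv\<^bsub>G\<^esub> x \<otimes>\<^bsub>G\<^esub> inv\<^bsub>G\<^esub> y})"

text \<open>Nilpotency of the abstract group. In a Hausdorff topological group the closed lower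
  central series reaches the trivial group at the same step.\<close>

definition nilpotent_group :: "('a, 'b) monoid_scheme \<Rightarrow> bool"
  where "nilpotent_group G \<longleftrightarrow> (\<exists>n. lower_central G n = {\<one>\<^bsub>G\<^esub>})"


section \<open>Poly-procyclic series and Hirsch length\<close>

definition quotient_topology :: "'a topology \<Rightarrow> ('a \<Rightarrow> 'c) \<Rightarrow> 'c topology"
  where "quotient_topology T f =
    topology (\<lambda>U. U \<subseteq> f ` topspace T \<and> openin T {x \<in> topspace T. f x \<in> U})"

lemma openin_quotient_topology:
  "openin (quotient_topology T f) U \<longleftrightarrow>
    U \<subseteq> f ` topspace T \<and> openin T {x \<in> topspace T. f x \<in> U}"
proof -
  have "istopology (\<lambda>U. U \<subseteq> f ` topspace T \<and> openin T {x \<in> topspace T. f x \<in> U})"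
    unfolding istopology_def
  proof (intro conjI allI impI)
    fix U V
    assume "U \<subseteq> f ` topspace T \<and> openin T {x \<in> topspace T. f x \<in> U}"
      and "V \<subseteq> f ` topspace T \<and> openin T {x \<in> topspace T. f x \<in> V}"
    moreover have "{x \<in> topspace T. f x \<in> U \<inter> V} =
        {x \<in> topspace T. f x \<in> U} \<inter> {x \<in> topspace T. f x \<in> V}"
      by auto
    ultimately show "U \<inter> V \<subseteq> f ` topspace T" "openin T {x \<in> topspace T. f x \<in> U \<inter> V}"
      by auto
  next
    fix K
    assume K: "\<forall>U\<in>K. U \<subseteq> f ` topspace T \<and> openin T {x \<in> topspace T. f x \<in> U}"
    then show "\<Union>K \<subseteq> f ` topspace T"
      by blast
    have "{x \<in> topspace T. f x \<in> \<Union>K} = (\<Union>U\<in>K. {x \<in> topspace T. f x \<in> U})"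
      by auto
    then show "openin T {x \<in> topspace T. f x \<in> \<Union>K}"
      using K by auto
  qed
  then show ?thesis
    by (simp add: quotient_topology_def topology_inverse')
qed

lemma topspace_quotient_topology: "topspace (quotient_topology T f) = f ` topspace T"
proof
  show "topspace (quotient_topology T f) \<subseteq> f ` topspace T"
    using openin_quotient_topology[of T f "topspace (quotient_topology T f)"] by auto
  have "{x \<in> topspace T. f x \<in> f ` topspace T} = topspace T"
    by auto
  then have "openin (quotient_topology T f) (f ` topspace T)"
    by (simp add: openin_quotient_topology)
  then show "f ` topspace T \<subseteq> topspace (quotient_topology T f)"
    by (rule openin_subset)
qed

lemma quotient_map_quotient_topology: "quotient_map T (quotient_topology T f) f"
  by (simp add: quotient_map_def topspace_quotient_topology openin_quotient_topology)

text \<open>For subgroups \<open>K \<lhd> H\<close> of \<open>G\<close>, the topological group \<open>H/K\<close>.\<close>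

abbreviation factor_group ::
    "('a, 'b) monoid_scheme \<Rightarrow> 'a set \<Rightarrow> 'a set \<Rightarrow> 'a set monoid"
  where "factor_group G H K \<equiv> (G\<lparr>carrier := H\<rparr>) Mod K"

definition factor_topology ::
    "('a, 'b) monoid_scheme \<Rightarrow> 'a topology \<Rightarrow> 'a set \<Rightarrow> 'a set \<Rightarrow> 'a set topology"
  where "factor_topology G T H K = quotient_topology (subtopology T H) (\<lambda>x. K #>\<^bsub>G\<^esub> x)"

definition polyprocyclic_series ::
    "('a, 'b) monoid_scheme \<Rightarrow> 'a topology \<Rightarrow> nat \<Rightarrow> (nat \<Rightarrow> 'a set) \<Rightarrow> bool"
  where "polyprocyclic_series G T n F \<longleftrightarrow>
    F 0 = {\<one>\<^bsub>G\<^esub>} \<and> F n = carrier G \<and>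
    (\<forall>i\<le>n. closed_subgroup G T (F i)) \<and>
    (\<forall>i<n. F i \<lhd> G\<lparr>carrier := F (Suc i)\<rparr> \<and>
      procyclic (factor_group G (F (Suc i)) (F i)) (factor_topology G T (F (Suc i)) (F i)))"

text \<open>The \<open>p\<close>-adic integers as the inverse limit of the groups \<open>\<int>/p\<^sup>n\<int>\<close>, whose elements are
  represented by \<open>0, \<dots>, p\<^sup>n - 1\<close>.\<close>

definition padic_carrier :: "nat \<Rightarrow> (nat \<Rightarrow> int) set"
  where "padic_carrier p =
    {x. \<forall>n. x n \<in> {0..<int p ^ n} \<and> x (Suc n) mod int p ^ n = x n}"

definition padic_int :: "nat \<Rightarrow> (nat \<Rightarrow> int) monoid"
  where "padic_int p =
    \<lparr>carrier = padic_carrier p,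
     mult = (\<lambda>x y n. (x n + y n) mod int p ^ n),
     one = (\<lambda>n. 0)\<rparr>"

definition padic_topology :: "nat \<Rightarrow> (nat \<Rightarrow> int) topology"
  where "padic_topology p =
    subtopology (product_topology (\<lambda>n. discrete_topology {0..<int p ^ n}) UNIV) (padic_carrier p)"

definition topological_group_isomorphic ::
    "('a, 'b) monoid_scheme \<Rightarrow> 'a topology \<Rightarrow> ('c, 'd) monoid_scheme \<Rightarrow> 'c topology \<Rightarrow> bool"
  where "topological_group_isomorphic G T H T' \<longleftrightarrow>
    (\<exists>f. f \<in> iso G H \<and> homeomorphic_map T T' f)"

definition padic_factor_count ::
    "nat \<Rightarrow> ('a, 'b) monoid_scheme \<Rightarrow> 'a topology \<Rightarrow> nat \<Rightarrow> (nat \<Rightarrow> 'a set) \<Rightarrow> nat"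
  where "padic_factor_count p G T n F =
    card {i. i < n \<and> topological_group_isomorphic
      (factor_group G (F (Suc i)) (F i)) (factor_topology G T (F (Suc i)) (F i))
      (padic_int p) (padic_topology p)}"

text \<open>For a poly-procyclic pro-\<open>p\<close> group the count does not depend on the series, so the choice
  made by \<open>SOME\<close> is immaterial. The value is meaningful only for such groups.\<close>

definition hirsch_length :: "nat \<Rightarrow> ('a, 'b) monoid_scheme \<Rightarrow> 'a topology \<Rightarrow> nat"
  where "hirsch_length p G T =
    (SOME h. \<exists>n F. polyprocyclic_series G T n F \<and> h = padic_factor_count p G T n F)"


section \<open>The space of closed subgroups\<close>

definition subgroup_nbhd ::
    "('a, 'b) monoid_scheme \<Rightarrow> 'a topology \<Rightarrow> 'a set \<Rightarrow> 'a set \<Rightarrow> 'a set set"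
  where "subgroup_nbhd G T H N =
    {K. closed_subgroup G T K \<and> K <#>\<^bsub>G\<^esub> N = H <#>\<^bsub>G\<^esub> N}"

text \<open>The generating sets are already a base: if \<open>L\<close> lies in \<open>B(H, N)\<close> and \<open>B(K, M)\<close>, then
  \<open>B(L, N \<inter> M)\<close> is contained in both. Hence the sets \<open>B(H, N)\<close>, for \<open>N\<close> open normal, form a
  base of open neighbourhoods of \<open>H\<close>.\<close>

definition subgroup_space :: "('a, 'b) monoid_scheme \<Rightarrow> 'a topology \<Rightarrow> 'a set topology"
  where "subgroup_space G T =
    topology_generated_by
      {subgroup_nbhd G T H N | H N. closed_subgroup G T H \<and> open_normal G T N}"


section \<open>Pelczynski space\<close>

text \<open>The intervals remaining at stage \<open>n\<close> of the middle-third construction, represented by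
  their pairs of endpoints. At stage \<open>n + 1\<close> the open middle third of each of them is deleted;
  its midpoint is that of the interval itself.\<close>

fun cantor_intervals :: "nat \<Rightarrow> (real \<times> real) set"
  where
    "cantor_intervals 0 = {(0, 1)}"
  | "cantor_intervals (Suc n) =
      (\<Union>(a, b) \<in> cantor_intervals n. {(a, a + (b - a) / 3), (b - (b - a) / 3, b)})"

definition cantor_set :: "real set"
  where "cantor_set = (\<Inter>n. \<Union>(a, b) \<in> cantor_intervals n. {a..b})"

definition deleted_midpoints :: "real set"
  where "deleted_midpoints = (\<Union>n. (\<lambda>(a, b). (a + b) / 2) ` cantor_intervals n)"

definition pelczynski_space :: "real topology"
  where "pelczynski_space = top_of_set (cantor_set \<union> deleted_midpoints)"

end

theory Submission
  imports Defs "HOL-Algebra.Multiplicative_Group"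
begin

text \<open>A compact Hausdorff space with countably many clopen sets separating points, with a dense set of
  isolated points and with a nonempty perfect set of limit points can be cut up along the binary tree
  in the same way as Pelczynski space: every piece is an isolated point together with two smaller
  pieces of the same kind, and the branches shrink to points. Hence it is homeomorphic to
  Pelczynski space.

  In the space of closed subgroups of \<open>G\<close> the open subgroups are dense, and they are exactly the
  isolated points because every closed subgroup has an open Frattini subgroup. It remains to see that
  no closed subgroup \<open>H\<close> of infinite index is isolated among those of infinite index. Otherwise \<open>H\<close>
  is normal in some open subgroup \<open>L\<close>, and all larger closed subgroups of \<open>L\<close> are open. If \<open>H\<close> is
  finite, this makes \<open>G\<close> virtually procyclic, against \<open>h(G) > 1\<close>. If \<open>H\<close> is infinite, then by
  nilpotency it has a quotient \<open>H / B\<close> that is isomorphic to \<open>\<int>\<^sub>p\<close> and central in \<open>L / B\<close>; twisting a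
  generator of this quotient by an element of \<open>L\<close> outside \<open>H\<close> moves \<open>H\<close> slightly.\<close>

section \<open>Binary schemes\<close>

text \<open>Finite generation and nilpotency enter largely through a finite tower of procyclic
  factors, which yields the maximal condition on closed subgroups. Maximal elements then take the
  place of rank and dimension arguments, both for the Frattini subgroups and for the choice of
  \<open>B\<close>. Two obstacles shape the rest. A clopen set that splits a piece may leave a
  finite side without limit points, on which no further piece can be grown; such a side is used up
  as centres, one point at a time. And the twisted subgroup is of use only if it is not open itself,
  which is why \<open>B\<close> is chosen so that the twisted subgroup is procyclic modulo
  \<open>B\<close>: its nontrivial closed subgroups then have finite index. The bound on the Hirsch
  length supplies one closed subgroup that is infinite and of infinite index; this subgroup is also
  the limit point whose existence the topological part requires.\<close>

lemma homeomorphic_by_clopen_patterns: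
  fixes U :: "'i \<Rightarrow> 'a set" and V :: "'i \<Rightarrow> 'b set"
  assumes X: "compact_space X" and Y: "compact_space Y" "Hausdorff_space Y"
    and U: "\<And>i. openin X (U i)" "\<And>i. closedin X (U i)"
    and V: "\<And>i. openin Y (V i)" "\<And>i. closedin Y (V i)"
    and sepU: "\<And>x y. \<lbrakk>x \<in> topspace X; y \<in> topspace X; \<And>i. x \<in> U i \<longleftrightarrow> y \<in> U i\<rbrakk> \<Longrightarrow> x = y"
    and sepV: "\<And>x y. \<lbrakk>x \<in> topspace Y; y \<in> topspace Y; \<And>i. x \<in> V i \<longleftrightarrow> y \<in> V i\<rbrakk> \<Longrightarrow> x = y"
    and XY: "\<And>x. x \<in> topspace X \<Longrightarrow> \<exists>y\<in>topspace Y. \<forall>i. x \<in> U i \<longleftrightarrow> y \<in> V i"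
    and YX: "\<And>y. y \<in> topspace Y \<Longrightarrow> \<exists>x\<in>topspace X. \<forall>i. x \<in> U i \<longleftrightarrow> y \<in> V i"
  shows "X homeomorphic_space Y"
proof -
  obtain h where h: "\<And>x. x \<in> topspace X \<Longrightarrow> h x \<in> topspace Y"
    and hU: "\<And>x i. x \<in> topspace X \<Longrightarrow> x \<in> U i \<longleftrightarrow> h x \<in> V i"
    using XY by metis
  have cont: "continuous_map X Y h"
    unfolding continuous_map_def
  proof (intro conjI allI impI)
    show "h \<in> topspace X \<rightarrow> topspace Y"
      using h by auto
    fix W assume W: "openin Y W"
    show "openin X {x \<in> topspace X. h x \<in> W}"
    proof (subst openin_subopen, intro ballI)
      fix x assume x: "x \<in> {x \<in> topspace X. h x \<in> W}"
      \<comment> \<open>\<open>C i\<close> is the side of \<open>V i\<close> that misses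
        \<open>h x\<close>. As the sets \<open>V i\<close> separate points, these sides cover the
        complement of \<open>W\<close>; finitely many indices suffice, and points that agree with
        \<open>x\<close> on those indices are mapped into \<open>W\<close>.\<close>
      define C where "C i = (if h x \<in> V i then topspace Y - V i else V i)" for i
      have C: "openin Y (C i)" for i
        using V openin_diff[OF openin_topspace V(2)] by (simp add: C_def)
      have cover: "topspace Y - W \<subseteq> \<Union>(range C)"
      proof
        fix y assume y: "y \<in> topspace Y - W"
        then have "\<exists>i. \<not> (y \<in> V i \<longleftrightarrow> h x \<in> V i)"
          using sepV[of y "h x"] x h by auto
        then show "y \<in> \<Union>(range C)"
          using y by (auto simp: C_def)
      qed
      have "compactin Y (topspace Y - W)"
        using W Y(1) by (meson closedin_compact_space openin_closedin_eq)
      then have "\<exists>F. finite F \<and> F \<subseteq> range C \<and> topspace Y - W \<subseteq> \<Union>F"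
        by (rule compactinD) (use cover C in auto)
      then obtain F where F: "finite F" "F \<subseteq> range C" "topspace Y - W \<subseteq> \<Union>F"
        by (elim exE conjE)
      then obtain I where I: "finite I" "F = C ` I"
        using finite_subset_image[of F C UNIV] by auto
      define O' where "O' = topspace X \<inter> (\<Inter>i\<in>I. if x \<in> U i then U i else topspace X - U i)"
      have "openin X O'"
        unfolding O'_def
      proof (rule openin_Int_Inter)
        fix S assume "S \<in> (\<lambda>i. if x \<in> U i then U i else topspace X - U i) ` I"
        then obtain i where "S = U i \<or> S = topspace X - U i"
          by (auto split: if_splits)
        then show "openin X S"
          using U(1)[of i] U(2)[of i] by (auto simp: closedin_def)
      qed (use I(1) in auto)
      moreover have "x \<in> O'"
        using x by (auto simp: O'_def)
      moreover have "h z \<in> W" if z: "z \<in> O'" for z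
      proof (rule ccontr)
        assume "h z \<notin> W"
        then obtain i where i: "i \<in> I" "h z \<in> C i"
          using F(3) I(2) z h[of z] unfolding O'_def by blast
        then show False
          using i z x hU[of x i] hU[of z i] unfolding O'_def C_def by (auto split: if_splits)
      qed
      ultimately show "\<exists>T. openin X T \<and> x \<in> T \<and> T \<subseteq> {x \<in> topspace X. h x \<in> W}"
        unfolding O'_def by blast
    qed
  qed
  have inj: "inj_on h (topspace X)"
  proof (rule inj_onI)
    fix x y assume xy: "x \<in> topspace X" "y \<in> topspace X" "h x = h y"
    show "x = y"
    proof (rule sepU[OF xy(1,2)])
      show "x \<in> U i \<longleftrightarrow> y \<in> U i" for i
        using xy hU[of x i] hU[of y i] by simp
    qed
  qed
  have surj: "h ` topspace X = topspace Y"
  proof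
    show "topspace Y \<subseteq> h ` topspace X"
    proof
      fix y assume y: "y \<in> topspace Y"
      then obtain x where x: "x \<in> topspace X" "\<forall>i. x \<in> U i \<longleftrightarrow> y \<in> V i"
        using YX by blast
      have "h x = y"
      proof (rule sepV)
        show "h x \<in> V i \<longleftrightarrow> y \<in> V i" for i
          using x hU[of x i] by simp
      qed (use x y h in auto)
      then show "y \<in> h ` topspace X"
        using x by blast
    qed
  qed (use h in auto)
  show ?thesis
    using continuous_imp_homeomorphic_map[OF cont X Y(2) surj inj] homeomorphic_map_imp_homeomorphic_space by blast
qed

text \<open>A node of the binary tree is a list that grows at its head, so the children of \<open>s\<close> are
  \<open>True # s\<close> and \<open>False # s\<close>. In Pelczynski space \<open>U s\<close> is the trace of an interval of the
  middle-third construction and \<open>d s\<close> is its midpoint.\<close>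

definition pelczynski_scheme ::
    "'a topology \<Rightarrow> (bool list \<Rightarrow> 'a set) \<Rightarrow> (bool list \<Rightarrow> 'a) \<Rightarrow> bool"
  where "pelczynski_scheme X U d \<longleftrightarrow>
    U [] = topspace X \<and>
    (\<forall>s. openin X (U s) \<and> U s \<noteq> {} \<and> openin X {d s} \<and>
      U s = insert (d s) (U (True # s) \<union> U (False # s)) \<and>
      U (True # s) \<inter> U (False # s) = {} \<and> d s \<notin> U (True # s) \<union> U (False # s)) \<and>
    (\<forall>x\<in>topspace X. \<forall>y\<in>topspace X. (\<forall>s. x \<in> U s \<longleftrightarrow> y \<in> U s) \<longrightarrow> x = y)"

context
  fixes X :: "'a topology" and U d
  assumes scheme: "pelczynski_scheme X U d"
begin

lemma scheme_Nil: "U [] = topspace X"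
  using scheme unfolding pelczynski_scheme_def by (elim conjE)

lemma scheme_split: "U s = insert (d s) (U (True # s) \<union> U (False # s))"
  and scheme_disjoint: "U (True # s) \<inter> U (False # s) = {}"
  and scheme_d': "d s \<notin> U (True # s) \<union> U (False # s)"
  and scheme_open: "openin X (U s)"
  and scheme_open_d: "openin X {d s}"
  and scheme_nonempty: "U s \<noteq> {}"
proof -
  have "\<forall>s. openin X (U s) \<and> U s \<noteq> {} \<and> openin X {d s} \<and>
      U s = insert (d s) (U (True # s) \<union> U (False # s)) \<and>
      U (True # s) \<inter> U (False # s) = {} \<and> d s \<notin> U (True # s) \<union> U (False # s)"
    using scheme unfolding pelczynski_scheme_def by (elim conjE)
  note * = spec[OF this, of s]
  show "U s = insert (d s) (U (True # s) \<union> U (False # s))"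
    using * by (elim conjE)
  show "U (True # s) \<inter> U (False # s) = {}"
    using * by (elim conjE)
  show "d s \<notin> U (True # s) \<union> U (False # s)"
    using * by (elim conjE)
  show "openin X (U s)"
    using * by (elim conjE)
  show "openin X {d s}"
    using * by (elim conjE)
  show "U s \<noteq> {}"
    using * by (elim conjE)
qed

lemma scheme_d: "d s \<notin> U (b # s)"
  using scheme_d'[of s] by (cases b) auto

lemma scheme_Cons_subset: "U (b # s) \<subseteq> U s"
  using scheme_split[of s] by (cases b) auto

lemma scheme_append_subset: "U (r @ s) \<subseteq> U s"
  by (induction r) (use scheme_Cons_subset in auto)

lemma scheme_level_disjoint: "length s = length t \<Longrightarrow> s \<noteq> t \<Longrightarrow> U s \<inter> U t = {}"
proof (induction s t rule: list_induct2)
  case (Cons a s b t)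
  show ?case
  proof (cases "s = t")
    case True
    then show ?thesis
      using Cons.prems scheme_disjoint[of s] by (cases a; cases b) auto
  next
    case False
    then show ?thesis
      using Cons.IH scheme_Cons_subset[of a s] scheme_Cons_subset[of b t] by blast
  qed
qed auto

lemma scheme_closed: "closedin X (U s)"
proof (induction s)
  case Nil
  then show ?case by (simp add: scheme_Nil)
next
  case (Cons b s)
  have "U (b # s) = U s - ({d s} \<union> U ((\<not> b) # s))"
    using scheme_split[of s] scheme_disjoint[of s] scheme_d[of s] by (cases b) auto
  then show ?case
    using Cons closedin_diff[OF Cons] scheme_open scheme_open_d by (metis openin_Un)
qed

text \<open>As nodes grow at the head, \<open>drop (length s - length t) s\<close> is the ancestor
  of \<open>s\<close> on the level of \<open>t\<close>. If \<open>t\<close> is longer than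
  \<open>s\<close>, the truncated difference makes it \<open>s\<close> itself and the first
  alternative fails. Pieces of one level are disjoint, so a coarser piece containing
  \<open>x\<close> must be an ancestor and a finer one a descendant.\<close>

lemma scheme_mem_iff:
  assumes "x \<in> U s"
  shows "x \<in> U t \<longleftrightarrow> drop (length s - length t) s = t \<or>
    (\<exists>r. t = r @ s \<and> x \<in> U t)"
proof
  assume xt: "x \<in> U t"
  show "drop (length s - length t) s = t \<or> (\<exists>r. t = r @ s \<and> x \<in> U t)"
  proof (cases "length t \<le> length s")
    case True
    let ?s' = "drop (length s - length t) s"
    have "x \<in> U ?s'"
      using assms scheme_append_subset[of "take (length s - length t) s" ?s'] by auto
    moreover have "length ?s' = length t"
      using True by simp
    ultimately show ?thesis
      using scheme_level_disjoint[of ?s' t] xt by (metis IntI empty_iff)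
  next
    case False
    let ?t' = "drop (length t - length s) t"
    have "x \<in> U ?t'"
      using xt scheme_append_subset[of "take (length t - length s) t" ?t'] by auto
    moreover have "length ?t' = length s"
      using False by simp
    ultimately have "?t' = s"
      using scheme_level_disjoint[of ?t' s] assms by (metis IntI empty_iff)
    then show ?thesis
      using xt by (metis append_take_drop_id)
  qed
next
  assume "drop (length s - length t) s = t \<or> (\<exists>r. t = r @ s \<and> x \<in> U t)"
  then show "x \<in> U t"
  proof
    assume "drop (length s - length t) s = t"
    then have "s = take (length s - length t) s @ t"
      by (metis append_take_drop_id)
    then show ?thesis
      using scheme_append_subset[of "take (length s - length t) s" t] assms by (metis subsetD)
  qed auto
qed

lemma scheme_d_mem: "d s \<in> U s"
  using scheme_split[of s] by blast

text \<open>The right-hand side mentions only the two lists. Hence centres with the same address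
  have the same pattern in any two schemes.\<close>

lemma scheme_d_mem_iff: "d s \<in> U t \<longleftrightarrow> drop (length s - length t) s = t"
proof -
  have "r = []" if "d s \<in> U (r @ s)" for r
  proof (rule ccontr)
    assume "r \<noteq> []"
    then obtain r' b where "r = r' @ [b]"
      using rev_exhaust by blast
    then have "d s \<in> U (b # s)"
      using that scheme_append_subset[of r' "b # s"] by auto
    then show False
      using scheme_d by blast
  qed
  then show ?thesis
    using scheme_mem_iff[OF scheme_d_mem, of s t] by auto
qed

lemma scheme_branch:
  assumes "x \<in> topspace X" "\<And>s. x \<noteq> d s"
  shows "\<exists>s. (\<forall>n. length (s n) = n \<and> (\<exists>b. s (Suc n) = b # s n)) \<and> (\<forall>t. x \<in> U t \<longleftrightarrow> s (length t) = t)"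
proof -
  have "\<exists>s. length s = n \<and> x \<in> U s" for n
  proof (induction n)
    case 0
    then show ?case using assms scheme_Nil by auto
  next
    case (Suc n)
    then obtain s where s: "length s = n" "x \<in> U s" by blast
    then have "\<exists>b. x \<in> U (b # s)"
      using scheme_split[of s] assms(2)[of s] by blast
    then obtain b where "x \<in> U (b # s)" ..
    then show ?case
      using s by (intro exI[of _ "b # s"]) simp
  qed
  then have "\<forall>n. \<exists>s. length s = n \<and> x \<in> U s"
    by blast
  from choice[OF this] obtain s where s: "\<And>n. length (s n) = n" "\<And>n. x \<in> U (s n)"
    by blast
  have iff: "x \<in> U t \<longleftrightarrow> s (length t) = t" for t
  proof
    assume "x \<in> U t"
    then show "s (length t) = t"
      using scheme_level_disjoint[of t "s (length t)"] s(1)[of "length t"] s(2)[of "length t"] by (metis IntI empty_iff)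
  next
    assume "s (length t) = t"
    then show "x \<in> U t"
      using s(2)[of "length t"] by simp
  qed
  have "\<exists>b. s (Suc n) = b # s n" for n
  proof -
    obtain b t where t: "s (Suc n) = b # t" "length t = n"
      using s(1)[of "Suc n"] by (cases "s (Suc n)") auto
    then have "x \<in> U t"
      using s(2)[of "Suc n"] scheme_Cons_subset[of b t] by auto
    then show ?thesis
      using iff[of t] t by auto
  qed
  then have "(\<forall>n. length (s n) = n \<and> (\<exists>b. s (Suc n) = b # s n)) \<and> (\<forall>t. (x \<in> U t) = (s (length t) = t))"
    using s(1) iff by blast
  then show ?thesis
    by (rule exI[where x = s])
qed

lemma scheme_sep:
  assumes "x \<in> topspace X" "y \<in> topspace X" "\<And>s. x \<in> U s \<longleftrightarrow> y \<in> U s"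
  shows "x = y"
proof -
  have "\<forall>x\<in>topspace X. \<forall>y\<in>topspace X. (\<forall>s. x \<in> U s \<longleftrightarrow> y \<in> U s) \<longrightarrow> x = y"
    using scheme unfolding pelczynski_scheme_def by (elim conjE)
  from bspec[OF bspec[OF this assms(1)] assms(2)] show ?thesis
    using assms(3) by blast
qed

end

text \<open>A centre is matched with the centre of the same address. Any other point runs through an
  infinite branch, and compactness gives the nested closed pieces along this branch in the other
  space a common point.\<close>

lemma scheme_pattern_transfer:
  assumes X: "pelczynski_scheme X U d" and Y: "pelczynski_scheme Y V e" "compact_space Y"
    and x: "x \<in> topspace X"
  shows "\<exists>y\<in>topspace Y. \<forall>s. x \<in> U s \<longleftrightarrow> y \<in> V s"
proof (cases "\<exists>s. x = d s")
  case True
  then obtain s where "x = d s" by blast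
  moreover have "e s \<in> topspace Y"
    using openin_subset[OF scheme_open_d[OF Y(1), of s]] by simp
  ultimately show ?thesis
    using scheme_d_mem_iff[OF X] scheme_d_mem_iff[OF Y(1)] by (intro bexI[of _ "e s"]) simp
next
  case False
  then have "x \<noteq> d s" for s
    by blast
  from scheme_branch[OF X x this] obtain s where
    "(\<forall>n. length (s n) = n \<and> (\<exists>b. s (Suc n) = b # s n)) \<and> (\<forall>t. x \<in> U t \<longleftrightarrow> s (length t) = t)"
    by (elim exE)
  then have s: "\<And>n. length (s n) = n" "\<And>n. \<exists>b. s (Suc n) = b # s n"
      "\<And>t. x \<in> U t \<longleftrightarrow> s (length t) = t"
    by simp_all
  have "V (s (Suc n)) \<subseteq> V (s n)" for n
  proof -
    obtain b where "s (Suc n) = b # s n"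
      using s(2) by blast
    then show ?thesis
      using scheme_Cons_subset[OF Y(1), of b "s n"] by simp
  qed
  then have "decseq (\<lambda>n. V (s n))"
    by (simp add: decseq_Suc_iff)
  then have "(\<Inter>n. V (s n)) \<noteq> {}"
    using scheme_closed[OF Y(1)] scheme_nonempty[OF Y(1)]
    by (intro compact_space_imp_nest[OF Y(2)]) auto
  then obtain y where y: "\<And>n. y \<in> V (s n)" by blast
  then have "y \<in> V t \<longleftrightarrow> s (length t) = t" for t
    using scheme_level_disjoint[OF Y(1), of t "s (length t)"] s(1) y by (metis IntI empty_iff)
  moreover have "y \<in> topspace Y"
    using y[of 0] openin_subset[OF scheme_open[OF Y(1), of "s 0"]] by blast
  ultimately show ?thesis
    using s(3) by (intro bexI[of _ y]) simp
qed

lemma pelczynski_scheme_unique: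
  assumes "pelczynski_scheme X U d" "compact_space X"
    and "pelczynski_scheme Y V e" "compact_space Y" "Hausdorff_space Y"
  shows "X homeomorphic_space Y"
proof (rule homeomorphic_by_clopen_patterns[OF assms(2,4,5)])
  show "\<exists>x\<in>topspace X. \<forall>i. (x \<in> U i) = (y \<in> V i)" if "y \<in> topspace Y" for y
    using scheme_pattern_transfer[OF assms(3,1,2) that] unfolding eq_commute[of "y \<in> _"] .
  show "\<exists>y\<in>topspace Y. \<forall>i. (x \<in> U i) = (y \<in> V i)" if "x \<in> topspace X" for x
    using scheme_pattern_transfer[OF assms(1,3,4) that] .
qed (fact scheme_open[OF assms(1)] scheme_open[OF assms(3)] scheme_closed[OF assms(1)] scheme_closed[OF assms(3)]
    scheme_sep[OF assms(1)] scheme_sep[OF assms(3)])+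

section \<open>The scheme of Pelczynski space\<close>

text \<open>Keeps the address that \<open>cantor_intervals\<close> forgets; addresses grow at the
  head to match the nodes of a scheme.\<close>

fun cantor_interval :: "bool list \<Rightarrow> real \<times> real"
  where
    "cantor_interval [] = (0, 1)"
  | "cantor_interval (b # s) =
      (let (l, r) = cantor_interval s
       in if b then (r - (r - l) / 3, r) else (l, l + (r - l) / 3))"

declare cantor_interval.simps(2) [simp del]

abbreviation cantor_left where "cantor_left s \<equiv> fst (cantor_interval s)"
abbreviation cantor_right where "cantor_right s \<equiv> snd (cantor_interval s)"

definition cantor_mid :: "bool list \<Rightarrow> real"
  where "cantor_mid s = (cantor_left s + cantor_right s) / 2"

abbreviation cantor_icc where "cantor_icc s \<equiv> {cantor_left s..cantor_right s}"

lemma cantor_length: "cantor_right s - cantor_left s = (1 / 3) ^ length s"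
  by (induction s) (auto simp: cantor_interval.simps Let_def case_prod_beta)

lemma cantor_length_pos: "cantor_left s < cantor_right s"
proof -
  have "0 < cantor_right s - cantor_left s"
    unfolding cantor_length by simp
  then show ?thesis by simp
qed

lemma cantor_intervals_eq: "cantor_intervals n = cantor_interval ` {s. length s = n}"
proof (induction n)
  case (Suc n)
  have "{s :: bool list. length s = Suc n} = (\<Union>s\<in>{s. length s = n}. {True # s, False # s})"
    by (auto simp: length_Suc_conv)
  then show ?case
    by (auto simp: Suc image_UN cantor_interval.simps Let_def case_prod_beta image_iff split: if_splits)
qed auto

lemma cantor_icc_Cons: "cantor_icc (b # s) \<subseteq> cantor_icc s"
  using cantor_length_pos[of s] by (auto simp: cantor_interval.simps Let_def case_prod_beta field_simps)

lemma cantor_icc_append: "cantor_icc (r @ s) \<subseteq> cantor_icc s"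
proof (induction r)
  case (Cons b r)
  then show ?case
    unfolding append_Cons by (rule subset_trans[OF cantor_icc_Cons])
qed simp

lemma cantor_icc_children_disjoint: "cantor_icc (True # s) \<inter> cantor_icc (False # s) = {}"
  using cantor_length_pos[of s] by (auto simp: cantor_interval.simps Let_def case_prod_beta field_simps)

lemma cantor_icc_level_disjoint:
  "length s = length t \<Longrightarrow> s \<noteq> t \<Longrightarrow> cantor_icc s \<inter> cantor_icc t = {}"
proof (induction s t rule: list_induct2)
  case (Cons a s b t)
  show ?case
  proof (cases "s = t")
    case True
    then show ?thesis
      using Cons.prems cantor_icc_children_disjoint[of s]
      by (cases a; cases b) (simp_all add: Int_commute)
  next
    case False
    then show ?thesis
      using Cons.IH cantor_icc_Cons[of a s] cantor_icc_Cons[of b t] by blast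
  qed
qed simp

lemma cantor_mid_mem: "cantor_mid s \<in> cantor_icc s"
  using cantor_length_pos[of s] by (simp add: cantor_mid_def)

lemma cantor_mid_notin_child: "cantor_mid s \<notin> cantor_icc (b # s)"
  using cantor_length_pos[of s] by (auto simp: cantor_mid_def cantor_interval.simps Let_def case_prod_beta field_simps)

lemma finite_lists_of_length: "finite {s :: bool list. length s = n}"
  using finite_lists_length_eq[of "UNIV :: bool set" n] by simp

definition cantor_level :: "nat \<Rightarrow> real set"
  where "cantor_level n = (\<Union>s\<in>{s. length s = n}. cantor_icc s)"

lemma cantor_set_eq: "cantor_set = (\<Inter>n. cantor_level n)"
  by (auto simp: cantor_set_def cantor_level_def cantor_intervals_eq case_prod_beta)

lemma deleted_midpoints_eq: "deleted_midpoints = range cantor_mid"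
  by (auto simp: deleted_midpoints_def cantor_intervals_eq case_prod_beta cantor_mid_def)

lemma cantor_level_Suc: "cantor_level (Suc n) \<subseteq> cantor_level n"
proof
  fix x assume "x \<in> cantor_level (Suc n)"
  then obtain s where s: "length s = Suc n" "x \<in> cantor_icc s"
    by (auto simp: cantor_level_def)
  then obtain b t where "s = b # t" "length t = n"
    by (auto simp: length_Suc_conv)
  then show "x \<in> cantor_level n"
    using s cantor_icc_Cons[of b t] unfolding cantor_level_def by blast
qed

lemma cantor_level_antimono: "m \<le> n \<Longrightarrow> cantor_level n \<subseteq> cantor_level m"
  using lift_Suc_antimono_le[of cantor_level m n] cantor_level_Suc by blast

definition pelczynski_set :: "real set"
  where "pelczynski_set = cantor_set \<union> deleted_midpoints"

text \<open>At stage \<open>n\<close> only finitely many midpoints have left the remaining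
  intervals, since a midpoint of a later stage still lies in them. This presents the set as an
  intersection of closed sets, whence its compactness.\<close>

lemma pelczynski_set_eq:
  "pelczynski_set = (\<Inter>n. cantor_level n \<union> cantor_mid ` {s. length s < n})"
proof (intro equalityI subsetI)
  fix x assume "x \<in> pelczynski_set"
  then consider "x \<in> cantor_set" | s where "x = cantor_mid s"
    by (auto simp: pelczynski_set_def deleted_midpoints_eq)
  then show "x \<in> (\<Inter>n. cantor_level n \<union> cantor_mid ` {s. length s < n})"
  proof cases
    case 2
    have "x \<in> cantor_level n \<union> cantor_mid ` {s. length s < n}" for n
    proof (cases "length s < n")
      case False
      have "x \<in> cantor_level (length s)"
        using 2 cantor_mid_mem[of s] unfolding cantor_level_def by blast
      then show ?thesis
        using cantor_level_antimono[of n "length s"] False by auto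
    qed (use 2 in auto)
    then show ?thesis by blast
  qed (auto simp: cantor_set_eq)
next
  fix x assume x: "x \<in> (\<Inter>n. cantor_level n \<union> cantor_mid ` {s. length s < n})"
  show "x \<in> pelczynski_set"
  proof (cases "x \<in> range cantor_mid")
    case False
    then have "x \<in> cantor_level n" for n
      using x by blast
    then show ?thesis
      by (auto simp: pelczynski_set_def cantor_set_eq)
  qed (auto simp: pelczynski_set_def deleted_midpoints_eq)
qed

lemma closed_cantor_level: "closed (cantor_level n)"
  unfolding cantor_level_def using finite_lists_of_length by (intro closed_UN) auto

lemma pelczynski_set_unit: "pelczynski_set \<subseteq> {0..1}"
proof
  fix x assume "x \<in> pelczynski_set"
  then have "x \<in> cantor_level 0"
    unfolding pelczynski_set_eq by blast
  then show "x \<in> {0..1}"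
    by (simp add: cantor_level_def)
qed

lemma compact_pelczynski_set: "compact pelczynski_set"
proof -
  have "finite {s :: bool list. length s < n}" for n
  proof -
    have "{s :: bool list. length s < n} = (\<Union>m<n. {s. length s = m})" by auto
    then show ?thesis using finite_lists_of_length by simp
  qed
  then have "closed (cantor_level n \<union> cantor_mid ` {s. length s < n})" for n
    by (intro closed_Un[OF closed_cantor_level] finite_imp_closed[OF finite_imageI])
  then have "closed pelczynski_set"
    unfolding pelczynski_set_eq by (intro closed_INT) auto
  moreover have "bounded pelczynski_set"
    using bounded_subset[OF bounded_closed_interval pelczynski_set_unit] .
  ultimately show ?thesis
    by (simp add: compact_eq_bounded_closed)
qed

text \<open>Stage \<open>Suc (length s)\<close> of \<open>pelczynski_set_eq\<close> leaves two
  cases. Either the point survives in an interval of that level, necessarily a child of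
  \<open>s\<close>, or it is a midpoint of level at most \<open>length s\<close>. The second case is
  impossible: the midpoint belongs to a proper ancestor \<open>t\<close> of \<open>s\<close>, and
  \<open>s\<close> lies inside a child of \<open>t\<close>, which misses the midpoint of
  \<open>t\<close>.\<close>

lemma pelczynski_split:
  assumes "x \<in> pelczynski_set" "x \<in> cantor_icc s" "x \<noteq> cantor_mid s"
  shows "\<exists>b. x \<in> cantor_icc (b # s)"
proof -
  have "x \<in> cantor_level (Suc (length s)) \<union> cantor_mid ` {t. length t < Suc (length s)}"
    using assms(1) unfolding pelczynski_set_eq by blast
  then have "\<exists>b t. length t = length s \<and> x \<in> cantor_icc (b # t)"
  proof
    assume "x \<in> cantor_level (Suc (length s))"
    then obtain u where u: "length u = Suc (length s)" "x \<in> cantor_icc u"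
      by (auto simp: cantor_level_def)
    moreover obtain b t where "u = b # t" "length t = length s"
      using u(1) by (auto simp: length_Suc_conv)
    ultimately show ?thesis by blast
  next
    assume "x \<in> cantor_mid ` {t. length t < Suc (length s)}"
    then obtain t where t: "x = cantor_mid t" "length t \<le> length s" by auto
    define u where "u = drop (length s - length t) s"
    have su: "s = take (length s - length t) s @ u" and lu: "length u = length t"
      using t(2) by (simp_all add: u_def)
    have "x \<in> cantor_icc u"
      using assms(2) cantor_icc_append[of "take (length s - length t) s" u] su by auto
    then have ut: "u = t"
      using cantor_icc_level_disjoint[OF lu] cantor_mid_mem[of t] t(1) by auto
    have "take (length s - length t) s \<noteq> []"
      using su ut assms(3) t(1) by auto
    then obtain r b where "take (length s - length t) s = r @ [b]"
      using rev_exhaust by blast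
    then have "s = r @ (b # t)"
      using su ut by simp
    then have "x \<in> cantor_icc (b # t)"
      using assms(2) cantor_icc_append[of r "b # t"] by auto
    then show ?thesis
      using cantor_mid_notin_child t(1) by blast
  qed
  then obtain b t where t: "length t = length s" "x \<in> cantor_icc (b # t)" by blast
  then have "x \<in> cantor_icc t"
    using cantor_icc_Cons[of b t] by blast
  then have "t = s"
    using cantor_icc_level_disjoint[OF t(1)] assms(2) by blast
  then show ?thesis
    using t(2) by blast
qed

lemma pelczynski_set_mid: "cantor_mid s \<in> pelczynski_set"
  by (simp add: pelczynski_set_def deleted_midpoints_eq)

lemma pelczynski_isolated: "openin (top_of_set pelczynski_set) {cantor_mid s}"
proof -
  \<comment> \<open>The gap deleted from the interval of \<open>s\<close>. A point of the set inside
    it lies in no child of \<open>s\<close> and is therefore the midpoint.\<close>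
  define I where "I = {cantor_right (False # s) <..< cantor_left (True # s)}"
  have "pelczynski_set \<inter> I = {cantor_mid s}"
  proof (intro equalityI subsetI)
    fix x assume x: "x \<in> pelczynski_set \<inter> I"
    then have "x \<in> cantor_icc s"
      using cantor_length_pos[of s] by (auto simp: I_def cantor_interval.simps Let_def case_prod_beta field_simps)
    moreover have "x \<notin> cantor_icc (b # s)" for b
      using x cantor_length_pos[of s] by (cases b) (auto simp: I_def)
    ultimately show "x \<in> {cantor_mid s}"
      using pelczynski_split[of x s] x by blast
  next
    have "cantor_mid s \<in> I"
      using cantor_length_pos[of s]
      by (simp add: I_def cantor_mid_def cantor_interval.simps Let_def case_prod_beta field_simps)
    moreover fix x assume "x \<in> {cantor_mid s}"
    ultimately show "x \<in> pelczynski_set \<inter> I"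
      using pelczynski_set_mid[of s] by simp
  qed
  then show ?thesis
    unfolding openin_open by (intro exI[of _ I]) (simp add: I_def)
qed

lemma pelczynski_icc_split:
  "pelczynski_set \<inter> cantor_icc s =
    insert (cantor_mid s) (pelczynski_set \<inter> cantor_icc (True # s) \<union> pelczynski_set \<inter> cantor_icc (False # s))"
    (is "?l = ?r")
proof (intro equalityI subsetI)
  fix x assume x: "x \<in> ?l"
  show "x \<in> ?r"
  proof (cases "x = cantor_mid s")
    case False
    then obtain b where "x \<in> cantor_icc (b # s)"
      using x pelczynski_split[of x s] by blast
    then show ?thesis
      using x by (cases b) auto
  qed blast
next
  fix x assume "x \<in> ?r"
  then consider "x = cantor_mid s" | b where "x \<in> pelczynski_set" "x \<in> cantor_icc (b # s)"
    by blast
  then show "x \<in> ?l"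
    using pelczynski_set_mid cantor_mid_mem cantor_icc_Cons by cases blast+
qed

lemma pelczynski_icc_open: "openin (top_of_set pelczynski_set) (pelczynski_set \<inter> cantor_icc s)"
proof (induction s)
  case Nil
  have "pelczynski_set \<inter> cantor_icc [] = pelczynski_set"
    using pelczynski_set_unit by auto
  then show ?case
    using openin_topspace[of "top_of_set pelczynski_set"] by simp
next
  case (Cons b s)
  have "closedin (top_of_set pelczynski_set) (pelczynski_set \<inter> cantor_icc ((\<not> b) # s))"
    by (intro closedin_closed_Int) auto
  then have cl: "closedin (top_of_set pelczynski_set) (insert (cantor_mid s) (pelczynski_set \<inter> cantor_icc ((\<not> b) # s)))"
    using closedin_Un[of "top_of_set pelczynski_set" "{cantor_mid s}"] closedin_closed_Int[of "{cantor_mid s}" pelczynski_set] pelczynski_set_mid[of s]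
    by simp
  have "pelczynski_set \<inter> cantor_icc (b # s) =
      pelczynski_set \<inter> cantor_icc s - insert (cantor_mid s) (pelczynski_set \<inter> cantor_icc ((\<not> b) # s))"
    using pelczynski_icc_split[of s] cantor_mid_notin_child[of s b] cantor_icc_children_disjoint[of s]
    by (cases b) auto
  then show ?case
    using openin_diff[OF Cons cl] by simp
qed

lemma pelczynski_space_scheme:
  "pelczynski_scheme pelczynski_space (\<lambda>s. pelczynski_set \<inter> cantor_icc s) cantor_mid"
proof -
  have top: "pelczynski_space = top_of_set pelczynski_set"
    by (simp add: pelczynski_space_def pelczynski_set_def)
  have sep: "x = y" if x: "x \<in> pelczynski_set" and y: "y \<in> pelczynski_set"
    and eq: "\<forall>s. x \<in> pelczynski_set \<inter> cantor_icc s \<longleftrightarrow> y \<in> pelczynski_set \<inter> cantor_icc s" for x y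
  proof (rule ccontr)
    assume "x \<noteq> y"
    then obtain n where n: "(1 / 3) ^ n < \<bar>x - y\<bar>"
      using real_arch_pow_inv[of "\<bar>x - y\<bar>" "1 / 3"] by auto
    have *: "\<bar>x - y\<bar> \<le> (1 / 3) ^ length s" if "x \<in> cantor_icc s" for s
    proof -
      have "y \<in> cantor_icc s"
        using that x eq by blast
      then show ?thesis
        using that cantor_length[of s] by auto
    qed
    \<comment> \<open>Both points lie in every piece that contains one of them. If one were the
      midpoint of \<open>s\<close>, the other would lie in a child of \<open>s\<close>, and then so
      would the midpoint. Hence \<open>x\<close> survives to every level, and intervals shorter than
      the distance contain both points.\<close>
    have mid: False if sz: "z = cantor_mid s" "z = x \<or> z = y" for s z
    proof -
      have "{x, y} \<subseteq> cantor_icc s"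
        using sz cantor_mid_mem[of s] x y eq by auto
      moreover obtain w where "w \<in> {x, y}" "w \<noteq> z"
        using \<open>x \<noteq> y\<close> by blast
      ultimately have "w \<in> pelczynski_set" "w \<in> cantor_icc s" "w \<noteq> cantor_mid s"
        using x y sz by auto
      then obtain b where "w \<in> cantor_icc (b # s)"
        using pelczynski_split by blast
      then have "z \<in> cantor_icc (b # s)"
        using \<open>w \<in> {x, y}\<close> sz x y eq by blast
      then show False
        using cantor_mid_notin_child[of s b] sz(1) by simp
    qed
    have "x \<in> cantor_level n"
      using x mid[of x] unfolding pelczynski_set_eq by blast
    then obtain s where "length s = n" "x \<in> cantor_icc s"
      by (auto simp: cantor_level_def)
    then show False
      using *[of s] n by simp
  qed
  show ?thesis
    unfolding pelczynski_scheme_def top topspace_euclidean_subtopology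
  proof (intro conjI allI ballI impI)
    fix s
    show "pelczynski_set \<inter> cantor_icc [] = pelczynski_set"
      using pelczynski_set_unit by auto
    show "pelczynski_set \<inter> cantor_icc s \<noteq> {}"
      using pelczynski_set_mid cantor_mid_mem by blast
    show "(pelczynski_set \<inter> cantor_icc (True # s)) \<inter> (pelczynski_set \<inter> cantor_icc (False # s)) = {}"
      using cantor_icc_children_disjoint by blast
    show "cantor_mid s \<notin> (pelczynski_set \<inter> cantor_icc (True # s)) \<union> (pelczynski_set \<inter> cantor_icc (False # s))"
      using cantor_mid_notin_child by blast
    show "x = y" if "x \<in> pelczynski_set" "y \<in> pelczynski_set"
      "\<forall>s. (x \<in> pelczynski_set \<inter> cantor_icc s) = (y \<in> pelczynski_set \<inter> cantor_icc s)" for x y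
      using sep[OF that] .
  qed (fact pelczynski_icc_open pelczynski_isolated pelczynski_icc_split)+
qed

section \<open>Schemes of spaces with dense isolated points\<close>

text \<open>\<open>no_isolated_limit\<close> makes the set of non-isolated points dense in itself.
  The separating family is enumerated by natural numbers because the tree always treats the least
  index that still splits a piece.\<close>

locale isolated_dense_space =
  fixes X :: "'a topology" and C :: "nat \<Rightarrow> 'a set"
  assumes compact: "compact_space X"
    and Hausdorff: "Hausdorff_space X"
    and C_open: "openin X (C n)"
    and C_closed: "closedin X (C n)"
    and C_separates: "\<lbrakk>x \<in> topspace X; y \<in> topspace X; x \<noteq> y\<rbrakk> \<Longrightarrow> \<exists>n. (x \<in> C n) \<noteq> (y \<in> C n)"
    and isolated_dense: "\<lbrakk>openin X W; W \<noteq> {}\<rbrakk> \<Longrightarrow> \<exists>x\<in>W. openin X {x}"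
    and no_isolated_limit: "\<lbrakk>openin X W; x \<in> W; \<not> openin X {x}\<rbrakk> \<Longrightarrow> \<exists>y\<in>W. y \<noteq> x \<and> \<not> openin X {y}"
    and limit_exists: "\<exists>x\<in>topspace X. \<not> openin X {x}"
begin

definition big :: "'a set \<Rightarrow> bool"
  where "big W \<longleftrightarrow> openin X W \<and> closedin X W \<and> (\<exists>x\<in>W. \<not> openin X {x})"

lemma closedin_singleton: "x \<in> topspace X \<Longrightarrow> closedin X {x}"
  using Hausdorff by (simp add: Hausdorff_imp_t1_space closedin_t1_singleton)

lemma big_infinite:
  assumes "big W" shows "infinite W"
proof
  assume fin: "finite W"
  obtain x where x: "x \<in> W" "\<not> openin X {x}"
    using assms by (auto simp: big_def)
  have "closedin X (\<Union>y\<in>W - {x}. {y})"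
    using fin assms closedin_singleton openin_subset by (intro closedin_Union) (auto simp: big_def)
  then have "closedin X (W - {x})"
    by simp
  then have "openin X (W - (W - {x}))"
    using assms by (intro openin_diff) (auto simp: big_def)
  moreover have "W - (W - {x}) = {x}"
    using x by blast
  ultimately show False
    using x by simp
qed

text \<open>All points are isolated, so the singletons form an open cover of a compact set. Together
  with \<open>big_infinite\<close> this shows that a clopen set is big exactly when it is
  infinite.\<close>

lemma not_big_finite:
  assumes "openin X W" "closedin X W" "\<not> big W" shows "finite W"
proof -
  have op: "openin X {x}" if "x \<in> W" for x
    using assms that by (auto simp: big_def)
  have "compactin X W"
    using closedin_compact_space[OF compact assms(2)] .
  then have "\<exists>F. finite F \<and> F \<subseteq> (\<lambda>x. {x}) ` W \<and> W \<subseteq> \<Union>F"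
    by (rule compactinD) (use op in auto)
  then obtain F where F: "finite F" "F \<subseteq> (\<lambda>x. {x}) ` W" "W \<subseteq> \<Union>F"
    by (elim exE conjE)
  moreover have "finite (\<Union>F)"
    using F(1,2) by (intro finite_Union) auto
  ultimately show ?thesis
    using finite_subset by blast
qed

lemma big_Int_clopen:
  assumes "big W" "x \<in> W \<inter> C n" "\<not> openin X {x}" shows "big (W \<inter> C n)"
  using assms C_open C_closed unfolding big_def by blast

lemma big_Diff_clopen:
  assumes "big W" "x \<in> W - S" "\<not> openin X {x}" "openin X S" "closedin X S"
  shows "big (W - S)"
  unfolding big_def
proof (intro conjI)
  show "openin X (W - S)" "closedin X (W - S)"
    using assms by (auto simp: big_def intro: openin_diff closedin_diff)
qed (use assms in blast)

lemma big_remove_isolated: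
  assumes "big W" "openin X {d}" shows "big (W - {d})"
proof -
  obtain x where x: "x \<in> W" "\<not> openin X {x}"
    using assms by (auto simp: big_def)
  moreover have "closedin X {d}"
    using openin_subset[OF assms(2)] closedin_singleton by simp
  ultimately show ?thesis
    using big_Diff_clopen[OF assms(1), of x "{d}"] assms(2) by blast
qed

lemma big_split:
  assumes "big W" shows "\<exists>n. big (W \<inter> C n) \<and> big (W - C n)"
proof -
  obtain x where x: "x \<in> W" "\<not> openin X {x}"
    using assms by (auto simp: big_def)
  then obtain y where y: "y \<in> W" "y \<noteq> x" "\<not> openin X {y}"
    using assms no_isolated_limit[of W x] by (auto simp: big_def)
  have "W \<subseteq> topspace X"
    using assms openin_subset by (auto simp: big_def)
  then obtain n where n: "(x \<in> C n) \<noteq> (y \<in> C n)"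
    using C_separates[of x y] x y by auto
  then show ?thesis
    using big_Int_clopen[OF assms] big_Diff_clopen[OF assms _ _ C_open C_closed] x y by (metis DiffI IntI)
qed

section \<open>Cutting a piece into a centre and two smaller pieces\<close>

definition splits :: "nat \<Rightarrow> 'a set \<Rightarrow> bool"
  where "splits n W \<longleftrightarrow> W \<inter> C n \<noteq> {} \<and> W - C n \<noteq> {}"

definition idx :: "'a set \<Rightarrow> nat"
  where "idx W = (LEAST n. splits n W)"

lemma big_splits_idx: "big W \<Longrightarrow> splits (idx W) W"
proof -
  assume "big W"
  then obtain n where "big (W \<inter> C n)" "big (W - C n)"
    using big_split by blast
  then have "splits n W"
    unfolding splits_def big_def by blast
  then show ?thesis
    unfolding idx_def by (rule LeastI)
qed

lemma splits_mono: "splits n A \<Longrightarrow> A \<subseteq> W \<Longrightarrow> splits n W"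
  unfolding splits_def by blast

text \<open>The last clause records progress on the least splitting index. In the good case neither
  half is split by \<open>C (idx W)\<close> any longer. If one side of \<open>C (idx W)\<close> has
  no limit point, it is finite and cannot carry a piece; then the centre is taken from it, so that
  it loses a point and is exhausted after finitely many steps.\<close>

definition resolves :: "'a set \<Rightarrow> 'a \<times> 'a set \<times> 'a set \<Rightarrow> bool"
  where "resolves W = (\<lambda>(d, A, B).
    openin X {d} \<and> W = insert d (A \<union> B) \<and> A \<inter> B = {} \<and> d \<notin> A \<union> B \<and> big A \<and> big B \<and>
    (\<not> splits (idx W) A \<and> \<not> splits (idx W) B \<or>
      (\<exists>S\<in>{C (idx W), - C (idx W)}. finite (W \<inter> S) \<and> d \<in> W \<inter> S)))"

lemma resolves_exists:
  assumes W: "big W" shows "\<exists>r. resolves W r"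
proof -
  define n where "n = idx W"
  have n: "splits n W"
    using big_splits_idx[OF W] by (simp add: n_def)
  have opcl: "openin X (W \<inter> C n)" "closedin X (W \<inter> C n)" "openin X (W - C n)" "closedin X (W - C n)"
    using W C_open C_closed by (auto simp: big_def intro: openin_diff closedin_diff)
  show ?thesis
  proof (cases "big (W \<inter> C n) \<and> big (W - C n)")
    case True
    obtain d where d: "d \<in> W \<inter> C n" "openin X {d}"
      using isolated_dense[OF opcl(1)] n by (auto simp: splits_def)
    have "resolves W (d, W \<inter> C n - {d}, W - C n)"
      unfolding resolves_def case_prod_conv n_def[symmetric]
      using d True big_remove_isolated[of "W \<inter> C n" d] by (intro conjI disjI1) (auto simp: splits_def)
    then show ?thesis ..
  next
    case False
    then obtain S where S: "S \<in> {C n, - C n}" "openin X (W \<inter> S)" "closedin X (W \<inter> S)" "\<not> big (W \<inter> S)"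
      using opcl unfolding Diff_eq by blast
    then have fin: "finite (W \<inter> S)"
      using not_big_finite by blast
    obtain d where d: "d \<in> W \<inter> S"
      using n S(1) unfolding splits_def by blast
    then have dop: "openin X {d}"
      using S by (auto simp: big_def)
    \<comment> \<open>The halves come from another index \<open>m\<close>, chosen so that both
      contain limit points; \<open>C n\<close> itself will be dealt with further down.\<close>
    obtain m where m: "big ((W - {d}) \<inter> C m)" "big (W - {d} - C m)"
      using big_split[OF big_remove_isolated[OF W dop]] by blast
    have "resolves W (d, (W - {d}) \<inter> C m, W - {d} - C m)"
      unfolding resolves_def case_prod_conv n_def[symmetric]
      using d dop m fin S(1) by (intro conjI disjI2) auto
    then show ?thesis ..
  qed
qed

definition resolution :: "'a set \<Rightarrow> 'a \<times> 'a set \<times> 'a set"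
  where "resolution W = (SOME r. resolves W r)"

primrec piece :: "bool list \<Rightarrow> 'a set"
  where
    "piece [] = topspace X"
  | "piece (b # s) =
      (if b then fst (snd (resolution (piece s))) else snd (snd (resolution (piece s))))"

definition centre :: "bool list \<Rightarrow> 'a"
  where "centre s = fst (resolution (piece s))"

lemma resolves_resolution: "big W \<Longrightarrow> resolves W (resolution W)"
  unfolding resolution_def using resolves_exists by (rule someI_ex)

lemma big_piece: "big (piece s)"
proof (induction s)
  case Nil
  then show ?case using limit_exists by (auto simp: big_def)
next
  case (Cons b s)
  then show ?case
    using resolves_resolution[OF Cons] by (auto simp: resolves_def case_prod_beta)
qed

lemma piece_resolves: "resolves (piece s) (centre s, piece (True # s), piece (False # s))"
  using resolves_resolution[OF big_piece[of s]] by (simp add: centre_def)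

lemma piece_split: "piece s = insert (centre s) (piece (True # s) \<union> piece (False # s))"
  and piece_disjoint: "piece (True # s) \<inter> piece (False # s) = {}"
  and centre_notin: "centre s \<notin> piece (True # s) \<union> piece (False # s)"
  and centre_open: "openin X {centre s}"
  and piece_progress: "\<not> splits (idx (piece s)) (piece (True # s)) \<and> \<not> splits (idx (piece s)) (piece (False # s)) \<or>
      (\<exists>S\<in>{C (idx (piece s)), - C (idx (piece s))}. finite (piece s \<inter> S) \<and> centre s \<in> piece s \<inter> S)"
proof -
  note * = piece_resolves[of s, unfolded resolves_def case_prod_conv]
  show "piece s = insert (centre s) (piece (True # s) \<union> piece (False # s))"
    using * by (elim conjE)
  show "piece (True # s) \<inter> piece (False # s) = {}"
    using * by (elim conjE)
  show "centre s \<notin> piece (True # s) \<union> piece (False # s)"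
    using * by (elim conjE)
  show "openin X {centre s}"
    using * by (elim conjE)
  show "\<not> splits (idx (piece s)) (piece (True # s)) \<and> \<not> splits (idx (piece s)) (piece (False # s)) \<or>
      (\<exists>S\<in>{C (idx (piece s)), - C (idx (piece s))}. finite (piece s \<inter> S) \<and> centre s \<in> piece s \<inter> S)"
    using * by (elim conjE)
qed

lemma piece_Cons_subset: "piece (b # s) \<subseteq> piece s - {centre s}"
proof -
  have "piece (True # s) \<subseteq> piece s - {centre s}" "piece (False # s) \<subseteq> piece s - {centre s}"
    using piece_split[of s] centre_notin[of s] by blast+
  then show ?thesis
    by (cases b) auto
qed

text \<open>Along a branch the least index of a \<open>C n\<close> that splits the current piece never decreases.
  If two points stayed together for ever, this index would become constant, and from then on one
  side of the splitting would be finite and lose a point at every step.\<close>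

lemma piece_separates:
  assumes xy: "x \<in> topspace X" "y \<in> topspace X" "x \<noteq> y"
    and same: "\<And>s. x \<in> piece s \<longleftrightarrow> y \<in> piece s"
  shows False
proof -
  have child: "\<exists>b. x \<in> piece (b # s)" if "x \<in> piece s" for s
  proof -
    have "y \<in> piece s"
      using that same by blast
    then have "x \<in> insert (centre s) (piece (True # s) \<union> piece (False # s))"
      "y \<in> insert (centre s) (piece (True # s) \<union> piece (False # s))"
      using that piece_split[of s] by (metis, metis)
    then have "x \<in> piece (True # s) \<union> piece (False # s) \<or> y \<in> piece (True # s) \<union> piece (False # s)"
      using xy(3) by blast
    then show ?thesis
      using same[of "True # s"] same[of "False # s"] by blast
  qed
  define t where "t = rec_nat [] (\<lambda>_ s. (SOME b. x \<in> piece (b # s)) # s)"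
  have t0: "t 0 = []" and tSuc: "t (Suc n) = (SOME b. x \<in> piece (b # t n)) # t n" for n
    by (simp_all add: t_def)
  have xt: "x \<in> piece (t n)" for n
  proof (induction n)
    case (Suc n)
    show ?case
      unfolding tSuc by (rule someI_ex[OF child[OF Suc]])
  qed (simp add: t0 xy)
  have yt: "y \<in> piece (t n)" for n
    using xt same by blast
  have step: "piece (t (Suc n)) \<subseteq> piece (t n) - {centre (t n)}" for n
    unfolding tSuc by (rule piece_Cons_subset)
  obtain m where m: "(x \<in> C m) \<noteq> (y \<in> C m)"
    using C_separates xy by blast
  have splm: "splits m (piece (t n))" for n
    using xt[of n] yt[of n] m unfolding splits_def by blast
  define k where "k n = idx (piece (t n))" for n
  have k_le: "k n \<le> m" for n
    unfolding k_def idx_def using splm by (rule Least_le)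
  have k_Suc: "k n \<le> k (Suc n)" for n
  proof -
    have "splits (k (Suc n)) (piece (t (Suc n)))"
      unfolding k_def using big_piece by (rule big_splits_idx)
    then have "splits (k (Suc n)) (piece (t n))"
      using step[of n] splits_mono by blast
    then show ?thesis
      unfolding k_def idx_def[of "piece (t n)"] by (rule Least_le)
  qed
  have k_mono: "i \<le> j \<Longrightarrow> k i \<le> k j" for i j
    using lift_Suc_mono_le[of k i j] k_Suc by blast
  have "finite (range k)"
    using k_le by (intro finite_subset[of "range k" "{..m}"]) auto
  then have "Max (range k) \<in> range k"
    by (intro Max_in) auto
  then obtain N where N: "k N = Max (range k)"
    by auto
  have kN: "k n = k N" if "n \<ge> N" for n
    using k_mono[OF that] Max_ge[OF \<open>finite (range k)\<close>, of "k n"] N by simp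
  define K where "K = C (k N)"
  have prog: "\<exists>S\<in>{K, - K}. finite (piece (t n) \<inter> S) \<and> centre (t n) \<in> piece (t n) \<inter> S" if "n \<ge> N" for n
  proof -
    have idx: "idx (piece (t n)) = k N"
      using kN[OF that] by (simp add: k_def)
    have "splits (k (Suc n)) (piece (t (Suc n)))"
      unfolding k_def using big_piece by (rule big_splits_idx)
    then have "splits (k N) (piece (t (Suc n)))"
      using kN[of "Suc n"] that by simp
    then have "splits (k N) (piece (True # t n)) \<or> splits (k N) (piece (False # t n))"
      unfolding tSuc by (cases "SOME b. x \<in> piece (b # t n)") auto
    then show ?thesis
      using piece_progress[of "t n"] unfolding idx K_def by blast
  qed
  then obtain S where S: "S \<in> {K, - K}" "finite (piece (t N) \<inter> S)"
    by blast
  have decr: "finite (piece (t n) \<inter> S) \<and> card (piece (t n) \<inter> S) + (n - N) \<le> card (piece (t N) \<inter> S)" if "n \<ge> N" for n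
    using that
  proof (induction n rule: dec_induct)
    case (step n)
    then have fin: "finite (piece (t n) \<inter> S)" by simp
    \<comment> \<open>The finite side might a priori depend on \<open>n\<close>. If at some step it
      were the side opposite to \<open>S\<close>, both parts of the piece would be finite, whereas
      pieces are infinite.\<close>
    have "centre (t n) \<in> piece (t n) \<inter> S"
    proof (rule ccontr)
      assume "centre (t n) \<notin> piece (t n) \<inter> S"
      then have "finite (piece (t n) \<inter> - S)"
        using prog[OF step(1)] S(1) by auto
      moreover have "piece (t n) = piece (t n) \<inter> S \<union> piece (t n) \<inter> - S"
        by blast
      ultimately have "finite (piece (t n))"
        using fin by (metis finite_Un)
      then show False
        using big_infinite[OF big_piece] by blast
    qed
    then have "piece (t (Suc n)) \<inter> S \<subset> piece (t n) \<inter> S"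
      using \<open>\<And>n. piece (t (Suc n)) \<subseteq> piece (t n) - {centre (t n)}\<close>[of n] by blast
    then have "card (piece (t (Suc n)) \<inter> S) < card (piece (t n) \<inter> S)" "finite (piece (t (Suc n)) \<inter> S)"
      using fin psubset_card_mono finite_subset by blast+
    then show ?case
      using step by linarith
  qed (use S in simp)
  show False
    using decr[of "N + Suc (card (piece (t N) \<inter> S))"] by simp
qed

lemma scheme_exists: "pelczynski_scheme X piece centre"
  unfolding pelczynski_scheme_def
proof (intro conjI allI ballI impI)
  fix s
  show "openin X (piece s)" "piece s \<noteq> {}"
    using big_piece[of s] by (auto simp: big_def)
  show "x = y" if "x \<in> topspace X" "y \<in> topspace X" "\<forall>s. (x \<in> piece s) = (y \<in> piece s)" for x y
    using piece_separates[of x y] that by blast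
qed (fact centre_open piece_split piece_disjoint centre_notin piece.simps(1))+

end

section \<open>Profinite groups\<close>

context topological_group
begin

abbreviation cl where "cl S \<equiv> T closure_of S"
abbreviation csub where "csub H \<equiv> closed_subgroup G T H"
abbreviation onorm where "onorm N \<equiv> open_normal G T N"

lemma continuous_map_mult:
  assumes "continuous_map X T f" "continuous_map X T g"
  shows "continuous_map X T (\<lambda>x. f x \<otimes> g x)"
proof -
  have "continuous_map X T ((\<lambda>(x, y). x \<otimes> y) \<circ> (\<lambda>x. (f x, g x)))"
    using assms by (intro continuous_map_compose[OF _ continuous_mult]) (simp add: continuous_map_pairedI)
  then show ?thesis
    by (simp add: comp_def)
qed

lemma continuous_map_inv:
  assumes "continuous_map X T f"
  shows "continuous_map X T (\<lambda>x. inv (f x))"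
  using continuous_map_compose[OF assms continuous_inv] by (simp add: comp_def)

lemma continuous_map_ident: "continuous_map T T (\<lambda>x. x)"
  using continuous_map_id by (simp add: id_def)

lemma continuous_map_constant: "a \<in> carrier G \<Longrightarrow> continuous_map X T (\<lambda>x. a)"
  by (simp add: continuous_map_const topspace_eq)

lemmas continuous_word = continuous_map_mult continuous_map_inv continuous_map_ident continuous_map_constant

lemma closedin_word:
  assumes "continuous_map T T f" "closedin T B"
  shows "closedin T {x \<in> carrier G. f x \<in> B}"
  using closedin_continuous_map_preimage[OF assms] by (simp add: topspace_eq)

lemma openin_word:
  assumes "continuous_map T T f" "openin T B"
  shows "openin T {x \<in> carrier G. f x \<in> B}"
  using openin_continuous_map_preimage[OF assms] by (simp add: topspace_eq)

lemma openin_translate: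
  assumes "openin T U" "a \<in> carrier G"
  shows "openin T {x \<in> carrier G. a \<otimes> x \<in> U}"
  using assms by (intro openin_word continuous_word) auto

lemma csub_subgroup: "csub H \<Longrightarrow> subgroup H G"
  and csub_closedin: "csub H \<Longrightarrow> closedin T H"
  by (auto simp: closed_subgroup_def)

lemma csub_carrier: "csub H \<Longrightarrow> H \<subseteq> carrier G"
  using csub_subgroup subgroup.subset by blast

lemma csub_one: "csub H \<Longrightarrow> \<one> \<in> H"
  and csub_mult: "csub H \<Longrightarrow> x \<in> H \<Longrightarrow> y \<in> H \<Longrightarrow> x \<otimes> y \<in> H"
  and csub_inv: "csub H \<Longrightarrow> x \<in> H \<Longrightarrow> inv x \<in> H"
  using csub_subgroup by (auto simp: subgroup.one_closed subgroup.m_closed subgroup.m_inv_closed)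

lemma csub_whole: "csub (carrier G)"
  using closedin_topspace[of T] by (simp add: closed_subgroup_def subgroup_self topspace_eq)

lemma csub_Int: "csub H \<Longrightarrow> csub K \<Longrightarrow> csub (H \<inter> K)"
  by (auto simp: closed_subgroup_def subgroups_Inter_pair)

lemma onorm_subgroup: "onorm N \<Longrightarrow> subgroup N G"
  by (simp add: open_normal_def normal_imp_subgroup)

lemma onorm_conj:
  assumes "onorm N" "x \<in> carrier G" "n \<in> N"
  shows "x \<otimes> n \<otimes> inv x \<in> N" "inv x \<otimes> n \<otimes> x \<in> N"
  using assms normal.inv_op_closed1[of N G x n] normal.inv_op_closed2[of N G x n]
  by (auto simp: open_normal_def)

lemma open_subgroup_closed:
  assumes H: "subgroup H G" "openin T H"
  shows "closedin T H"
proof -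
  have "openin T {y \<in> carrier G. inv x \<otimes> y \<in> H}" if "x \<in> carrier G" for x
    using openin_translate[OF H(2), of "inv x"] that by simp
  then have "openin T (\<Union>x\<in>carrier G - H. {y \<in> carrier G. inv x \<otimes> y \<in> H})"
    by (intro openin_Union) auto
  moreover have "(\<Union>x\<in>carrier G - H. {y \<in> carrier G. inv x \<otimes> y \<in> H}) = carrier G - H"
  proof (intro equalityI subsetI)
    fix y assume "y \<in> (\<Union>x\<in>carrier G - H. {y \<in> carrier G. inv x \<otimes> y \<in> H})"
    then obtain x where x: "x \<in> carrier G" "x \<notin> H" "y \<in> carrier G" "inv x \<otimes> y \<in> H"
      by auto
    have "y \<notin> H"
    proof
      assume "y \<in> H"
      then have "y \<otimes> inv (inv x \<otimes> y) \<in> H"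
        using x H by (simp add: subgroup.m_closed subgroup.m_inv_closed)
      then show False
        using x by (simp add: inv_mult_group m_assoc[symmetric])
    qed
    then show "y \<in> carrier G - H"
      using x by simp
  next
    fix y assume "y \<in> carrier G - H"
    then show "y \<in> (\<Union>x\<in>carrier G - H. {y \<in> carrier G. inv x \<otimes> y \<in> H})"
      using subgroup.one_closed[OF H(1)] by (intro UN_I[of y]) auto
  qed
  ultimately show ?thesis
    using subgroup.subset[OF H(1)] by (simp add: closedin_def topspace_eq)
qed

lemma onorm_csub: "onorm N \<Longrightarrow> csub N"
  using open_subgroup_closed onorm_subgroup by (simp add: closed_subgroup_def open_normal_def)

lemma onorm_Int: "onorm N \<Longrightarrow> onorm M \<Longrightarrow> onorm (N \<inter> M)"
  by (simp add: open_normal_def normal_subgroup_intersect openin_Int)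

lemma onorm_whole: "onorm (carrier G)"
  using openin_topspace[of T] by (simp add: open_normal_def normal_self topspace_eq)

lemma closure_approx:
  assumes "x \<in> cl S" "onorm N" "S \<subseteq> carrier G"
  shows "\<exists>s\<in>S. inv s \<otimes> x \<in> N"
proof -
  have x: "x \<in> carrier G"
    using assms(1) closure_of_subset_topspace[of T S] by (auto simp: topspace_eq)
  have "openin T {y \<in> carrier G. inv x \<otimes> y \<in> N}"
    using openin_translate[of N "inv x"] assms(2) x by (simp add: open_normal_def)
  moreover have "x \<in> {y \<in> carrier G. inv x \<otimes> y \<in> N}"
    using x csub_one[OF onorm_csub[OF assms(2)]] by simp
  moreover have "\<forall>U. x \<in> U \<and> openin T U \<longrightarrow> (\<exists>s. s \<in> S \<and> s \<in> U)"
    using assms(1) unfolding in_closure_of by (elim conjE)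
  ultimately have "\<exists>s. s \<in> S \<and> s \<in> {y \<in> carrier G. inv x \<otimes> y \<in> N}"
    by (elim allE[of _ "{y \<in> carrier G. inv x \<otimes> y \<in> N}"]) (rule mp, assumption, rule conjI)
  then obtain s where s: "s \<in> S" "inv x \<otimes> s \<in> N" "s \<in> carrier G"
    by auto
  then have "inv (inv x \<otimes> s) \<in> N"
    using csub_inv[OF onorm_csub[OF assms(2)]] by blast
  then show ?thesis
    using s x by (auto simp: inv_mult_group)
qed

lemma closure_subset_carrier: "cl S \<subseteq> carrier G"
  using closure_of_subset_topspace[of T S] by (simp add: topspace_eq)

lemma closure_superset: "S \<subseteq> carrier G \<Longrightarrow> S \<subseteq> cl S"
  using closure_of_subset[of S T] by (simp add: topspace_eq)

lemma closure_minimal: "S \<subseteq> A \<Longrightarrow> closedin T A \<Longrightarrow> cl S \<subseteq> A"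
  by (rule closure_of_minimal)

lemma csub_closure:
  assumes H: "subgroup H G"
  shows "csub (cl H)"
  unfolding closed_subgroup_def
proof
  have HG: "H \<subseteq> carrier G"
    using H by (rule subgroup.subset)
  have inv: "inv x \<in> cl H" if "x \<in> cl H" for x
  proof -
    have "cl H \<subseteq> {x \<in> carrier G. inv x \<in> cl H}"
      using H HG closure_superset[OF HG] subgroup.m_inv_closed[OF H]
      by (intro closure_minimal closedin_word continuous_word) auto
    then show ?thesis using that by blast
  qed
  have m1: "h \<otimes> x \<in> cl H" if "x \<in> cl H" "h \<in> H" for x h
  proof -
    have "cl H \<subseteq> {x \<in> carrier G. h \<otimes> x \<in> cl H}"
      using HG closure_superset[OF HG] subgroup.m_closed[OF H] that(2)
      by (intro closure_minimal closedin_word continuous_word) auto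
    then show ?thesis using that by blast
  qed
  \<comment> \<open>The closure is taken once for each factor: first with the left factor in
    \<open>H\<close>, then with the right factor fixed in the closure.\<close>
  have m2: "y \<otimes> x \<in> cl H" if "x \<in> cl H" "y \<in> cl H" for x y
  proof -
    have "cl H \<subseteq> {y \<in> carrier G. y \<otimes> x \<in> cl H}"
      using HG m1[OF that(1)] that(1) closure_subset_carrier
      by (intro closure_minimal closedin_word continuous_word) auto
    then show ?thesis using that by blast
  qed
  show "subgroup (cl H) G"
    using closure_subset_carrier closure_superset[OF HG] subgroup.one_closed[OF H] inv m2
    by (intro subgroupI) auto
qed simp

definition gen :: "'a \<Rightarrow> 'a set"
  where "gen x = cl (generate G {x})"

lemma csub_gen: "x \<in> carrier G \<Longrightarrow> csub (gen x)"
  unfolding gen_def by (intro csub_closure generate_is_subgroup) auto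

lemma gen_self: "x \<in> carrier G \<Longrightarrow> x \<in> gen x"
  unfolding gen_def using closure_superset[OF generate_incl[of "{x}"]] generate.incl[of x "{x}" G] by auto

lemma gen_minimal: "csub A \<Longrightarrow> x \<in> A \<Longrightarrow> gen x \<subseteq> A"
  unfolding gen_def
  by (intro closure_minimal) (auto simp: closed_subgroup_def dest: generate_subgroup_incl[of "{x}", rotated])

text \<open>For an arbitrary set \<open>B\<close> the inclusion of \<open>x B inv x\<close> in
  \<open>B\<close> may be proper. Requiring both conjugations yields the normalizer and makes
  closure under inverses a matter of symmetry.\<close>

definition normz :: "'a set \<Rightarrow> 'a set"
  where "normz B = {x \<in> carrier G. \<forall>b\<in>B. x \<otimes> b \<otimes> inv x \<in> B \<and> inv x \<otimes> b \<otimes> x \<in> B}"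

lemma normz_carrier: "normz B \<subseteq> carrier G"
  by (auto simp: normz_def)

lemma normz_conj: "x \<in> normz B \<Longrightarrow> b \<in> B \<Longrightarrow> x \<otimes> b \<otimes> inv x \<in> B"
  and normz_conj': "x \<in> normz B \<Longrightarrow> b \<in> B \<Longrightarrow> inv x \<otimes> b \<otimes> x \<in> B"
  by (auto simp: normz_def)

lemma normz_inv: "x \<in> normz B \<Longrightarrow> inv x \<in> normz B"
  by (auto simp: normz_def)

lemma subgroup_normz:
  assumes "B \<subseteq> carrier G" shows "subgroup (normz B) G"
proof (rule subgroupI)
  show "normz B \<noteq> {}"
    using assms by (auto simp: normz_def intro!: exI[of _ \<one>])
  fix x y assume x: "x \<in> normz B" and y: "y \<in> normz B"
  then have [simp]: "x \<in> carrier G" "y \<in> carrier G"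
    using normz_carrier by auto
  have "(x \<otimes> y) \<otimes> b \<otimes> inv (x \<otimes> y) \<in> B \<and> inv (x \<otimes> y) \<otimes> b \<otimes> (x \<otimes> y) \<in> B" if b: "b \<in> B" for b
  proof -
    have [simp]: "b \<in> carrier G" using b assms by blast
    have "x \<otimes> (y \<otimes> b \<otimes> inv y) \<otimes> inv x \<in> B" "inv y \<otimes> (inv x \<otimes> b \<otimes> x) \<otimes> y \<in> B"
      using normz_conj[OF x normz_conj[OF y b]] normz_conj'[OF y normz_conj'[OF x b]] .
    then show ?thesis
      by (simp add: inv_mult_group m_assoc)
  qed
  then show "x \<otimes> y \<in> normz B"
    by (simp add: normz_def)
qed (use normz_carrier normz_inv in auto)

lemma csub_normz:
  assumes "csub B" shows "csub (normz B)"
proof -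
  have "closedin T (carrier G \<inter> (\<Inter>b\<in>B. {x \<in> carrier G. x \<otimes> b \<otimes> inv x \<in> B} \<inter> {x \<in> carrier G. inv x \<otimes> b \<otimes> x \<in> B}))"
  proof (cases "B = {}")
    case False
    have "closedin T (\<Inter>b\<in>B. {x \<in> carrier G. x \<otimes> b \<otimes> inv x \<in> B} \<inter> {x \<in> carrier G. inv x \<otimes> b \<otimes> x \<in> B})"
      using False assms csub_carrier[OF assms]
      by (intro closedin_INT closedin_Int closedin_word continuous_word) (auto simp: csub_closedin)
    then show ?thesis
      using closedin_topspace[of T] by (simp add: topspace_eq closedin_Int)
  qed (use csub_one[OF assms] in auto)
  also have "carrier G \<inter> (\<Inter>b\<in>B. {x \<in> carrier G. x \<otimes> b \<otimes> inv x \<in> B} \<inter> {x \<in> carrier G. inv x \<otimes> b \<otimes> x \<in> B}) = normz B"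
    by (auto simp: normz_def)
  finally show ?thesis
    using subgroup_normz[OF csub_carrier[OF assms]] by (simp add: closed_subgroup_def)
qed

lemma subgroup_subset_normz:
  assumes "subgroup B G" shows "B \<subseteq> normz B"
  using assms subgroup.subset[OF assms]
  by (auto simp: normz_def subgroup.m_closed subgroup.m_inv_closed)

lemma gen_subset_normz: "csub B \<Longrightarrow> x \<in> normz B \<Longrightarrow> gen x \<subseteq> normz B"
  by (intro gen_minimal csub_normz)

lemma onorm_normz: "onorm N \<Longrightarrow> normz N = carrier G"
  using onorm_conj by (auto simp: normz_def)

lemma set_mult_iff: "x \<in> A <#> B \<longleftrightarrow> (\<exists>a\<in>A. \<exists>b\<in>B. x = a \<otimes> b)"
  by (auto simp: set_mult_def)

lemma set_multI: "a \<in> A \<Longrightarrow> b \<in> B \<Longrightarrow> a \<otimes> b \<in> A <#> B"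
  by (auto simp: set_mult_def)

lemma set_mult_superset:
  assumes "subgroup A G" "subgroup B G"
  shows "A \<subseteq> A <#> B" "B \<subseteq> A <#> B"
proof -
  have "a = a \<otimes> \<one>" if "a \<in> A" for a
    using that subgroup.subset[OF assms(1)] by auto
  then show "A \<subseteq> A <#> B"
    using subgroup.one_closed[OF assms(2)] unfolding set_mult_def by blast
  have "b = \<one> \<otimes> b" if "b \<in> B" for b
    using that subgroup.subset[OF assms(2)] by auto
  then show "B \<subseteq> A <#> B"
    using subgroup.one_closed[OF assms(1)] unfolding set_mult_def by blast
qed

lemma set_mult_minimal:
  assumes "subgroup C G" "A \<subseteq> C" "B \<subseteq> C" shows "A <#> B \<subseteq> C"
  using assms subgroup.m_closed[OF assms(1)] by (auto simp: set_mult_def)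

lemma subgroup_set_mult:
  assumes A: "subgroup A G" and B: "subgroup B G" and AB: "A \<subseteq> normz B"
  shows "subgroup (A <#> B) G"
proof (rule subgroupI)
  have [simp]: "a \<in> carrier G" if "a \<in> A" for a using that subgroup.subset[OF A] by blast
  have [simp]: "b \<in> carrier G" if "b \<in> B" for b using that subgroup.subset[OF B] by blast
  show "A <#> B \<subseteq> carrier G"
    by (auto simp: set_mult_def)
  show "A <#> B \<noteq> {}"
    using set_mult_superset(1)[OF A B] subgroup.one_closed[OF A] by blast
  fix x assume "x \<in> A <#> B"
  then obtain a b where x: "a \<in> A" "b \<in> B" "x = a \<otimes> b"
    by (auto simp: set_mult_def)
  have "inv a \<otimes> (a \<otimes> inv b \<otimes> inv a) \<in> A <#> B"
    using x AB normz_conj[of a B "inv b"] subgroup.m_inv_closed[OF A] subgroup.m_inv_closed[OF B] by (intro set_multI) auto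
  moreover have "inv a \<otimes> (a \<otimes> inv b \<otimes> inv a) = inv x"
    using x by (simp add: inv_mult_group m_assoc[symmetric])
  ultimately show "inv x \<in> A <#> B" by simp
  fix y assume "y \<in> A <#> B"
  then obtain c d where y: "c \<in> A" "d \<in> B" "y = c \<otimes> d"
    by (auto simp: set_mult_def)
  have "(a \<otimes> c) \<otimes> ((inv c \<otimes> b \<otimes> c) \<otimes> d) \<in> A <#> B"
    using x y AB normz_conj'[of c B b] subgroup.m_closed[OF A] subgroup.m_closed[OF B] by (intro set_multI) auto
  moreover have "(a \<otimes> c) \<otimes> ((inv c \<otimes> b \<otimes> c) \<otimes> d) = x \<otimes> y"
  proof -
    have "c \<otimes> (inv c \<otimes> (b \<otimes> (c \<otimes> d))) = b \<otimes> (c \<otimes> d)"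
      using x y by (simp add: m_assoc[symmetric])
    then show ?thesis
      using x y by (simp add: m_assoc)
  qed
  ultimately show "x \<otimes> y \<in> A <#> B" by simp
qed

lemma openin_set_mult:
  assumes "A \<subseteq> carrier G" "openin T N" "N \<subseteq> carrier G"
  shows "openin T (A <#> N)"
proof -
  have "openin T (\<Union>a\<in>A. {y \<in> carrier G. inv a \<otimes> y \<in> N})"
    using openin_translate[OF assms(2)] assms(1) by (intro openin_Union) auto
  also have "(\<Union>a\<in>A. {y \<in> carrier G. inv a \<otimes> y \<in> N}) = A <#> N"
  proof (intro equalityI subsetI)
    fix y assume "y \<in> (\<Union>a\<in>A. {y \<in> carrier G. inv a \<otimes> y \<in> N})"
    then obtain a where a: "a \<in> A" "y \<in> carrier G" "inv a \<otimes> y \<in> N" by auto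
    then have "y = a \<otimes> (inv a \<otimes> y)"
      using assms(1) by (auto simp: m_assoc[symmetric])
    then show "y \<in> A <#> N"
      using a set_multI by metis
  next
    fix y assume "y \<in> A <#> N"
    then obtain a n where a: "a \<in> A" "n \<in> N" "y = a \<otimes> n" by (auto simp: set_mult_def)
    then have "a \<in> carrier G" "n \<in> carrier G"
      using assms by auto
    then have "inv a \<otimes> y = n"
      using a by (simp add: m_assoc[symmetric])
    then show "y \<in> (\<Union>a\<in>A. {y \<in> carrier G. inv a \<otimes> y \<in> N})"
      using a \<open>a \<in> carrier G\<close> \<open>n \<in> carrier G\<close> by (intro UN_I[of a]) auto
  qed
  finally show ?thesis .
qed

lemma subgroup_open_if_contains:
  assumes "subgroup H G" "onorm N" "N \<subseteq> H"
  shows "openin T H"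
proof -
  have "H <#> N = H"
    using set_mult_superset(1)[OF assms(1) onorm_subgroup[OF assms(2)]]
      set_mult_minimal[OF assms(1) order_refl assms(3)] by blast
  then show ?thesis
    using openin_set_mult[OF subgroup.subset[OF assms(1)], of N] assms(2) subgroup.subset[OF onorm_subgroup[OF assms(2)]]
    by (simp add: open_normal_def)
qed

lemma set_mult_onorm:
  assumes "subgroup H G" "onorm N"
  shows "subgroup (H <#> N) G" "openin T (H <#> N)" "csub (H <#> N)"
proof -
  show *: "subgroup (H <#> N) G"
    using subgroup_set_mult[OF assms(1) onorm_subgroup[OF assms(2)]] onorm_normz[OF assms(2)]
      subgroup.subset[OF assms(1)] by simp
  show "openin T (H <#> N)"
    using subgroup_open_if_contains[OF * assms(2)] set_mult_superset(2)[OF assms(1) onorm_subgroup[OF assms(2)]] .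
  then show "csub (H <#> N)"
    using * open_subgroup_closed by (simp add: closed_subgroup_def)
qed

end

section \<open>Open normal subgroups and the separation of points from closed sets\<close>

context profinite_group
begin

text \<open>In a compact Hausdorff space components coincide with quasi-components, that is, with
  intersections of clopen sets; here they are points. Each point outside \<open>U\<close> is thus
  cut off from \<open>x\<close> by a clopen set, and compactness of the complement of
  \<open>U\<close> reduces this to finitely many.\<close>

lemma clopen_nbhd:
  assumes "openin T U" "x \<in> U"
  shows "\<exists>V. openin T V \<and> closedin T V \<and> x \<in> V \<and> V \<subseteq> U"
proof -
  have x: "x \<in> topspace T"
    using assms openin_subset by blast
  have "quasi_components_of T = connected_components_of T"
    using quasi_eq_connected_components_of compact Hausdorff by blast
  then have "quasi_component_of T x = connected_component_of T x"
    using x unfolding quasi_eq_connected_components_of_pointwise by simp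
  then have conn: "connectedin T (quasi_component_of_set T x)"
    by (simp add: connectedin_connected_component_of)
  define F where "F = {V. openin T V \<and> closedin T V \<and> x \<in> V}"
  have cover: "topspace T - U \<subseteq> \<Union>((\<lambda>V. topspace T - V) ` F)"
  proof
    fix y assume y: "y \<in> topspace T - U"
    then have "y \<noteq> x"
      using assms by blast
    then have "\<not> quasi_component_of T x y"
      using totally_disconnected[OF conn, of x y] x by (metis mem_Collect_eq quasi_component_of_refl)
    then obtain V where "x \<in> V" "closedin T V" "openin T V" "y \<notin> V"
      using x y unfolding quasi_component_of by auto
    then show "y \<in> \<Union>((\<lambda>V. topspace T - V) ` F)"
      using y by (auto simp: F_def)
  qed
  have "compactin T (topspace T - U)"
    using assms(1) compact closedin_compact_space openin_closedin_eq by blast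
  then have "\<exists>H. finite H \<and> H \<subseteq> (\<lambda>V. topspace T - V) ` F \<and> topspace T - U \<subseteq> \<Union>H"
    by (rule compactinD) (use cover in \<open>auto simp: F_def closedin_def\<close>)
  then obtain H where H: "finite H" "H \<subseteq> (\<lambda>V. topspace T - V) ` F" "topspace T - U \<subseteq> \<Union>H"
    by (elim exE conjE)
  define W where "W = topspace T \<inter> (\<Inter>h\<in>H. topspace T - h)"
  have cop: "openin T (topspace T - h) \<and> closedin T (topspace T - h) \<and> x \<in> topspace T - h" if h: "h \<in> H" for h
  proof -
    obtain V where V: "V \<in> F" "h = topspace T - V"
      using H(2) h by blast
    then have "topspace T - h = V"
      using openin_subset[of T V] by (auto simp: F_def)
    then show ?thesis
      using V by (simp add: F_def)
  qed
  have "openin T W"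
    unfolding W_def using H(1) cop by (intro openin_Int_Inter) auto
  moreover have "closedin T W"
  proof (cases "H = {}")
    case False
    then show ?thesis
      unfolding W_def using cop by (intro closedin_Int closedin_INT) auto
  qed (simp add: W_def)
  moreover have "x \<in> W"
    using cop x by (auto simp: W_def)
  moreover have "W \<subseteq> U"
    using H(3) by (auto simp: W_def)
  ultimately show ?thesis by blast
qed

text \<open>After shrinking to a clopen \<open>U\<close>, the group \<open>N\<close> consists of the
  elements all of whose conjugates, together with those of the inverse, carry \<open>U\<close> into
  itself by right translation. Quantifying over all conjugates makes \<open>N\<close> normal, and
  \<open>\<one> \<in> U\<close> places it inside \<open>U\<close>.\<close>

lemma open_normal_nbhd:
  assumes "openin T U0" "\<one> \<in> U0"
  shows "\<exists>N. onorm N \<and> N \<subseteq> U0"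
proof -
  obtain U where U: "openin T U" "closedin T U" "\<one> \<in> U" "U \<subseteq> U0"
    using clopen_nbhd[OF assms] by blast
  have [simp]: "u \<in> carrier G" if "u \<in> U" for u
    using openin_subset[OF U(1)] that by (auto simp: topspace_eq)
  define N where "N = {x \<in> carrier G. \<forall>g\<in>carrier G. \<forall>u\<in>U.
    u \<otimes> (g \<otimes> x \<otimes> inv g) \<in> U \<and> u \<otimes> (g \<otimes> inv x \<otimes> inv g) \<in> U}"
  have NU: "N \<subseteq> U"
  proof
    fix x assume x: "x \<in> N"
    then have "\<one> \<otimes> (\<one> \<otimes> x \<otimes> inv \<one>) \<in> U"
      using U(3) unfolding N_def by blast
    then show "x \<in> U"
      using x by (simp add: N_def)
  qed
  have sub: "subgroup N G"
  proof (rule subgroupI)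
    show "N \<subseteq> carrier G" by (auto simp: N_def)
    have "\<one> \<in> N" by (simp add: N_def)
    then show "N \<noteq> {}" by blast
    show "inv x \<in> N" if "x \<in> N" for x
      using that by (auto simp: N_def)
    fix x y assume x: "x \<in> N" and y: "y \<in> N"
    have [simp]: "x \<in> carrier G" "y \<in> carrier G"
      using x y by (auto simp: N_def)
    have "u \<otimes> (g \<otimes> (x \<otimes> y) \<otimes> inv g) \<in> U \<and> u \<otimes> (g \<otimes> inv (x \<otimes> y) \<otimes> inv g) \<in> U"
      if g: "g \<in> carrier G" and u: "u \<in> U" for g u
    proof -
      have "u \<otimes> (g \<otimes> x \<otimes> inv g) \<in> U" "u \<otimes> (g \<otimes> inv y \<otimes> inv g) \<in> U"
        using x y g u by (auto simp: N_def)
      then have "(u \<otimes> (g \<otimes> x \<otimes> inv g)) \<otimes> (g \<otimes> y \<otimes> inv g) \<in> U"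
         "(u \<otimes> (g \<otimes> inv y \<otimes> inv g)) \<otimes> (g \<otimes> inv x \<otimes> inv g) \<in> U"
        using x y g unfolding N_def by blast+
      moreover have "inv g \<otimes> (g \<otimes> z) = z" if "z \<in> carrier G" for z
        using that g by (simp add: m_assoc[symmetric])
      ultimately show ?thesis
        using g u by (simp add: m_assoc inv_mult_group)
    qed
    then show "x \<otimes> y \<in> N"
      by (simp add: N_def)
  qed
  have "N \<lhd> G"
    unfolding normal_inv_iff
  proof (intro conjI sub ballI)
    fix h x assume h: "h \<in> carrier G" and x: "x \<in> N"
    have [simp]: "x \<in> carrier G" using x by (auto simp: N_def)
    have "u \<otimes> (g \<otimes> (h \<otimes> x \<otimes> inv h) \<otimes> inv g) \<in> U \<and> u \<otimes> (g \<otimes> inv (h \<otimes> x \<otimes> inv h) \<otimes> inv g) \<in> U"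
      if g: "g \<in> carrier G" and u: "u \<in> U" for g u
    proof -
      have "u \<otimes> ((g \<otimes> h) \<otimes> x \<otimes> inv (g \<otimes> h)) \<in> U \<and> u \<otimes> ((g \<otimes> h) \<otimes> inv x \<otimes> inv (g \<otimes> h)) \<in> U"
        using x g h u m_closed[OF g h] unfolding N_def by blast
      then show ?thesis
        using g h u by (simp add: inv_mult_group m_assoc)
    qed
    then show "h \<otimes> x \<otimes> inv h \<in> N"
      using h by (simp add: N_def)
  qed
  moreover have "openin T N"
  proof -
    define f where "f s = (\<lambda>z. fst (fst z) \<otimes> (snd (fst z) \<otimes> (if s then snd z else inv (snd z)) \<otimes> inv (snd (fst z))))" for s :: bool
    let ?X = "prod_topology (prod_topology T T) T"
    have c1: "continuous_map ?X T (\<lambda>z. fst (fst z))" "continuous_map ?X T (\<lambda>z. snd (fst z))" "continuous_map ?X T snd"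
      using continuous_map_compose[OF continuous_map_fst continuous_map_fst, of T T T]
        continuous_map_compose[OF continuous_map_fst continuous_map_snd, of T T T] continuous_map_snd
      by (auto simp: comp_def)
    have cf: "continuous_map ?X T (f s)" for s
      unfolding f_def using c1 by (cases s) (auto intro!: continuous_word)
    \<comment> \<open>The witnesses against membership in \<open>N\<close>. This set is closed
      because \<open>U\<close> is clopen, and projecting along the compact space of pairs
      \<open>(u, g)\<close> is a closed map; so the complement of \<open>N\<close> is
      closed.\<close>
    define K where "K = {z \<in> topspace ?X. fst (fst z) \<in> U} \<inter>
      ({z \<in> topspace ?X. f True z \<in> topspace T - U} \<union> {z \<in> topspace ?X. f False z \<in> topspace T - U})"
    have "closedin ?X K"
      unfolding K_def using U(1,2) openin_closedin_eq
      by (intro closedin_Int closedin_Un closedin_continuous_map_preimage[OF cf] closedin_continuous_map_preimage[OF c1(1)]) auto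
    moreover have "closed_map ?X T snd"
      by (intro closed_map_snd) (simp add: compact_space_prod_topology compact)
    ultimately have "closedin T (snd ` K)"
      by (simp add: closed_map_def)
    moreover have "N = topspace T - snd ` K"
    proof (intro equalityI subsetI)
      fix x assume "x \<in> N"
      then show "x \<in> topspace T - snd ` K"
        by (auto simp: N_def K_def f_def topspace_eq)
    next
      fix x assume x: "x \<in> topspace T - snd ` K"
      have "u \<otimes> (g \<otimes> x \<otimes> inv g) \<in> U \<and> u \<otimes> (g \<otimes> inv x \<otimes> inv g) \<in> U"
        if g: "g \<in> carrier G" and u: "u \<in> U" for g u
      proof -
        have "((u, g), x) \<notin> K"
          using x by force
        then show ?thesis
          using x g u by (auto simp: K_def f_def topspace_eq)
      qed
      then show "x \<in> N"
        using x by (auto simp: N_def topspace_eq)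
    qed
    ultimately show ?thesis
      by (simp add: openin_diff)
  qed
  ultimately show ?thesis
    using NU U(4) unfolding open_normal_def by blast
qed

lemma closed_separation:
  assumes "closedin T A" "x \<in> carrier G" "x \<notin> A"
  shows "\<exists>N. onorm N \<and> x \<notin> A <#> N"
proof -
  have "openin T {y \<in> carrier G. x \<otimes> y \<in> topspace T - A}"
    using assms by (intro openin_translate) auto
  moreover have "\<one> \<in> {y \<in> carrier G. x \<otimes> y \<in> topspace T - A}"
    using assms by (simp add: topspace_eq)
  ultimately obtain N where N: "onorm N" "N \<subseteq> {y \<in> carrier G. x \<otimes> y \<in> topspace T - A}"
    using open_normal_nbhd by blast
  have "x \<notin> A <#> N"
  proof
    assume "x \<in> A <#> N"
    then obtain a n where an: "a \<in> A" "n \<in> N" "x = a \<otimes> n"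
      by (auto simp: set_mult_def)
    have "a \<in> carrier G" "n \<in> carrier G"
      using an N(2) closedin_subset[OF assms(1)] by (auto simp: topspace_eq)
    then have "x \<otimes> inv n = a"
      using an by (simp add: m_assoc)
    moreover have "inv n \<in> N"
      using csub_inv[OF onorm_csub[OF N(1)] an(2)] .
    ultimately show False
      using N(2) an(1) by auto
  qed
  then show ?thesis
    using N(1) by blast
qed

lemma closed_memI:
  assumes "closedin T A" "x \<in> carrier G" "\<And>N. onorm N \<Longrightarrow> \<exists>a\<in>A. \<exists>n\<in>N. x = a \<otimes> n"
  shows "x \<in> A"
  using closed_separation[OF assms(1,2)] assms(3) unfolding set_mult_iff by blast

lemma closedin_set_mult:
  assumes "closedin T A" "closedin T B"
  shows "closedin T (A <#> B)"
proof -
  have "compactin (prod_topology T T) (A \<times> B)"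
    using assms compact by (simp add: closedin_compact_space compactin_Times)
  then have "compactin T ((\<lambda>(x, y). x \<otimes> y) ` (A \<times> B))"
    using continuous_mult by (rule image_compactin)
  moreover have "(\<lambda>(x, y). x \<otimes> y) ` (A \<times> B) = A <#> B"
    by (auto simp: set_mult_def)
  ultimately show ?thesis
    using Hausdorff compactin_imp_closedin by metis
qed

lemma csub_set_mult:
  assumes "csub A" "csub B" "A \<subseteq> normz B"
  shows "csub (A <#> B)"
  using assms closedin_set_mult subgroup_set_mult by (simp add: closed_subgroup_def)

lemma csub_trivial: "csub {\<one>}"
  using Hausdorff by (simp add: closed_subgroup_def triv_subgroup Hausdorff_imp_t1_space closedin_t1_singleton topspace_eq)

end

section \<open>Procyclic factors of pro-p groups\<close>

context pro_p_group
begin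

lemma p_pos: "p > 0"
  using prime prime_gt_0_nat by blast

lemma onorm_finite_cosets:
  assumes "onorm N"
  shows "\<exists>F. finite F \<and> F \<subseteq> carrier G \<and> (\<forall>x\<in>carrier G. \<exists>f\<in>F. \<exists>n\<in>N. x = f \<otimes> n)"
proof -
  obtain k where "order (G Mod N) = p ^ k"
    using open_index[OF assms] by blast
  then have "finite (carrier (G Mod N))"
    using p_pos by (metis card.infinite order_def power_not_zero less_numeral_extra(3))
  then have "finite ((\<lambda>x. N #> x) ` carrier G)"
    by (simp add: carrier_FactGroup)
  then obtain F where F: "F \<subseteq> carrier G" "finite F" "(\<lambda>x. N #> x) ` carrier G = (\<lambda>x. N #> x) ` F"
    using finite_subset_image[of "(\<lambda>x. N #> x) ` carrier G" "\<lambda>x. N #> x" "carrier G"] by blast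
  have "\<exists>f\<in>F. \<exists>n\<in>N. x = f \<otimes> n" if x: "x \<in> carrier G" for x
  proof -
    obtain f where f: "f \<in> F" "N #> x = N #> f"
      using F(3) x by blast
    have "x \<in> N #> f"
      using rcos_self[OF x onorm_subgroup[OF assms]] f(2) by simp
    then obtain n where n: "n \<in> N" "x = n \<otimes> f"
      by (auto simp: r_coset_def)
    have [simp]: "n \<in> carrier G" "f \<in> carrier G"
      using n(1) f(1) F(1) csub_carrier[OF onorm_csub[OF assms]] by auto
    have "x = f \<otimes> (inv f \<otimes> n \<otimes> f)"
      using n by (simp add: m_assoc[symmetric])
    then show ?thesis
      using onorm_conj(2)[OF assms _ n(1), of f] f(1) by auto
  qed
  then show ?thesis
    using F by blast
qed

text \<open>Lagrange's theorem in the finite \<open>p\<close>-group \<open>G / N\<close>. It says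
  that the powers with exponent \<open>p ^ k\<close> tend to the identity uniformly, which is how
  the pro-\<open>p\<close> hypothesis acts on procyclic subgroups.\<close>

lemma onorm_pow:
  assumes "onorm N"
  shows "\<exists>k. \<forall>x\<in>carrier G. x [^] (p ^ k) \<in> N"
proof -
  obtain k where k: "order (G Mod N) = p ^ k"
    using open_index[OF assms] by blast
  interpret N: normal N G
    using assms by (simp add: open_normal_def)
  interpret Q: group "G Mod N"
    by (rule N.factorgroup_is_group)
  have "x [^] (p ^ k) \<in> N" if x: "x \<in> carrier G" for x
  proof -
    have "(N #> x) [^]\<^bsub>G Mod N\<^esub> (p ^ k) = N"
      using Q.pow_order_eq_1[of "N #> x"] x k by (simp add: carrier_FactGroup)
    then have "N #> (x [^] (p ^ k)) = N"
      using N.FactGroup_pow[OF x, of "p ^ k"] by simp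
    then show ?thesis
      using rcos_self[of "x [^] (p ^ k)" N] x N.subgroup_axioms by auto
  qed
  then show ?thesis by blast
qed

text \<open>For closed subgroups \<open>A \<le> E\<close> this says that \<open>A\<close> has finite index in \<open>E\<close>.\<close>

definition relopen :: "'a set \<Rightarrow> 'a set \<Rightarrow> bool"
  where "relopen A E \<longleftrightarrow> (\<exists>N. onorm N \<and> E \<inter> N \<subseteq> A)"

lemma relopen_trans: "relopen A B \<Longrightarrow> relopen B E \<Longrightarrow> relopen A E"
proof -
  assume "relopen A B" "relopen B E"
  then obtain N M where "onorm N" "B \<inter> N \<subseteq> A" "onorm M" "E \<inter> M \<subseteq> B"
    by (auto simp: relopen_def)
  then have "onorm (N \<inter> M)" "E \<inter> (N \<inter> M) \<subseteq> A"
    using onorm_Int by auto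
  then show ?thesis
    unfolding relopen_def by blast
qed

lemma relopen_mono: "relopen A E \<Longrightarrow> A \<subseteq> A' \<Longrightarrow> E' \<subseteq> E \<Longrightarrow> relopen A' E'"
  unfolding relopen_def by blast

lemma relopen_whole_iff:
  assumes "subgroup A G" shows "relopen A (carrier G) \<longleftrightarrow> openin T A"
proof
  assume "relopen A (carrier G)"
  then obtain N where "onorm N" "carrier G \<inter> N \<subseteq> A"
    by (auto simp: relopen_def)
  then show "openin T A"
    using subgroup_open_if_contains[OF assms] csub_carrier[OF onorm_csub] by (metis inf_absorb2)
next
  assume "openin T A"
  then show "relopen A (carrier G)"
    using open_normal_nbhd[of A] subgroup.one_closed[OF assms] unfolding relopen_def by blast
qed

text \<open>A translate of \<open>A\<close> that contains the identity is \<open>A\<close> itself.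
  The finitely many others form a closed set that misses the identity, so an open normal subgroup
  avoids them, and it meets \<open>E\<close> only inside \<open>A\<close>.\<close>

lemma relopen_finite_cover:
  assumes A: "csub A" and I: "finite I" and e: "\<And>i. i \<in> I \<Longrightarrow> e i \<in> carrier G"
    and E: "\<And>y. y \<in> E \<Longrightarrow> y \<in> carrier G \<and> (\<exists>i\<in>I. inv (e i) \<otimes> y \<in> A)"
  shows "relopen A E"
proof -
  define J where "J = {i \<in> I. inv (e i) \<notin> A}"
  have "closedin T (\<Union>i\<in>J. {y \<in> carrier G. inv (e i) \<otimes> y \<in> A})"
    using I e csub_closedin[OF A] by (intro closedin_Union) (auto simp: J_def intro!: closedin_word continuous_word)
  then have "openin T (topspace T - (\<Union>i\<in>J. {y \<in> carrier G. inv (e i) \<otimes> y \<in> A}))"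
    by (rule openin_diff[OF openin_topspace])
  moreover have "\<one> \<in> topspace T - (\<Union>i\<in>J. {y \<in> carrier G. inv (e i) \<otimes> y \<in> A})"
    using e by (auto simp: topspace_eq J_def)
  ultimately have "\<exists>N. onorm N \<and> N \<subseteq> topspace T - (\<Union>i\<in>J. {y \<in> carrier G. inv (e i) \<otimes> y \<in> A})"
    by (rule open_normal_nbhd)
  then obtain N where N: "onorm N" "N \<subseteq> topspace T - (\<Union>i\<in>J. {y \<in> carrier G. inv (e i) \<otimes> y \<in> A})"
    by (elim exE conjE)
  have "y \<in> A" if y: "y \<in> E \<inter> N" for y
  proof -
    obtain i where i: "i \<in> I" "inv (e i) \<otimes> y \<in> A" and yG: "y \<in> carrier G"
      using E y by blast
    then have "i \<notin> J"
      using N(2) y by blast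
    then have ei: "inv (e i) \<in> A"
      using i by (simp add: J_def)
    have "inv (inv (e i)) \<otimes> (inv (e i) \<otimes> y) \<in> A"
      using csub_mult[OF A csub_inv[OF A ei] i(2)] .
    then show ?thesis
      using e[OF i(1)] yG by (simp add: m_assoc[symmetric])
  qed
  then show ?thesis
    using N(1) unfolding relopen_def by blast
qed

lemma csub_pow: "csub A \<Longrightarrow> x \<in> A \<Longrightarrow> x [^] (n :: nat) \<in> A"
  by (induction n) (auto simp: csub_one csub_mult)

lemma csub_int_pow: "csub A \<Longrightarrow> x \<in> A \<Longrightarrow> x [^] (z :: int) \<in> A"
  using subgroup_int_pow_closed csub_subgroup by blast

lemma int_pow_split:
  assumes "x \<in> carrier G" "n > 0"
  shows "x [^] (z :: int) = x [^] (nat (z mod int n)) \<otimes> (x [^] n) [^] (z div int n)"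
proof -
  have "x [^] z = x [^] (int (nat (z mod int n)) + int n * (z div int n))"
    using assms(2) by (simp add: mod_mult_div_eq)
  also have "\<dots> = x [^] int (nat (z mod int n)) \<otimes> x [^] (int n * (z div int n))"
    using assms(1) by (rule int_pow_mult)
  also have "x [^] (int n * (z div int n)) = (x [^] int n) [^] (z div int n)"
    using assms(1) by (simp add: int_pow_pow)
  finally show ?thesis
    by (simp only: int_pow_int)
qed

text \<open>Modulo \<open>N\<close> an integer exponent matters only up to a multiple of some
  \<open>p ^ e\<close>, so it can be replaced by a natural number.\<close>

lemma gen_approx:
  assumes x: "x \<in> carrier G" and y: "y \<in> gen x" and N: "onorm N"
  shows "\<exists>k :: nat. inv (x [^] k) \<otimes> y \<in> N"
proof -
  obtain s where s: "s \<in> generate G {x}" "inv s \<otimes> y \<in> N"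
    using closure_approx[of y "generate G {x}" N] y N generate_in_carrier[of "{x}"] x
    unfolding gen_def by blast
  then obtain z :: int where z: "s = x [^] z"
    using generate_pow[OF x] by auto
  obtain e where e: "x [^] (p ^ e) \<in> N"
    using onorm_pow[OF N] x by blast
  define k where "k = nat (z mod int (p ^ e))"
  define w where "w = (x [^] (p ^ e)) [^] (z div int (p ^ e))"
  have w: "w \<in> N" "w \<in> carrier G"
    using csub_int_pow[OF onorm_csub[OF N] e] x by (auto simp: w_def)
  have yG: "y \<in> carrier G"
    using y csub_carrier[OF csub_gen[OF x]] by blast
  have sk: "s = x [^] k \<otimes> w"
    unfolding z k_def w_def using int_pow_split[OF x, of "p ^ e" z] p_pos by simp
  have "inv (x [^] k) \<otimes> y = w \<otimes> (inv s \<otimes> y)"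
    unfolding sk using x yG w by (simp add: inv_mult_group m_assoc[symmetric])
  then show ?thesis
    using csub_mult[OF onorm_csub[OF N] w(1) s(2)] by metis
qed

text \<open>All integer powers of \<open>x\<close> lie in the cosets of \<open>A\<close> by
  \<open>x [^] i\<close> with \<open>i < n\<close>. Their union is closed, hence contains
  \<open>gen x\<close>, and these cosets then cover \<open>gen x <#> A\<close>.\<close>

lemma relopen_gen:
  assumes A: "csub A" and x: "x \<in> normz A" and n: "x [^] (n :: nat) \<in> A" "n > 0"
  shows "relopen A (gen x <#> A)"
proof -
  have xG: "x \<in> carrier G"
    using x normz_carrier by blast
  define Z where "Z = (\<Union>i<n. {y \<in> carrier G. inv (x [^] i) \<otimes> y \<in> A})"
  have "closedin T Z"
    unfolding Z_def using xG csub_closedin[OF A]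
    by (intro closedin_Union) (auto intro!: closedin_word continuous_word)
  moreover have "generate G {x} \<subseteq> Z"
  proof
    fix s assume "s \<in> generate G {x}"
    then obtain z :: int where z: "s = x [^] z"
      using generate_pow[OF xG] by auto
    have "nat (z mod int n) < n"
      using n(2) by (simp add: nat_less_iff)
    moreover have "inv (x [^] nat (z mod int n)) \<otimes> s = (x [^] n) [^] (z div int n)"
      unfolding z using int_pow_split[OF xG n(2), of z] xG by (simp add: m_assoc[symmetric])
    then have "inv (x [^] nat (z mod int n)) \<otimes> s \<in> A"
      by (simp only: csub_int_pow[OF A n(1)])
    moreover have "s \<in> carrier G"
      using xG z by simp
    ultimately show "s \<in> Z"
      unfolding Z_def by blast
  qed
  ultimately have gZ: "gen x \<subseteq> Z"
    unfolding gen_def by (rule closure_minimal[rotated])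
  show ?thesis
  proof (rule relopen_finite_cover[OF A, of "{..<n}" "\<lambda>i. x [^] i"])
    fix y assume "y \<in> gen x <#> A"
    then obtain c a where c: "c \<in> gen x" "a \<in> A" "y = c \<otimes> a"
      by (auto simp: set_mult_def)
    then obtain i where i: "i < n" "inv (x [^] i) \<otimes> c \<in> A" "c \<in> carrier G"
      using gZ unfolding Z_def by blast
    have "a \<in> carrier G"
      using csub_carrier[OF A] c(2) by blast
    then have "inv (x [^] i) \<otimes> y = inv (x [^] i) \<otimes> c \<otimes> a"
      using c i xG by (simp add: m_assoc)
    then show "y \<in> carrier G \<and> (\<exists>i\<in>{..<n}. inv (x [^] i) \<otimes> y \<in> A)"
      using csub_mult[OF A i(2) c(2)] i c \<open>a \<in> carrier G\<close> by (intro conjI bexI[of _ i]) simp_all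
  qed (use xG in auto)
qed

lemma csub_gen_mult: "csub B \<Longrightarrow> x \<in> normz B \<Longrightarrow> csub (gen x <#> B)"
  using csub_set_mult csub_gen gen_subset_normz normz_carrier by blast

lemma gen_mult_superset:
  assumes "csub B" "x \<in> carrier G"
  shows "B \<subseteq> gen x <#> B" "x \<in> gen x <#> B"
  using set_mult_superset[of "gen x" B] gen_self csub_gen csub_subgroup assms by blast+

lemma gen_mult_minimal: "csub A \<Longrightarrow> x \<in> A \<Longrightarrow> B \<subseteq> A \<Longrightarrow> gen x <#> B \<subseteq> A"
  by (intro set_mult_minimal gen_minimal csub_subgroup)

lemma gen_mult_subset_normz:
  assumes "csub B" "x \<in> normz B" shows "gen x <#> B \<subseteq> normz B"
  using assms gen_mult_minimal csub_normz subgroup_subset_normz csub_subgroup by blast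

text \<open>The subgroups of a finite cyclic \<open>p\<close>-group form a chain.\<close>

lemma procyclic_dichotomy:
  assumes B: "csub B" and x: "x \<in> normz B" and y: "y \<in> gen x <#> B"
  shows "y \<in> gen (x [^] p) <#> B \<or> x \<in> gen y <#> B"
proof (rule disjCI)
  assume nx: "x \<notin> gen y <#> B"
  have xG: "x \<in> carrier G" using x normz_carrier by blast
  have yn: "y \<in> normz B" using gen_mult_subset_normz[OF B x] y by blast
  then have yG: "y \<in> carrier G" using normz_carrier by blast
  have Ey: "csub (gen y <#> B)" by (rule csub_gen_mult[OF B yn])
  obtain N0 where N0: "onorm N0" "x \<notin> (gen y <#> B) <#> N0"
    using closed_separation[OF csub_closedin[OF Ey] xG nx] by blast
  have xp: "x [^] p \<in> normz B" using csub_pow[OF csub_normz[OF B] x] .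
  show "y \<in> gen (x [^] p) <#> B"
  proof (rule closed_memI[OF csub_closedin[OF csub_gen_mult[OF B xp]] yG])
    fix N assume N: "onorm N"
    \<comment> \<open>\<open>N\<close> is the precision asked for in the conclusion, while
      \<open>N0\<close> detects that \<open>x\<close> is outside \<open>gen y <#> B\<close>.\<close>
    define M where "M = N \<inter> N0"
    have M: "onorm M" using N N0 onorm_Int by (simp add: M_def)
    obtain c b where cb: "c \<in> gen x" "b \<in> B" "y = c \<otimes> b"
      using y by (auto simp: set_mult_def)
    obtain k :: nat where k: "inv (x [^] k) \<otimes> c \<in> M"
      using gen_approx[OF xG cb(1) M] by blast
    define m where "m = inv (x [^] k) \<otimes> c"
    have cG [simp]: "c \<in> carrier G" using cb(1) csub_carrier[OF csub_gen[OF xG]] by blast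
    have bG [simp]: "b \<in> carrier G" using cb(2) csub_carrier[OF B] by blast
    have mG [simp]: "m \<in> carrier G" using xG by (simp add: m_def)
    have mM: "m \<in> M" using k by (simp add: m_def)
    have c: "c = x [^] k \<otimes> m" using xG by (simp add: m_def m_assoc[symmetric])
    \<comment> \<open>Modulo \<open>B\<close> and \<open>M\<close> the element \<open>y\<close>
      equals \<open>x [^] k\<close>. If \<open>p\<close> does not divide \<open>k\<close>, Bezout
      inverts \<open>k\<close> modulo the order \<open>p ^ e\<close> and recovers \<open>x\<close>
      from \<open>y\<close>, against the choice of \<open>N0\<close>.\<close>
    have "p dvd k"
    proof (rule ccontr)
      assume "\<not> p dvd k"
      then have cop: "coprime p k" using prime prime_imp_coprime_nat by blast
      obtain e where e: "x [^] (p ^ e) \<in> M" using onorm_pow[OF M] xG by blast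
      have "coprime (int k) (int (p ^ e))"
        using cop by (simp add: coprime_commute)
      then obtain u v :: int where uv: "u * int k + v * int (p ^ e) = 1"
        using bezout_int[of "int k" "int (p ^ e)"] by auto
      define W where "W = (gen y <#> B) <#> M"
      have W: "csub W"
        unfolding W_def by (rule set_mult_onorm(3)[OF csub_subgroup[OF Ey] M])
      have WM: "M \<subseteq> W" and WE: "gen y <#> B \<subseteq> W"
        unfolding W_def using set_mult_superset[OF csub_subgroup[OF Ey] onorm_subgroup[OF M]] by auto
      have "y \<otimes> inv b \<otimes> inv m = x [^] k"
        using xG c cb(3) by (simp add: m_assoc)
      moreover have "y \<in> W" "inv b \<in> W" "inv m \<in> W"
        using WM WE gen_mult_superset[OF B yG] csub_inv[OF B cb(2)] csub_inv[OF onorm_csub[OF M] mM] by auto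
      ultimately have xk: "x [^] k \<in> W"
        using csub_mult[OF W] by metis
      have "x = x [^] (int k * u + int (p ^ e) * v)"
        using uv xG by (simp add: mult.commute)
      also have "\<dots> = (x [^] int k) [^] u \<otimes> (x [^] int (p ^ e)) [^] v"
        using xG int_pow_mult int_pow_pow by metis
      also have "\<dots> = (x [^] k) [^] u \<otimes> (x [^] (p ^ e)) [^] v"
        by (simp only: int_pow_int)
      finally have "x \<in> W"
        using csub_mult[OF W csub_int_pow[OF W xk, of u] csub_int_pow[OF W subsetD[OF WM e], of v]] by simp
      moreover have "W \<subseteq> (gen y <#> B) <#> N0"
        unfolding W_def M_def by (rule mono_set_mult) auto
      ultimately show False using N0(2) by blast
    qed
    then obtain j where j: "k = p * j" by blast
    have "x [^] k = (x [^] p) [^] j"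
      using xG j by (simp add: nat_pow_pow)
    then have "x [^] k \<in> gen (x [^] p)"
      using csub_pow[OF csub_gen[of "x [^] p"] gen_self[of "x [^] p"]] xG by simp
    then have "x [^] k \<otimes> b \<in> gen (x [^] p) <#> B"
      using cb(2) by (rule set_multI)
    moreover have "y = (x [^] k \<otimes> b) \<otimes> (inv b \<otimes> m \<otimes> b)"
      using c cb(3) xG by (simp add: m_assoc[symmetric]) (simp add: m_assoc)
    moreover have "inv b \<otimes> m \<otimes> b \<in> N"
      using onorm_conj(2)[OF M bG mM] by (simp add: M_def)
    ultimately show "\<exists>a\<in>gen (x [^] p) <#> B. \<exists>n\<in>N. y = a \<otimes> n" by blast
  qed
qed

lemma procyclic_filtration_antimono:
  assumes B: "csub B" and x: "x \<in> normz B" and "i \<le> j"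
  shows "gen (x [^] (p ^ j)) <#> B \<subseteq> gen (x [^] (p ^ i)) <#> B"
proof -
  have xG: "x \<in> carrier G" using x normz_carrier by blast
  have "p ^ j = p ^ i * p ^ (j - i)"
    using assms(3) by (simp flip: power_add)
  then have "x [^] (p ^ j) = (x [^] (p ^ i)) [^] (p ^ (j - i))"
    using xG by (simp add: nat_pow_pow)
  then have "x [^] (p ^ j) \<in> gen (x [^] (p ^ i))"
    using csub_pow[OF csub_gen gen_self] xG by simp
  then show ?thesis
    using csub_gen xG by (intro mono_set_mult gen_minimal) auto
qed

text \<open>The subgroups \<open>gen (x [^] (p ^ j)) <#> B\<close> decrease to \<open>B\<close>,
  because the powers of \<open>x\<close> eventually lie in any given open normal subgroup. So
  \<open>y\<close> drops out at a first index \<open>j\<close>, which is positive, and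
  \<open>procyclic_dichotomy\<close> is applied at \<open>j - 1\<close>.\<close>

lemma procyclic_level:
  assumes B: "csub B" and x: "x \<in> normz B" and y: "y \<in> gen x <#> B" "y \<notin> B"
  shows "\<exists>k. y \<in> gen (x [^] (p ^ k)) <#> B \<and> x [^] (p ^ k) \<in> gen y <#> B"
proof -
  have xG: "x \<in> carrier G" using x normz_carrier by blast
  have yG: "y \<in> carrier G" using y(1) csub_carrier[OF csub_gen_mult[OF B x]] by blast
  have "\<exists>j. y \<notin> gen (x [^] (p ^ j)) <#> B"
  proof (rule ccontr)
    assume all: "\<nexists>j. y \<notin> gen (x [^] (p ^ j)) <#> B"
    have "y \<in> B"
    proof (rule closed_memI[OF csub_closedin[OF B] yG])
      fix N assume N: "onorm N"
      obtain e where e: "x [^] (p ^ e) \<in> N" using onorm_pow[OF N] xG by blast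
      obtain c b where cb: "c \<in> gen (x [^] (p ^ e))" "b \<in> B" "y = c \<otimes> b"
        using all set_mult_iff[of y "gen (x [^] (p ^ e))" B] by blast
      have c: "c \<in> N" using gen_minimal[OF onorm_csub[OF N] e] cb(1) by blast
      have [simp]: "c \<in> carrier G" "b \<in> carrier G"
        using c cb(2) csub_carrier[OF B] csub_carrier[OF onorm_csub[OF N]] by auto
      have "y = b \<otimes> (inv b \<otimes> c \<otimes> b)"
        using cb(3) by (simp add: m_assoc[symmetric])
      then show "\<exists>a\<in>B. \<exists>n\<in>N. y = a \<otimes> n"
        using cb(2) onorm_conj(2)[OF N _ c, of b] by auto
    qed
    then show False using y(2) by simp
  qed
  then obtain j where j: "y \<notin> gen (x [^] (p ^ j)) <#> B" "\<And>i. i < j \<Longrightarrow> y \<in> gen (x [^] (p ^ i)) <#> B"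
    using exists_least_iff[of "\<lambda>j. y \<notin> gen (x [^] (p ^ j)) <#> B"] by blast
  have "j \<noteq> 0"
    using j(1) y(1) xG by (auto intro: ccontr)
  then obtain k where k: "j = Suc k" using not0_implies_Suc by blast
  have "(x [^] (p ^ k)) [^] p = x [^] (p ^ Suc k)"
    using xG by (simp add: nat_pow_pow mult.commute)
  then show ?thesis
    using procyclic_dichotomy[OF B csub_pow[OF csub_normz[OF B] x], of y "p ^ k"] j k by auto
qed

text \<open>The analogue of the fact that the nonzero closed subgroups of the \<open>p\<close>-adic
  integers are generated by powers of \<open>p\<close>. The exponent is the least \<open>k\<close>
  for which \<open>x [^] (p ^ k)\<close> lies in \<open>A\<close>; the level of any element of
  \<open>A\<close> outside \<open>B\<close> cannot be smaller.\<close>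

lemma procyclic_subgroups:
  assumes B: "csub B" and x: "x \<in> normz B" and A: "csub A" "B \<subseteq> A" "A \<subseteq> gen x <#> B"
  shows "A = B \<or> (\<exists>k. A = gen (x [^] (p ^ k)) <#> B)"
proof (rule disjCI, rule ccontr)
  assume *: "\<nexists>k. A = gen (x [^] (p ^ k)) <#> B" and "A \<noteq> B"
  have xG: "x \<in> carrier G" using x normz_carrier by blast
  have lev: "\<exists>k. y \<in> gen (x [^] (p ^ k)) <#> B \<and> x [^] (p ^ k) \<in> A" if y: "y \<in> A" "y \<notin> B" for y
  proof -
    have "gen y <#> B \<subseteq> A" using gen_mult_minimal[OF A(1) y(1) A(2)] .
    then show ?thesis using procyclic_level[OF B x _ y(2)] A(3) y(1) by blast
  qed
  obtain y0 where "y0 \<in> A" "y0 \<notin> B" using \<open>A \<noteq> B\<close> A(2) by blast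
  then have "\<exists>k. x [^] (p ^ k) \<in> A" using lev by blast
  then obtain k where k: "x [^] (p ^ k) \<in> A" "\<And>i. i < k \<Longrightarrow> x [^] (p ^ i) \<notin> A"
    using exists_least_iff[of "\<lambda>k. x [^] (p ^ k) \<in> A"] by blast
  have "A \<subseteq> gen (x [^] (p ^ k)) <#> B"
  proof
    fix y assume y: "y \<in> A"
    show "y \<in> gen (x [^] (p ^ k)) <#> B"
    proof (cases "y \<in> B")
      case True
      then show ?thesis using gen_mult_superset(1)[OF B, of "x [^] (p ^ k)"] xG by auto
    next
      case False
      then obtain j where j: "y \<in> gen (x [^] (p ^ j)) <#> B" "x [^] (p ^ j) \<in> A"
        using lev y by blast
      then have "k \<le> j" using k(2) not_le by blast
      then show ?thesis using procyclic_filtration_antimono[OF B x] j(1) by blast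
    qed
  qed
  moreover have "gen (x [^] (p ^ k)) <#> B \<subseteq> A"
    using gen_mult_minimal[OF A(1) k(1) A(2)] .
  ultimately show False using * by blast
qed

text \<open>\<open>A\<close> is one of the levels of the chain. It is normalized by
  \<open>x\<close>, which commutes with \<open>gen (x [^] (p ^ k))\<close> and normalizes
  \<open>B\<close>, and it contains a power of \<open>x\<close>; so \<open>relopen_gen\<close>
  applies with \<open>A\<close> as the lower group.\<close>

lemma relopen_procyclic:
  assumes B: "csub B" and x: "x \<in> normz B" and A: "csub A" "B \<subseteq> A" "A \<subseteq> gen x <#> B" "A \<noteq> B"
  shows "relopen A (gen x <#> B)"
proof -
  have xG: "x \<in> carrier G" using x normz_carrier by blast
  obtain k where k: "A = gen (x [^] (p ^ k)) <#> B"
    using procyclic_subgroups[OF B x A(1-3)] A(4) by blast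
  have xk: "x [^] (p ^ k) \<in> A"
    using gen_mult_superset(2)[OF B] xG k by simp
  have xA: "x \<in> normz A"
    unfolding normz_def mem_Collect_eq
  proof (intro conjI ballI xG)
    fix a assume "a \<in> A"
    then obtain c b where cb: "c \<in> gen (x [^] (p ^ k))" "b \<in> B" "a = c \<otimes> b"
      using k by (auto simp: set_mult_def)
    \<comment> \<open>Commuting with \<open>x\<close> is a closed condition, so it passes from the
      powers of \<open>x\<close> to the closure.\<close>
    have "gen (x [^] (p ^ k)) \<subseteq> {c \<in> carrier G. x \<otimes> c \<otimes> inv x \<otimes> inv c \<in> {\<one>}}"
    proof (rule subset_trans[of _ "cl (generate G {x [^] (p ^ k)})"])
      show "cl (generate G {x [^] (p ^ k)}) \<subseteq> {c \<in> carrier G. x \<otimes> c \<otimes> inv x \<otimes> inv c \<in> {\<one>}}"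
      proof (rule closure_minimal)
        show "closedin T {c \<in> carrier G. x \<otimes> c \<otimes> inv x \<otimes> inv c \<in> {\<one>}}"
          using xG csub_closedin[OF csub_trivial] by (intro closedin_word continuous_word)
        show "generate G {x [^] (p ^ k)} \<subseteq> {c \<in> carrier G. x \<otimes> c \<otimes> inv x \<otimes> inv c \<in> {\<one>}}"
        proof
          fix s assume "s \<in> generate G {x [^] (p ^ k)}"
          then obtain z :: int where z: "s = (x [^] (p ^ k)) [^] z"
            using generate_pow[of "x [^] (p ^ k)"] xG by auto
          have "s = x [^] (int (p ^ k) * z)"
            unfolding z int_pow_int[symmetric] using xG by (simp only: int_pow_pow)
          then have "x \<otimes> s = s \<otimes> x"
            using xG int_pow_mult[of x 1 "int (p ^ k) * z"] int_pow_mult[of x "int (p ^ k) * z" 1]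
            by (simp add: add.commute)
          then show "s \<in> {c \<in> carrier G. x \<otimes> c \<otimes> inv x \<otimes> inv c \<in> {\<one>}}"
            using xG z by (simp add: m_assoc)
        qed
      qed
    qed (simp add: gen_def)
    then have "x \<otimes> c \<otimes> inv x \<otimes> inv c = \<one>" and cG: "c \<in> carrier G"
      using cb(1) by auto
    then have comm: "x \<otimes> c = c \<otimes> x"
      using xG by (metis inv_closed inv_equality inv_inv inv_solve_right m_closed)
    have bG: "b \<in> carrier G" using cb(2) csub_carrier[OF B] by blast
    have "x \<otimes> a \<otimes> inv x = (x \<otimes> c) \<otimes> b \<otimes> inv x"
      using cb(3) xG cG bG by (simp add: m_assoc)
    also have "\<dots> = c \<otimes> (x \<otimes> b \<otimes> inv x)"
      unfolding comm using xG cG bG by (simp add: m_assoc)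
    finally show "x \<otimes> a \<otimes> inv x \<in> A"
      using set_multI[OF cb(1) normz_conj[OF x cb(2)]] k by simp
    have "inv x \<otimes> c = c \<otimes> inv x"
      using comm xG cG by (metis inv_closed inv_solve_left inv_solve_right m_assoc m_closed)
    then have "inv x \<otimes> a \<otimes> x = c \<otimes> (inv x \<otimes> b \<otimes> x)"
      using cb(3) xG cG bG by (simp add: m_assoc[symmetric])
    then show "inv x \<otimes> a \<otimes> x \<in> A"
      using set_multI[OF cb(1) normz_conj'[OF x cb(2)]] k by simp
  qed
  have "relopen A (gen x <#> A)"
    using relopen_gen[OF A(1) xA xk] p_pos by simp
  then show ?thesis
    by (rule relopen_mono[OF _ order_refl mono_set_mult[OF order_refl A(2)]])
qed

end

section \<open>Commutators and abelian factors\<close>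

context group
begin

text \<open>The same convention as in \<open>lower_central\<close>, so that the generators of the
  next term are literally values of \<open>commut\<close>.\<close>

definition commut :: "'a \<Rightarrow> 'a \<Rightarrow> 'a"
  where "commut x y = x \<otimes> y \<otimes> inv x \<otimes> inv y"

lemma cancel_left: "x \<in> carrier G \<Longrightarrow> z \<in> carrier G \<Longrightarrow> x \<otimes> (inv x \<otimes> z) = z"
  and cancel_left_inv: "x \<in> carrier G \<Longrightarrow> z \<in> carrier G \<Longrightarrow> inv x \<otimes> (x \<otimes> z) = z"
  by (simp_all add: m_assoc[symmetric])

lemmas group_word = m_assoc inv_mult_group cancel_left cancel_left_inv

lemma commut_closed [simp]: "x \<in> carrier G \<Longrightarrow> y \<in> carrier G \<Longrightarrow> commut x y \<in> carrier G"
  by (simp add: commut_def)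

lemma conj_eq_commut: "x \<in> carrier G \<Longrightarrow> y \<in> carrier G \<Longrightarrow> x \<otimes> y \<otimes> inv x = commut x y \<otimes> y"
  by (simp add: commut_def group_word)

lemma inv_commut: "x \<in> carrier G \<Longrightarrow> y \<in> carrier G \<Longrightarrow> inv (commut x y) = commut y x"
  by (simp add: commut_def group_word)

lemma commut_mult: "\<lbrakk>x \<in> carrier G; x' \<in> carrier G; y \<in> carrier G\<rbrakk> \<Longrightarrow>
    commut (x \<otimes> x') y = (x \<otimes> commut x' y \<otimes> inv x) \<otimes> commut x y"
  by (simp add: commut_def group_word)

lemma commut_inv: "\<lbrakk>x \<in> carrier G; y \<in> carrier G\<rbrakk> \<Longrightarrow>
    commut (inv x) y = inv x \<otimes> inv (commut x y) \<otimes> x"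
  by (simp add: commut_def group_word)

lemma commut_one: "y \<in> carrier G \<Longrightarrow> commut \<one> y = \<one>"
  by (simp add: commut_def)

lemma commut_eq_one_iff: "\<lbrakk>x \<in> carrier G; y \<in> carrier G\<rbrakk> \<Longrightarrow> commut x y = \<one> \<longleftrightarrow> x \<otimes> y = y \<otimes> x"
proof
  assume xy: "x \<in> carrier G" "y \<in> carrier G"
  assume "commut x y = \<one>"
  then have "commut x y \<otimes> (y \<otimes> x) = y \<otimes> x"
    using xy by simp
  moreover have "commut x y \<otimes> (y \<otimes> x) = x \<otimes> y"
    using xy by (simp add: commut_def group_word)
  ultimately show "x \<otimes> y = y \<otimes> x" by simp
next
  assume xy: "x \<in> carrier G" "y \<in> carrier G" "x \<otimes> y = y \<otimes> x"
  then show "commut x y = \<one>"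
    by (simp add: commut_def) (simp add: group_word)
qed

lemma lower_central_commut:
  "x \<in> lower_central G n \<Longrightarrow> y \<in> carrier G \<Longrightarrow> commut x y \<in> lower_central G (Suc n)"
  unfolding lower_central.simps commut_def by (rule generate.incl) blast

lemma lower_central_carrier: "lower_central G n \<subseteq> carrier G"
proof (induction n)
  case (Suc n)
  then show ?case
    unfolding lower_central.simps by (intro generate_incl) auto
qed simp

lemma subgroup_lower_central: "subgroup (lower_central G n) G"
proof (cases n)
  case (Suc m)
  then show ?thesis
    using lower_central_carrier[of m] unfolding Suc lower_central.simps
    by (intro generate_is_subgroup) auto
qed (simp add: subgroup_self)

lemma lower_central_Suc_subset:
  assumes "subgroup H G" "\<And>x y. x \<in> lower_central G n \<Longrightarrow> y \<in> carrier G \<Longrightarrow> commut x y \<in> H"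
  shows "lower_central G (Suc n) \<subseteq> H"
  unfolding lower_central.simps using assms by (intro generate_subgroup_incl) (auto simp: commut_def)

lemma lower_central_antimono: "lower_central G (Suc n) \<subseteq> lower_central G n"
proof (induction n)
  case 0
  show ?case using lower_central_carrier[of "Suc 0"] by simp
next
  case (Suc n)
  show ?case
    using Suc lower_central_commut by (intro lower_central_Suc_subset subgroup_lower_central) blast
qed

text \<open>Let \<open>i\<close> be least such that the \<open>i\<close>-th lower central term meets
  \<open>X\<close> inside \<open>B\<close>. It is not \<open>0\<close>, and an element of the
  preceding term in \<open>X\<close> but outside \<open>B\<close> has its commutators in the
  \<open>i\<close>-th term. Such an element plays the role of a nontrivial central element of
  \<open>X / B\<close>, without \<open>B\<close> having to be normal.\<close>

lemma nilpotent_step: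
  assumes "nilpotent_group G" "X \<subseteq> carrier G" "\<not> X \<subseteq> B" "\<one> \<in> B"
  shows "\<exists>x\<in>X. x \<notin> B \<and> (\<forall>y\<in>carrier G. commut x y \<in> X \<longrightarrow> commut x y \<in> B)"
proof -
  obtain c where c: "lower_central G c = {\<one>}"
    using assms(1) by (auto simp: nilpotent_group_def)
  then have "lower_central G c \<inter> X \<subseteq> B"
    using assms(4) by auto
  then obtain i where i: "lower_central G i \<inter> X \<subseteq> B" "\<And>j. j < i \<Longrightarrow> \<not> lower_central G j \<inter> X \<subseteq> B"
    using exists_least_iff[of "\<lambda>i. lower_central G i \<inter> X \<subseteq> B"] by blast
  have "i \<noteq> 0"
    using i(1) assms(2,3) by (cases i) auto
  then obtain j where j: "i = Suc j" using not0_implies_Suc by blast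
  then obtain x where x: "x \<in> lower_central G j" "x \<in> X" "x \<notin> B"
    using i(2)[of j] by blast
  have "commut x y \<in> B" if "y \<in> carrier G" "commut x y \<in> X" for y
    using lower_central_commut[OF x(1) that(1)] that(2) i(1) j by blast
  then show ?thesis
    using x by blast
qed

lemma normal_in_subgroup:
  assumes Y: "subgroup Y G" and B: "subgroup B G" "B \<subseteq> Y"
    and n: "\<forall>y\<in>Y. \<forall>b\<in>B. y \<otimes> b \<otimes> inv y \<in> B"
  shows "B \<lhd> G\<lparr>carrier := Y\<rparr>"
proof -
  interpret Y: group "G\<lparr>carrier := Y\<rparr>"
    using Y by (rule subgroup_imp_group)
  show ?thesis
    unfolding Y.normal_inv_iff
    using subgroup_incl[OF B(1) Y B(2)] n Y by (auto simp: m_inv_consistent)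
qed

text \<open>Passing to \<open>Y / B\<close> turns congruences modulo \<open>B\<close> into equations.\<close>

lemma factor_group_facts:
  assumes Y: "subgroup Y G" and B: "subgroup B G" "B \<subseteq> Y"
    and n: "\<forall>y\<in>Y. \<forall>b\<in>B. y \<otimes> b \<otimes> inv y \<in> B"
  shows "group (factor_group G Y B)"
    and "(\<lambda>x. B #> x) \<in> hom (G\<lparr>carrier := Y\<rparr>) (factor_group G Y B)"
    and "\<And>x. x \<in> Y \<Longrightarrow> B #> x = \<one>\<^bsub>factor_group G Y B\<^esub> \<longleftrightarrow> x \<in> B"
    and "\<And>x y. \<lbrakk>x \<in> Y; y \<in> Y\<rbrakk> \<Longrightarrow> B #> x = B #> y \<longleftrightarrow> inv x \<otimes> y \<in> B"
    and "\<And>x k. x \<in> Y \<Longrightarrow> B #> (x [^] (k :: nat)) = (B #> x) [^]\<^bsub>factor_group G Y B\<^esub> k"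
    and "\<And>x y. \<lbrakk>x \<in> Y; y \<in> Y\<rbrakk> \<Longrightarrow> B #> (x \<otimes> y) = (B #> x) \<otimes>\<^bsub>factor_group G Y B\<^esub> (B #> y)"
    and "\<And>x. x \<in> Y \<Longrightarrow> B #> inv x = inv\<^bsub>factor_group G Y B\<^esub> (B #> x)"
    and "carrier (factor_group G Y B) = (\<lambda>x. B #> x) ` Y"
proof -
  interpret N: normal B "G\<lparr>carrier := Y\<rparr>"
    using normal_in_subgroup[OF assms] .
  have Yc [simp]: "x \<in> carrier G" if "x \<in> Y" for x
    using that subgroup.subset[OF Y] by blast
  show gp: "group (factor_group G Y B)"
    by (rule N.factorgroup_is_group)
  show hom: "(\<lambda>x. B #> x) \<in> hom (G\<lparr>carrier := Y\<rparr>) (factor_group G Y B)"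
    using N.r_coset_hom_Mod by simp
  interpret h: group_hom "G\<lparr>carrier := Y\<rparr>" "factor_group G Y B" "\<lambda>x. B #> x"
    using hom gp subgroup_imp_group[OF Y] by (simp add: group_hom_def group_hom_axioms_def)
  have iff1: "B #> x = B \<longleftrightarrow> x \<in> B" if "x \<in> Y" for x
    using that rcos_self[of x B] coset_join2[of x B] B(1) by auto
  show "\<And>x. x \<in> Y \<Longrightarrow> B #> x = \<one>\<^bsub>factor_group G Y B\<^esub> \<longleftrightarrow> x \<in> B"
    using iff1 by simp
  show mult: "\<And>x y. \<lbrakk>x \<in> Y; y \<in> Y\<rbrakk> \<Longrightarrow> B #> (x \<otimes> y) = (B #> x) \<otimes>\<^bsub>factor_group G Y B\<^esub> (B #> y)"
    using h.hom_mult by simp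
  show inv: "\<And>x. x \<in> Y \<Longrightarrow> B #> inv x = inv\<^bsub>factor_group G Y B\<^esub> (B #> x)"
    using h.hom_inv Y by (simp add: m_inv_consistent)
  show "\<And>x k. x \<in> Y \<Longrightarrow> B #> (x [^] (k :: nat)) = (B #> x) [^]\<^bsub>factor_group G Y B\<^esub> k"
    using h.hom_nat_pow by (simp add: nat_pow_consistent[symmetric])
  show "carrier (factor_group G Y B) = (\<lambda>x. B #> x) ` Y"
    by (simp add: carrier_FactGroup)
  show "B #> x = B #> y \<longleftrightarrow> inv x \<otimes> y \<in> B" if xy: "x \<in> Y" "y \<in> Y" for x y
  proof -
    have Q: "B #> x \<in> carrier (factor_group G Y B)" "B #> y \<in> carrier (factor_group G Y B)"
      using xy h.hom_closed by auto
    have "inv x \<otimes> y \<in> Y"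
      using xy Y by (simp add: subgroup.m_closed subgroup.m_inv_closed)
    then have "inv x \<otimes> y \<in> B \<longleftrightarrow> B #> (inv x \<otimes> y) = \<one>\<^bsub>factor_group G Y B\<^esub>"
      using iff1 by simp
    also have "\<dots> \<longleftrightarrow> inv\<^bsub>factor_group G Y B\<^esub> (B #> x) \<otimes>\<^bsub>factor_group G Y B\<^esub> (B #> y) = \<one>\<^bsub>factor_group G Y B\<^esub>"
      using mult[of "inv x" y] inv xy Y by (simp add: subgroup.m_inv_closed)
    also have "\<dots> \<longleftrightarrow> B #> x = B #> y"
      using Q group.inv_solve_left'[OF gp _ Q] group.inv_closed[OF gp] group.is_monoid[OF gp]
      by (metis group.inv_equality group.inv_inv group.l_inv gp)
    finally show ?thesis by simp
  qed
qed

lemma factor_group_comm: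
  assumes Y: "subgroup Y G" and B: "subgroup B G" "B \<subseteq> Y"
    and n: "\<forall>y\<in>Y. \<forall>b\<in>B. y \<otimes> b \<otimes> inv y \<in> B"
    and c: "\<And>x y. \<lbrakk>x \<in> Y; y \<in> Y\<rbrakk> \<Longrightarrow> commut x y \<in> B"
  shows "comm_group (factor_group G Y B)"
proof -
  note F = factor_group_facts[OF Y B n]
  have Yc [simp]: "x \<in> carrier G" if "x \<in> Y" for x
    using that subgroup.subset[OF Y] by blast
  show ?thesis
  proof (rule group.group_comm_groupI[OF F(1)])
    fix a b assume "a \<in> carrier (factor_group G Y B)" "b \<in> carrier (factor_group G Y B)"
    then obtain x y where xy: "x \<in> Y" "a = B #> x" "y \<in> Y" "b = B #> y"
      unfolding F(8) by auto
    have "commut (inv y) (inv x) \<in> B"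
      using c xy Y by (simp add: subgroup.m_inv_closed)
    moreover have "commut (inv y) (inv x) = inv (x \<otimes> y) \<otimes> (y \<otimes> x)"
      using xy by (simp add: commut_def group_word)
    ultimately have "B #> (x \<otimes> y) = B #> (y \<otimes> x)"
      using F(4)[of "x \<otimes> y" "y \<otimes> x"] xy Y by (simp add: subgroup.m_closed)
    then show "a \<otimes>\<^bsub>factor_group G Y B\<^esub> b = b \<otimes>\<^bsub>factor_group G Y B\<^esub> a"
      using F(6) xy by simp
  qed
qed

end

context profinite_group
begin

lemma csub_INT: "I \<noteq> {} \<Longrightarrow> (\<And>i. i \<in> I \<Longrightarrow> csub (A i)) \<Longrightarrow> csub (\<Inter>i\<in>I. A i)"
  unfolding closed_subgroup_def by (auto intro!: subgroups_Inter closedin_INT)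

text \<open>For fixed \<open>y\<close>, the map taking \<open>x\<close> to \<open>commut x y\<close>
  is a crossed homomorphism by \<open>commut_mult\<close>. As \<open>X\<close> normalizes
  \<open>B\<close>, the preimage of \<open>B\<close> is a subgroup.\<close>

lemma csub_centralizer:
  assumes X: "csub X" and B: "csub B" and XB: "X \<subseteq> normz B" and y: "y \<in> carrier G"
  shows "csub {x \<in> X. commut x y \<in> B}"
  unfolding closed_subgroup_def
proof
  have XG [simp]: "x \<in> carrier G" if "x \<in> X" for x using that csub_carrier[OF X] by blast
  have "{x \<in> X. commut x y \<in> B} = X \<inter> {x \<in> carrier G. commut x y \<in> B}" by auto
  moreover have "closedin T {x \<in> carrier G. commut x y \<in> B}"
    unfolding commut_def using y csub_closedin[OF B] by (intro closedin_word continuous_word) auto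
  ultimately show "closedin T {x \<in> X. commut x y \<in> B}"
    using csub_closedin[OF X] by auto
  show "subgroup {x \<in> X. commut x y \<in> B} G"
  proof (rule subgroupI)
    have "\<one> \<in> {x \<in> X. commut x y \<in> B}"
      using y csub_one[OF X] csub_one[OF B] by (simp add: commut_one)
    then show "{x \<in> X. commut x y \<in> B} \<noteq> {}" by blast
    fix a assume a: "a \<in> {x \<in> X. commut x y \<in> B}"
    then have "inv a \<otimes> inv (commut a y) \<otimes> a \<in> B"
      using XB by (intro normz_conj' csub_inv[OF B]) auto
    then show "inv a \<in> {x \<in> X. commut x y \<in> B}"
      using a y csub_inv[OF X] by (simp add: commut_inv)
    fix b assume b: "b \<in> {x \<in> X. commut x y \<in> B}"
    have "a \<otimes> commut b y \<otimes> inv a \<in> B"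
      using a b XB by (intro normz_conj) auto
    then show "a \<otimes> b \<in> {x \<in> X. commut x y \<in> B}"
      using a b y csub_mult[OF X] csub_mult[OF B] by (simp add: commut_mult)
  qed auto
qed

lemma commut_swap_mem: "csub B \<Longrightarrow> x \<in> carrier G \<Longrightarrow> y \<in> carrier G \<Longrightarrow> commut x y \<in> B \<Longrightarrow> commut y x \<in> B"
  using csub_inv inv_commut by metis

lemma csub_relative_center:
  assumes X: "csub X" and B: "csub B" and XB: "X \<subseteq> normz B" and Y: "Y \<subseteq> carrier G" "Y \<noteq> {}"
  shows "csub {x \<in> X. \<forall>y\<in>Y. commut x y \<in> B}"
proof -
  have "csub (\<Inter>y\<in>Y. {x \<in> X. commut x y \<in> B})"
    using csub_centralizer[OF X B XB] Y by (intro csub_INT) auto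
  moreover have "(\<Inter>y\<in>Y. {x \<in> X. commut x y \<in> B}) = {x \<in> X. \<forall>y\<in>Y. commut x y \<in> B}"
    using Y(2) by auto
  ultimately show ?thesis by simp
qed

lemma normz_if_commut:
  assumes "csub A" "x \<in> carrier G" "\<And>a. a \<in> A \<Longrightarrow> commut x a \<in> A" "\<And>a. a \<in> A \<Longrightarrow> commut (inv x) a \<in> A"
  shows "x \<in> normz A"
proof -
  have "x \<otimes> a \<otimes> inv x \<in> A \<and> inv x \<otimes> a \<otimes> x \<in> A" if a: "a \<in> A" for a
  proof -
    have aG: "a \<in> carrier G" using a csub_carrier[OF assms(1)] by blast
    show ?thesis
      using csub_mult[OF assms(1) assms(3)[OF a] a] csub_mult[OF assms(1) assms(4)[OF a] a]
        conj_eq_commut[OF assms(2) aG] conj_eq_commut[OF inv_closed[OF assms(2)] aG] assms(2) by simp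
  qed
  then show ?thesis
    using assms(2) by (simp add: normz_def)
qed

lemma commut_mem_if_normz:
  assumes "csub A" "y \<in> normz A" "a \<in> A" shows "commut a y \<in> A" "commut y a \<in> A"
proof -
  have G: "y \<in> carrier G" "a \<in> carrier G" using assms normz_carrier csub_carrier by blast+
  have "(y \<otimes> a \<otimes> inv y) \<otimes> inv a \<in> A"
    using csub_mult[OF assms(1) normz_conj[OF assms(2,3)] csub_inv[OF assms(1,3)]] .
  then show *: "commut y a \<in> A"
    using G by (simp add: commut_def)
  show "commut a y \<in> A"
    using commut_swap_mem[OF assms(1) G *] .
qed

end

context pro_p_group
begin

text \<open>The preimage in \<open>X\<close> of the \<open>p\<close>-th powers of
  \<open>X / B\<close>, which is a subgroup once \<open>X / B\<close> is abelian. Writing it as a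
  product set makes it closed, by compactness.\<close>

definition power_set :: "'a set \<Rightarrow> 'a set \<Rightarrow> 'a set"
  where "power_set X B = ((\<lambda>y. y [^] p) ` X) <#> B"

lemma closedin_power_image:
  assumes "csub X" shows "closedin T ((\<lambda>y. y [^] (n :: nat)) ` X)"
proof -
  have "continuous_map T T (\<lambda>y. y [^] n)"
  proof (induction n)
    case (Suc n)
    then show ?case by (auto intro!: continuous_word)
  next
    case 0
    show ?case using continuous_map_constant[OF one_closed] by simp
  qed
  moreover have "compactin T X"
    using closedin_compact_space[OF compact csub_closedin[OF assms]] .
  ultimately show ?thesis
    using image_compactin Hausdorff compactin_imp_closedin by metis
qed

context
  fixes X B
  assumes X: "csub X" and B: "csub B" "B \<subseteq> X" and comm: "\<forall>x\<in>X. \<forall>y\<in>X. commut x y \<in> B"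
begin

lemma abelian_factor_normz: "X \<subseteq> normz B"
proof
  fix x assume "x \<in> X"
  then show "x \<in> normz B"
    using comm B csub_carrier[OF X] csub_inv[OF X] by (intro normz_if_commut) auto
qed

lemma abelian_factor_conj: "\<forall>y\<in>X. \<forall>b\<in>B. y \<otimes> b \<otimes> inv y \<in> B"
  using abelian_factor_normz normz_conj by blast

lemma abelian_factor: "comm_group (factor_group G X B)"
  using factor_group_comm[OF csub_subgroup[OF X] csub_subgroup[OF B(1)] B(2) abelian_factor_conj] comm by blast

lemmas abelian_factor_facts =
  factor_group_facts[OF csub_subgroup[OF X] csub_subgroup[OF B(1)] B(2) abelian_factor_conj]

lemma power_set_iff: "x \<in> power_set X B \<longleftrightarrow>
    x \<in> X \<and> (\<exists>y\<in>X. B #> x = (B #> y) [^]\<^bsub>factor_group G X B\<^esub> p)"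
proof
  assume "x \<in> power_set X B"
  then obtain y b where yb: "y \<in> X" "b \<in> B" "x = y [^] p \<otimes> b"
    by (auto simp: power_set_def set_mult_def)
  then have x: "x \<in> X"
    using csub_mult[OF X csub_pow[OF X yb(1)]] B(2) by blast
  have "y \<in> carrier G" "b \<in> carrier G"
    using yb B csub_carrier[OF X] by auto
  then have "inv (y [^] p) \<otimes> x \<in> B"
    using yb by (simp add: cancel_left_inv)
  then have "B #> (y [^] p) = B #> x"
    using abelian_factor_facts(4) x csub_pow[OF X yb(1)] by blast
  then show "x \<in> X \<and> (\<exists>y\<in>X. B #> x = (B #> y) [^]\<^bsub>factor_group G X B\<^esub> p)"
    using x yb(1) abelian_factor_facts(5)[OF yb(1), of p] by auto
next
  assume "x \<in> X \<and> (\<exists>y\<in>X. B #> x = (B #> y) [^]\<^bsub>factor_group G X B\<^esub> p)"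
  then obtain y where y: "x \<in> X" "y \<in> X" "B #> (y [^] p) = B #> x"
    using abelian_factor_facts(5) by metis
  then have "inv (y [^] p) \<otimes> x \<in> B"
    using abelian_factor_facts(4)[of "y [^] p" x] csub_pow[OF X y(2)] by simp
  moreover have "x = y [^] p \<otimes> (inv (y [^] p) \<otimes> x)"
    using y csub_carrier[OF X] by (simp add: cancel_left subsetD)
  ultimately show "x \<in> power_set X B"
    using y(2) unfolding power_set_def set_mult_iff by blast
qed

lemma csub_power_set: "csub (power_set X B)"
  unfolding closed_subgroup_def
proof
  interpret Q: comm_group "factor_group G X B" by (rule abelian_factor)
  have Qc: "B #> x \<in> carrier (factor_group G X B)" if "x \<in> X" for x
    using that abelian_factor_facts(8) by blast
  show "closedin T (power_set X B)"
    unfolding power_set_def using closedin_power_image[OF X] csub_closedin[OF B(1)] by (rule closedin_set_mult)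
  show "subgroup (power_set X B) G"
  proof (rule subgroupI)
    show "power_set X B \<subseteq> carrier G"
      using power_set_iff csub_carrier[OF X] by blast
    have "\<one> [^] p \<otimes> \<one> \<in> power_set X B"
      unfolding power_set_def using csub_one[OF X] csub_one[OF B(1)] by (intro set_multI imageI)
    then show "power_set X B \<noteq> {}" by blast
    fix a assume "a \<in> power_set X B"
    then obtain y where a: "a \<in> X" "y \<in> X" "B #> a = (B #> y) [^]\<^bsub>factor_group G X B\<^esub> p"
      unfolding power_set_iff by blast
    have "B #> inv a = (B #> inv y) [^]\<^bsub>factor_group G X B\<^esub> p"
      using a abelian_factor_facts(7) Qc Q.nat_pow_inv by simp
    then show "inv a \<in> power_set X B"
      unfolding power_set_iff using csub_inv[OF X] a by blast
    fix b assume "b \<in> power_set X B"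
    then obtain z where b: "b \<in> X" "z \<in> X" "B #> b = (B #> z) [^]\<^bsub>factor_group G X B\<^esub> p"
      unfolding power_set_iff by blast
    have "B #> (a \<otimes> b) = (B #> (y \<otimes> z)) [^]\<^bsub>factor_group G X B\<^esub> p"
      using a b abelian_factor_facts(6) Qc Q.nat_pow_distrib by simp
    then show "a \<otimes> b \<in> power_set X B"
      unfolding power_set_iff using csub_mult[OF X] a b by blast
  qed
qed

lemma power_set_superset: "B \<subseteq> power_set X B"
proof
  fix b assume b: "b \<in> B"
  have "\<one> [^] p \<otimes> b \<in> power_set X B"
    unfolding power_set_def using csub_one[OF X] b by (intro set_multI imageI)
  then show "b \<in> power_set X B"
    using b csub_carrier[OF B(1)] by auto
qed

lemma power_mem_power_set: "x \<in> X \<Longrightarrow> x [^] p \<in> power_set X B"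
  unfolding power_set_iff using abelian_factor_facts(5) csub_pow[OF X] by blast

text \<open>A \<open>p\<close>-divisible abelian pro-\<open>p\<close> group is trivial: each element
  is, modulo \<open>B\<close>, a power with exponent \<open>p ^ k\<close> for every
  \<open>k\<close>, and for suitable \<open>k\<close> such powers lie in a prescribed open normal
  subgroup.\<close>

lemma power_set_proper:
  assumes "X \<subseteq> power_set X B" shows "X = B"
proof -
  interpret Q: comm_group "factor_group G X B" by (rule abelian_factor)
  have Qc: "B #> x \<in> carrier (factor_group G X B)" if "x \<in> X" for x
    using that abelian_factor_facts(8) by blast
  have div: "\<exists>y\<in>X. B #> x = (B #> y) [^]\<^bsub>factor_group G X B\<^esub> (p ^ k)" if "x \<in> X" for x k
    using that
  proof (induction k arbitrary: x)
    case 0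
    then have "(B #> x) [^]\<^bsub>factor_group G X B\<^esub> (p ^ 0) = B #> x"
      using Q.l_one[OF Qc] by (simp only: power_0 One_nat_def Q.nat_pow_Suc Q.nat_pow_0)
    then show ?case using 0 by metis
  next
    case (Suc k)
    obtain y where y: "y \<in> X" "B #> x = (B #> y) [^]\<^bsub>factor_group G X B\<^esub> p"
      using assms Suc.prems power_set_iff by blast
    obtain z where z: "z \<in> X" "B #> y = (B #> z) [^]\<^bsub>factor_group G X B\<^esub> (p ^ k)"
      using Suc.IH[OF y(1)] by blast
    have "B #> x = (B #> z) [^]\<^bsub>factor_group G X B\<^esub> (p ^ Suc k)"
      using y z Qc[OF z(1)] by (simp add: Q.nat_pow_pow mult.commute)
    then show ?case using z(1) by blast
  qed
  have "x \<in> B" if x: "x \<in> X" for x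
  proof (rule closed_memI[OF csub_closedin[OF B(1)]])
    show "x \<in> carrier G" using x csub_carrier[OF X] by blast
    fix N assume N: "onorm N"
    obtain k where k: "\<forall>x\<in>carrier G. x [^] (p ^ k) \<in> N" using onorm_pow[OF N] by blast
    obtain y where y: "y \<in> X" "B #> x = B #> (y [^] (p ^ k))"
      using div[OF x, of k] abelian_factor_facts(5) by metis
    have yN: "y [^] (p ^ k) \<in> N" using k y(1) csub_carrier[OF X] by blast
    have "inv x \<otimes> (y [^] (p ^ k)) \<in> B"
      using abelian_factor_facts(4)[OF x csub_pow[OF X y(1)]] y(2) by blast
    then have b: "inv (inv x \<otimes> (y [^] (p ^ k))) \<in> B" using csub_inv[OF B(1)] by blast
    define b where "b = inv (inv x \<otimes> (y [^] (p ^ k)))"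
    have G: "x \<in> carrier G" "y \<in> carrier G" using x y csub_carrier[OF X] by auto
    have "x = b \<otimes> (inv b \<otimes> (y [^] (p ^ k)) \<otimes> b)"
      using G by (simp add: b_def group_word)
    moreover have "inv b \<otimes> (y [^] (p ^ k)) \<otimes> b \<in> N"
      using onorm_conj(2)[OF N _ yN, of b] G by (simp add: b_def)
    moreover have "b \<in> B"
      using b by (simp only: b_def)
    ultimately show "\<exists>a\<in>B. \<exists>n\<in>N. x = a \<otimes> n"
      by (intro bexI[of _ b] bexI[of _ "inv b \<otimes> (y [^] (p ^ k)) \<otimes> b"])
  qed
  then show ?thesis using B(2) by blast
qed

end

section \<open>Towers with procyclic factors\<close>

text \<open>The inductive counterpart of \<open>polyprocyclic_series\<close>. Each factor comes with
  a topological generator \<open>x\<close> that normalizes the previous member, so that inductions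
  can use the chain of closed subgroups between \<open>A\<close> and
  \<open>gen x <#> A\<close>.\<close>

inductive procyclic_tower :: "'a set \<Rightarrow> bool"
  where
    trivial: "procyclic_tower {\<one>}"
  | extend: "\<lbrakk>procyclic_tower A; csub A; x \<in> normz A\<rbrakk> \<Longrightarrow> procyclic_tower (gen x <#> A)"

lemma procyclic_tower_csub: "procyclic_tower E \<Longrightarrow> csub E"
  by (induction rule: procyclic_tower.induct) (auto simp: csub_trivial csub_gen_mult)

lemma dedekind_eq:
  assumes Y: "csub Y" and K: "csub K" and A: "csub A" and "Y \<subseteq> K" "K \<inter> A = Y \<inter> A" "K <#> A = Y <#> A"
  shows "K = Y"
proof
  show "K \<subseteq> Y"
  proof
    fix z assume z: "z \<in> K"
    then have "z \<in> Y <#> A"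
      using set_mult_superset(1)[OF csub_subgroup[OF K] csub_subgroup[OF A]] assms(6) by blast
    then obtain y a where ya: "y \<in> Y" "a \<in> A" "z = y \<otimes> a"
      by (auto simp: set_mult_def)
    have G: "y \<in> carrier G" "a \<in> carrier G"
      using ya csub_carrier[OF Y] csub_carrier[OF A] by auto
    have "inv y \<otimes> z \<in> K"
      using csub_mult[OF K csub_inv[OF K] z] ya(1) assms(4) by blast
    then have "a \<in> K"
      using ya(3) G by (simp add: cancel_left_inv)
    then have "a \<in> Y"
      using assms(5) ya(2) by blast
    then show "z \<in> Y"
      using csub_mult[OF Y ya(1)] ya(3) by simp
  qed
qed (fact assms(4))

text \<open>By Dedekind's law, \<open>Y \<subseteq> K\<close> are equal as soon as \<open>Y \<inter> A = K \<inter> A\<close> and \<open>Y A = K A\<close>; the first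
  intersection is handled by induction, and the products form a chain.\<close>

lemma procyclic_tower_noetherian:
  assumes "procyclic_tower E"
  shows "\<lbrakk>\<X> \<noteq> {}; \<And>Y. Y \<in> \<X> \<Longrightarrow> csub Y \<and> Y \<subseteq> E\<rbrakk> \<Longrightarrow> \<exists>Y\<in>\<X>. \<forall>K\<in>\<X>. Y \<subseteq> K \<longrightarrow> K = Y"
  using assms
proof (induction arbitrary: \<X> rule: procyclic_tower.induct)
  case trivial
  then obtain Y where Y: "Y \<in> \<X>" by blast
  have "Z = {\<one>}" if "Z \<in> \<X>" for Z
    using trivial(2)[OF that] csub_one[of Z] by blast
  then show ?case using Y by blast
next
  case (extend A x)
  have A: "csub A" and x: "x \<in> normz A" by fact+
  have X: "csub Y" "Y \<subseteq> gen x <#> A" if "Y \<in> \<X>" for Y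
    using extend.prems(2)[OF that] by auto
  have "\<exists>Z\<in>(\<lambda>Y. Y \<inter> A) ` \<X>. \<forall>K\<in>(\<lambda>Y. Y \<inter> A) ` \<X>. Z \<subseteq> K \<longrightarrow> K = Z"
    using extend.prems(1) X(1) A by (intro extend.IH) (auto intro: csub_Int)
  then obtain Y0 where Y0: "Y0 \<in> \<X>" and max0: "\<And>K. K \<in> \<X> \<Longrightarrow> Y0 \<inter> A \<subseteq> K \<inter> A \<Longrightarrow> K \<inter> A = Y0 \<inter> A"
    by auto
  have prod: "csub (Y <#> A)" "A \<subseteq> Y <#> A" "Y <#> A \<subseteq> gen x <#> A" if "Y \<in> \<X>" for Y
  proof -
    have "Y \<subseteq> normz A"
      using X(2)[OF that] gen_mult_subset_normz[OF A x] by blast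
    then show "csub (Y <#> A)" using csub_set_mult X(1)[OF that] A by blast
    show "A \<subseteq> Y <#> A"
      using set_mult_superset(2) csub_subgroup X(1)[OF that] A by blast
    show "Y <#> A \<subseteq> gen x <#> A"
      using set_mult_minimal[OF csub_subgroup[OF csub_gen_mult[OF A x]] X(2)[OF that]]
        gen_mult_superset(1)[OF A] x normz_carrier by blast
  qed
  let ?F = "\<lambda>k. gen (x [^] (p ^ k)) <#> A"
  \<comment> \<open>Among the members whose intersection with \<open>A\<close> is the maximal one,
    the least \<open>k\<close> gives the largest product with \<open>A\<close>. If no
    \<open>k\<close> occurs, all these products equal \<open>A\<close>.\<close>
  define P where "P k \<longleftrightarrow> (\<exists>Y\<in>\<X>. Y \<inter> A = Y0 \<inter> A \<and> Y <#> A = ?F k)" for k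
  show ?case
  proof (cases "\<exists>k. P k")
    case True
    then obtain k where k: "P k" "\<And>j. j < k \<Longrightarrow> \<not> P j"
      using exists_least_iff[of P] by blast
    then obtain Y where Y: "Y \<in> \<X>" "Y \<inter> A = Y0 \<inter> A" "Y <#> A = ?F k"
      unfolding P_def by blast
    have "K = Y" if K: "K \<in> \<X>" "Y \<subseteq> K" for K
    proof -
      have KA: "K \<inter> A = Y0 \<inter> A"
        using max0[OF K(1)] Y(2) K(2) by blast
      have sub: "?F k \<subseteq> K <#> A"
        using mono_set_mult[OF K(2) order_refl, of G A] Y(3) by simp
      have "K <#> A = ?F k"
        using procyclic_subgroups[OF A x prod[OF K(1)]]
      proof
        assume "K <#> A = A"
        then show ?thesis using sub prod(2)[OF Y(1)] Y(3) by blast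
      next
        assume "\<exists>j. K <#> A = ?F j"
        then obtain j where j: "K <#> A = ?F j" by blast
        then have "P j" unfolding P_def using K(1) KA by blast
        then have "k \<le> j" using k(2) not_le by blast
        then show ?thesis
          using procyclic_filtration_antimono[OF A x] sub j by blast
      qed
      then show ?thesis
        using dedekind_eq[OF X(1)[OF Y(1)] X(1)[OF K(1)] A K(2)] KA Y by simp
    qed
    then show ?thesis using Y(1) by blast
  next
    case False
    have "K = Y0" if K: "K \<in> \<X>" "Y0 \<subseteq> K" for K
    proof -
      have KA: "K \<inter> A = Y0 \<inter> A"
        using max0[OF K(1)] K(2) by blast
      have "Z <#> A = A" if "Z \<in> \<X>" "Z \<inter> A = Y0 \<inter> A" for Z
        using procyclic_subgroups[OF A x prod[OF that(1)]] False that unfolding P_def by blast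
      then show ?thesis
        using dedekind_eq[OF X(1)[OF Y0] X(1)[OF K(1)] A K(2)] KA Y0 K(1) by simp
    qed
    then show ?thesis using Y0 by blast
  qed
qed

end

context pro_p_group
begin

text \<open>The Frattini argument: the closed subgroup \<open>\<Phi>\<close> generated by commutators and \<open>p\<close>-th powers
  of \<open>U\<close> is open in \<open>U\<close>, and a proper closed subgroup of \<open>U\<close> cannot supplement it.\<close>

lemma isolated_in_subgroups:
  assumes tower: "procyclic_tower (carrier G)" and nilp: "nilpotent_group G" and U: "csub U"
  shows "\<exists>N. onorm N \<and> (\<forall>K. csub K \<and> K \<subseteq> U \<and> U \<subseteq> K <#> N \<longrightarrow> K = U)"
proof -
  have noeth: "\<exists>Y\<in>\<X>. \<forall>K\<in>\<X>. Y \<subseteq> K \<longrightarrow> K = Y" if "\<X> \<noteq> {}" "\<And>Y. Y \<in> \<X> \<Longrightarrow> csub Y" for \<X>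
    using procyclic_tower_noetherian[OF tower that(1)] that(2) csub_carrier by blast
  have UG: "x \<in> carrier G" if "x \<in> U" for x using that csub_carrier[OF U] by blast
  have commU: "commut x y \<in> U" if "x \<in> U" "y \<in> U" for x y
    unfolding commut_def using that csub_mult[OF U] csub_inv[OF U] by blast
  define S where "S = (\<Union>x\<in>U. \<Union>y\<in>U. {commut x y}) \<union> (\<lambda>x. x [^] p) ` U"
  define \<Phi> where "\<Phi> = cl (generate G S)"
  have SU: "S \<subseteq> U" using commU csub_pow[OF U] by (auto simp: S_def)
  then have SG: "S \<subseteq> carrier G" using csub_carrier[OF U] by blast
  have \<Phi>: "csub \<Phi>" unfolding \<Phi>_def using csub_closure[OF generate_is_subgroup[OF SG]] .
  have \<Phi>_min: "\<Phi> \<subseteq> A" if "csub A" "S \<subseteq> A" for A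
    unfolding \<Phi>_def using that generate_subgroup_incl[OF that(2) csub_subgroup[OF that(1)]] csub_closedin
    by (intro closure_minimal) auto
  have \<Phi>U: "\<Phi> \<subseteq> U" using \<Phi>_min[OF U SU] .
  have S\<Phi>: "S \<subseteq> \<Phi>" unfolding \<Phi>_def
    using closure_superset[OF generate_incl[OF SG]] generate.incl[of _ S G] by blast
  have c\<Phi>: "commut x y \<in> \<Phi>" if "x \<in> U" "y \<in> U" for x y
    using S\<Phi> that unfolding S_def by blast
  have nz: "U \<subseteq> normz A" if A: "csub A" "\<Phi> \<subseteq> A" "A \<subseteq> U" for A
  proof
    fix x assume x: "x \<in> U"
    show "x \<in> normz A"
    proof (rule normz_if_commut[OF A(1) UG[OF x]])
      fix a assume "a \<in> A"
      then have "a \<in> U" using A(3) by blast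
      then show "commut x a \<in> A" "commut (inv x) a \<in> A"
        using c\<Phi>[OF x] c\<Phi>[OF csub_inv[OF U x]] A(2) by blast+
    qed
  qed
  \<comment> \<open>Finiteness of \<open>U / \<Phi>\<close> comes from the maximal condition: take
    \<open>A\<close> maximal among the groups in which \<open>\<Phi>\<close> has finite index.
    Adjoining any \<open>s\<close> of \<open>U\<close> preserves this, because
    \<open>s [^] p\<close> lies in \<open>\<Phi>\<close>; hence \<open>A\<close> is all of
    \<open>U\<close>.\<close>
  define \<X> where "\<X> = {A. csub A \<and> \<Phi> \<subseteq> A \<and> A \<subseteq> U \<and> relopen \<Phi> A}"
  have "relopen \<Phi> \<Phi>" unfolding relopen_def using onorm_whole by blast
  then have "\<Phi> \<in> \<X>" using \<Phi> \<Phi>U by (simp add: \<X>_def)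
  then have "\<exists>A\<in>\<X>. \<forall>K\<in>\<X>. A \<subseteq> K \<longrightarrow> K = A"
    by (intro noeth) (auto simp: \<X>_def)
  then obtain A where A: "A \<in> \<X>" "\<And>K. K \<in> \<X> \<Longrightarrow> A \<subseteq> K \<Longrightarrow> K = A"
    by blast
  then have A': "csub A" "\<Phi> \<subseteq> A" "A \<subseteq> U" "relopen \<Phi> A" by (auto simp: \<X>_def)
  have "U \<subseteq> A"
  proof
    fix s assume s: "s \<in> U"
    have sn: "s \<in> normz A" using nz[OF A'(1-3)] s by blast
    have "s [^] p \<in> A" using s S\<Phi> A'(2) by (auto simp: S_def)
    then have "relopen A (gen s <#> A)" using relopen_gen[OF A'(1) sn] p_pos by blast
    then have "relopen \<Phi> (gen s <#> A)" using relopen_trans A'(4) by blast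
    moreover have "gen s <#> A \<subseteq> U" using gen_mult_minimal[OF U s A'(3)] .
    moreover have "A \<subseteq> gen s <#> A" "s \<in> gen s <#> A"
      using gen_mult_superset[OF A'(1)] UG[OF s] by auto
    ultimately have "gen s <#> A = A"
      using csub_gen_mult[OF A'(1) sn] A'(2) by (intro A(2)) (auto simp: \<X>_def)
    then show "s \<in> A" using \<open>s \<in> gen s <#> A\<close> by simp
  qed
  then have "relopen \<Phi> U" using relopen_mono[OF A'(4)] by blast
  then obtain N where N: "onorm N" "U \<inter> N \<subseteq> \<Phi>" by (auto simp: relopen_def)
  have "K = U" if K: "csub K" "K \<subseteq> U" "U \<subseteq> K <#> N" for K
  proof (rule ccontr)
    assume "K \<noteq> U"
    \<comment> \<open>The proper closed subgroups of \<open>U\<close> above \<open>K\<close>. A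
      maximal one is a maximal closed subgroup of \<open>U\<close>.\<close>
    define \<Y> where "\<Y> = {M. csub M \<and> K \<subseteq> M \<and> M \<subset> U}"
    have "K \<in> \<Y>" using K \<open>K \<noteq> U\<close> by (auto simp: \<Y>_def)
    then have "\<exists>M\<in>\<Y>. \<forall>L\<in>\<Y>. M \<subseteq> L \<longrightarrow> L = M"
      by (intro noeth) (auto simp: \<Y>_def)
    then obtain M where M: "M \<in> \<Y>" "\<And>L. L \<in> \<Y> \<Longrightarrow> M \<subseteq> L \<Longrightarrow> L = M"
      by blast
    then have M': "csub M" "K \<subseteq> M" "M \<subset> U" by (auto simp: \<Y>_def)
    \<comment> \<open>Modulo \<open>M\<close> this \<open>x\<close> is central in \<open>U\<close>.
      So it normalizes \<open>M\<close>, maximality gives \<open>gen x <#> M = U\<close>, and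
      \<open>U / M\<close> is abelian.\<close>
    obtain x where x: "x \<in> U" "x \<notin> M"
      and xc: "\<And>y. y \<in> carrier G \<Longrightarrow> commut x y \<in> U \<Longrightarrow> commut x y \<in> M"
      using nilpotent_step[OF nilp csub_carrier[OF U], of M] M'(3) csub_one[OF M'(1)] by blast
    have xcU: "commut x y \<in> M" if "y \<in> U" for y
      using xc[OF UG[OF that] commU[OF x(1) that]] .
    have xn: "x \<in> normz M"
    proof -
      have "x \<otimes> m \<otimes> inv x \<in> M \<and> inv x \<otimes> m \<otimes> x \<in> M" if m: "m \<in> M" for m
      proof
        have mU: "m \<in> U" using m M'(3) by blast
        have G: "x \<in> carrier G" "m \<in> carrier G" using UG x mU by auto
        show "x \<otimes> m \<otimes> inv x \<in> M"
          using csub_mult[OF M'(1) xcU[OF mU] m] conj_eq_commut[OF G] by simp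
        have "inv x \<otimes> m \<otimes> x \<in> U"
          using csub_mult[OF U csub_mult[OF U csub_inv[OF U x(1)] mU] x(1)] .
        then have "inv (commut x (inv x \<otimes> m \<otimes> x)) \<otimes> m \<in> M"
          using csub_mult[OF M'(1) csub_inv[OF M'(1)] m] xcU by blast
        moreover have "inv (commut x (inv x \<otimes> m \<otimes> x)) \<otimes> m = inv x \<otimes> m \<otimes> x"
          using G by (simp add: commut_def group_word)
        ultimately show "inv x \<otimes> m \<otimes> x \<in> M" by simp
      qed
      then show ?thesis using UG[OF x(1)] by (simp add: normz_def)
    qed
    have UM: "gen x <#> M = U"
    proof (rule ccontr)
      assume "gen x <#> M \<noteq> U"
      moreover have "gen x <#> M \<subseteq> U" using gen_mult_minimal[OF U x(1)] M'(3) by blast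
      moreover have "M \<subseteq> gen x <#> M" "x \<in> gen x <#> M"
        using gen_mult_superset[OF M'(1) UG[OF x(1)]] by auto
      ultimately have "gen x <#> M = M"
        using csub_gen_mult[OF M'(1) xn] M'(2) by (intro M(2)) (auto simp: \<Y>_def)
      then show False using \<open>x \<in> gen x <#> M\<close> x(2) by simp
    qed
    have Un: "U \<subseteq> normz M" using gen_mult_subset_normz[OF M'(1) xn] UM by simp
    have UG': "U \<subseteq> carrier G" "U \<noteq> {}" using csub_carrier[OF U] x by auto
    have "gen x <#> M \<subseteq> {u \<in> U. \<forall>y\<in>U. commut u y \<in> M}"
      using csub_relative_center[OF U M'(1) Un UG'] x(1) xcU M'(3) Un commut_mem_if_normz(1)[OF M'(1)]
      by (intro gen_mult_minimal) auto
    then have comm: "\<forall>u\<in>U. \<forall>y\<in>U. commut u y \<in> M" using UM by blast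
    have MU: "M \<subseteq> U" using M'(3) by blast
    note PS = csub_power_set[OF U M'(1) MU comm] power_set_superset[OF U M'(1) MU comm]
      power_mem_power_set[OF U M'(1) MU comm] power_set_proper[OF U M'(1) MU comm]
    \<comment> \<open>Commutators lie in \<open>M\<close> and \<open>p\<close>-th powers in
      \<open>power_set U M\<close>. As \<open>K\<close> lies in \<open>M\<close> and
      \<open>U \<inter> N\<close> in \<open>\<Phi>\<close>, the supplement property puts all of
      \<open>U\<close> into \<open>power_set U M\<close>, which is impossible for proper
      \<open>M\<close>.\<close>
    have "\<Phi> \<subseteq> power_set U M"
      using PS(2,3) comm by (intro \<Phi>_min[OF PS(1)]) (auto simp: S_def)
    have "U \<subseteq> power_set U M"
    proof
      fix u assume u: "u \<in> U"
      then obtain k n where kn: "k \<in> K" "n \<in> N" "u = k \<otimes> n"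
        using K(3) by (auto simp: set_mult_def)
      have G: "k \<in> carrier G" "n \<in> carrier G"
        using kn csub_carrier[OF K(1)] csub_carrier[OF onorm_csub[OF N(1)]] by auto
      have "inv k \<otimes> u \<in> U" using csub_mult[OF U csub_inv[OF U] u] kn(1) K(2) by blast
      then have "n \<in> \<Phi>" using kn N(2) G by (auto simp: cancel_left_inv)
      then show "u \<in> power_set U M"
        using csub_mult[OF PS(1)] kn PS(2) M'(2) \<open>\<Phi> \<subseteq> power_set U M\<close> by blast
    qed
    then show False using PS(4) M'(3) by blast
  qed
  then show ?thesis using N(1) by blast
qed

text \<open>Modulo the next term, each term of the closed lower central series is generated by the
  commutators of generators of the previous term with generators of \<open>G\<close>.\<close>

lemma procyclic_tower_nilpotent:
  assumes fg: "topologically_fin_gen G T" and nilp: "nilpotent_group G"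
  shows "procyclic_tower (carrier G)"
proof -
  define \<Gamma> where "\<Gamma> i = cl (lower_central G i)" for i
  obtain S where S: "finite S" "S \<subseteq> carrier G" "cl (generate G S) = carrier G"
    using fg by (auto simp: topologically_fin_gen_def topologically_generates_def)
  have Smin: "carrier G \<subseteq> A" if "csub A" "S \<subseteq> A" for A
    using closure_minimal[OF generate_subgroup_incl[OF that(2) csub_subgroup[OF that(1)]] csub_closedin[OF that(1)]] S(3)
    by simp
  have \<Gamma>: "csub (\<Gamma> i)" for i
    unfolding \<Gamma>_def using csub_closure[OF subgroup_lower_central] .
  have \<Gamma>G: "x \<in> carrier G" if "x \<in> \<Gamma> i" for x i using that csub_carrier[OF \<Gamma>] by blast
  have \<Gamma>sup: "lower_central G i \<subseteq> \<Gamma> i" for i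
    unfolding \<Gamma>_def using closure_superset[OF lower_central_carrier] .
  have \<Gamma>comm: "commut x y \<in> \<Gamma> (Suc i)" if "x \<in> \<Gamma> i" "y \<in> carrier G" for x y i
  proof -
    have "\<Gamma> i \<subseteq> {x \<in> carrier G. commut x y \<in> \<Gamma> (Suc i)}"
      unfolding \<Gamma>_def[of i]
    proof (rule closure_minimal)
      show "lower_central G i \<subseteq> {x \<in> carrier G. commut x y \<in> \<Gamma> (Suc i)}"
        using lower_central_commut[OF _ that(2)] \<Gamma>sup lower_central_carrier by blast
      show "closedin T {x \<in> carrier G. commut x y \<in> \<Gamma> (Suc i)}"
        unfolding commut_def using that(2) csub_closedin[OF \<Gamma>] by (intro closedin_word continuous_word) auto
    qed
    then show ?thesis using that(1) by blast
  qed
  have \<Gamma>dec: "\<Gamma> (Suc i) \<subseteq> \<Gamma> i" for i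
    unfolding \<Gamma>_def by (rule closure_of_mono[OF lower_central_antimono])
  have \<Gamma>0: "\<Gamma> 0 = carrier G"
    using \<Gamma>sup[of 0] csub_carrier[OF \<Gamma>, of 0] by auto
  have nz: "x \<in> normz C" if "csub C" "\<Gamma> (Suc i) \<subseteq> C" "C \<subseteq> \<Gamma> i" "x \<in> carrier G" for x C i
  proof (rule normz_if_commut[OF that(1,4)])
    fix a assume a: "a \<in> C"
    have "commut a y \<in> C" if "y \<in> carrier G" for y
      using \<Gamma>comm[of a i y] a that \<open>\<Gamma> (Suc i) \<subseteq> C\<close> \<open>C \<subseteq> \<Gamma> i\<close> by blast
    moreover have "a \<in> carrier G" using a csub_carrier[OF that(1)] by blast
    ultimately show "commut x a \<in> C" "commut (inv x) a \<in> C"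
      using commut_swap_mem[OF that(1)] that(4) by auto
  qed
  have gens: "\<exists>X. finite X \<and> X \<subseteq> \<Gamma> i \<and> (\<forall>C. csub C \<and> X \<subseteq> C \<and> \<Gamma> (Suc i) \<subseteq> C \<longrightarrow> \<Gamma> i \<subseteq> C)" for i
  proof (induction i)
    case 0
    then show ?case using S Smin \<Gamma>0 by metis
  next
    case (Suc i)
    then obtain X where
      "finite X \<and> X \<subseteq> \<Gamma> i \<and> (\<forall>C. csub C \<and> X \<subseteq> C \<and> \<Gamma> (Suc i) \<subseteq> C \<longrightarrow> \<Gamma> i \<subseteq> C)"
      by (elim exE)
    then have X: "finite X" "X \<subseteq> \<Gamma> i" "\<And>C. csub C \<Longrightarrow> X \<subseteq> C \<Longrightarrow> \<Gamma> (Suc i) \<subseteq> C \<Longrightarrow> \<Gamma> i \<subseteq> C"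
      by simp_all
    define X' where "X' = (\<lambda>(x, s). commut x s) ` (X \<times> S)"
    have "finite X'" using X(1) S(1) by (simp add: X'_def)
    moreover have "X' \<subseteq> \<Gamma> (Suc i)"
      using \<Gamma>comm[of _ i] X(2) S(2) by (auto simp: X'_def subset_iff)
    moreover have "\<Gamma> (Suc i) \<subseteq> C" if C: "csub C" "X' \<subseteq> C" "\<Gamma> (Suc (Suc i)) \<subseteq> C" for C
    proof -
      \<comment> \<open>Cutting \<open>C\<close> down to \<open>\<Gamma> (Suc i)\<close> gives a
        subgroup normalized by \<open>G\<close>. For fixed \<open>s\<close> the elements commuting
        with \<open>s\<close> modulo \<open>D\<close> then form a closed subgroup; it contains
        \<open>X\<close> and \<open>\<Gamma> (Suc i)\<close>, hence \<open>\<Gamma> i\<close>.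
        Exchanging the two arguments extends this from \<open>S\<close> to all of
        \<open>G\<close>.\<close>
      define D where "D = C \<inter> \<Gamma> (Suc i)"
      have D: "csub D" "\<Gamma> (Suc (Suc i)) \<subseteq> D" "D \<subseteq> \<Gamma> (Suc i)" "X' \<subseteq> D"
        using csub_Int[OF C(1) \<Gamma>] C \<Gamma>dec[of "Suc i"] \<open>X' \<subseteq> \<Gamma> (Suc i)\<close> by (auto simp: D_def)
      have Dn: "carrier G \<subseteq> normz D" using nz[OF D(1-3)] by blast
      have "\<Gamma> i \<subseteq> {x \<in> carrier G. commut x s \<in> D}" if s: "s \<in> S" for s
      proof (rule X(3))
        show "csub {x \<in> carrier G. commut x s \<in> D}"
          using csub_centralizer[OF csub_whole D(1) Dn] s S(2) by blast
        show "X \<subseteq> {x \<in> carrier G. commut x s \<in> D}"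
          using D(4) s \<Gamma>G X(2) by (auto simp: X'_def)
        show "\<Gamma> (Suc i) \<subseteq> {x \<in> carrier G. commut x s \<in> D}"
          using \<Gamma>comm[of _ "Suc i" s] s S(2) D(2) \<Gamma>G by blast
      qed
      then have xs: "commut x s \<in> D" if "x \<in> \<Gamma> i" "s \<in> S" for x s using that by blast
      have "commut x y \<in> D" if x: "x \<in> \<Gamma> i" and y: "y \<in> carrier G" for x y
      proof -
        have "carrier G \<subseteq> {y \<in> carrier G. commut y x \<in> D}"
        proof (rule Smin)
          show "csub {y \<in> carrier G. commut y x \<in> D}"
            using csub_centralizer[OF csub_whole D(1) Dn] \<Gamma>G[OF x] by blast
          show "S \<subseteq> {y \<in> carrier G. commut y x \<in> D}"
            using xs[OF x] S(2) commut_swap_mem[OF D(1) \<Gamma>G[OF x]] by blast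
        qed
        then show ?thesis using y commut_swap_mem[OF D(1) y \<Gamma>G[OF x]] by blast
      qed
      then have "lower_central G (Suc i) \<subseteq> D"
        using \<Gamma>sup[of i] by (intro lower_central_Suc_subset csub_subgroup[OF D(1)]) blast
      then have "\<Gamma> (Suc i) \<subseteq> D"
        unfolding \<Gamma>_def using csub_closedin[OF D(1)] by (rule closure_minimal)
      then show ?thesis by (simp add: D_def)
    qed
    ultimately show ?case by (intro exI[of _ X']) simp
  qed
  have step: "procyclic_tower (\<Gamma> i)" if tw: "procyclic_tower (\<Gamma> (Suc i))" for i
  proof -
    \<comment> \<open>A closed subgroup between two consecutive terms is normalized by
      \<open>G\<close>, so generators can be adjoined one at a time.\<close>
    have tw': "\<exists>C. procyclic_tower C \<and> X \<subseteq> C \<and> \<Gamma> (Suc i) \<subseteq> C \<and> C \<subseteq> \<Gamma> i" if "finite X" "X \<subseteq> \<Gamma> i" for X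
      using that
    proof (induction X)
      case empty
      then show ?case using tw \<Gamma>dec by blast
    next
      case (insert x X)
      then obtain C where C: "procyclic_tower C" "X \<subseteq> C" "\<Gamma> (Suc i) \<subseteq> C" "C \<subseteq> \<Gamma> i" by blast
      have cC: "csub C" using procyclic_tower_csub[OF C(1)] .
      have xG: "x \<in> carrier G" and x: "x \<in> \<Gamma> i" using insert.prems \<Gamma>G by auto
      have "procyclic_tower (gen x <#> C)"
        using procyclic_tower.extend[OF C(1) cC nz[OF cC C(3,4) xG]] .
      then show ?case
        using gen_mult_superset[OF cC xG] gen_mult_minimal[OF \<Gamma> x C(4)] C by (intro exI[of _ "gen x <#> C"]) auto
    qed
    obtain X where X: "finite X \<and> X \<subseteq> \<Gamma> i \<and> (\<forall>C. csub C \<and> X \<subseteq> C \<and> \<Gamma> (Suc i) \<subseteq> C \<longrightarrow> \<Gamma> i \<subseteq> C)"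
      using gens[of i] by (elim exE)
    then obtain C where C: "procyclic_tower C" "X \<subseteq> C" "\<Gamma> (Suc i) \<subseteq> C" "C \<subseteq> \<Gamma> i"
      using tw'[of X] by auto
    then have "C = \<Gamma> i"
      using X procyclic_tower_csub[OF C(1)] by (intro subset_antisym) simp_all
    then show ?thesis
      using C(1) by simp
  qed
  obtain c where c: "lower_central G c = {\<one>}"
    using nilp by (auto simp: nilpotent_group_def)
  have "\<Gamma> c = {\<one>}"
    using closure_minimal[of "{\<one>}" "{\<one>}"] csub_closedin[OF csub_trivial] csub_one[OF \<Gamma>, of c] unfolding \<Gamma>_def c by auto
  then have base: "procyclic_tower (\<Gamma> c)" by (simp add: procyclic_tower.trivial)
  \<comment> \<open>The tower climbs from term \<open>c\<close> to term \<open>0\<close>; from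
    \<open>k = c\<close> on, the truncated difference stays \<open>0\<close>.\<close>
  have "procyclic_tower (\<Gamma> (c - k))" for k
  proof (induction k)
    case (Suc k)
    then show ?case
    proof (cases "k < c")
      case True
      then have "Suc (c - Suc k) = c - k" by simp
      then show ?thesis using step[of "c - Suc k"] Suc by simp
    qed simp
  qed (use base in simp)
  from this[of c] show ?thesis by (simp add: \<Gamma>0)
qed

text \<open>Every coset of \<open>A\<close> has a representative in \<open>gen x\<close>. The
  preimage of an open set of the factor group is open in \<open>E\<close>, so near this
  representative it contains an element of the abstract group generated by \<open>x\<close>.\<close>

lemma procyclic_factor:
  assumes A: "csub A" and x: "x \<in> normz A"
  shows "procyclic (factor_group G (gen x <#> A) A) (factor_topology G T (gen x <#> A) A)"
proof -
  define E where "E = gen x <#> A"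
  have E: "csub E" unfolding E_def using csub_gen_mult[OF A x] .
  have EG: "y \<in> carrier G" if "y \<in> E" for y using that csub_carrier[OF E] by blast
  have xG: "x \<in> carrier G" using x normz_carrier by blast
  have AE: "A \<subseteq> E" and xE: "x \<in> E" unfolding E_def using gen_mult_superset[OF A xG] by auto
  have conj: "\<forall>y\<in>E. \<forall>b\<in>A. y \<otimes> b \<otimes> inv y \<in> A"
    using gen_mult_subset_normz[OF A x] normz_conj unfolding E_def by blast
  note F = factor_group_facts[OF csub_subgroup[OF E] csub_subgroup[OF A] AE conj]
  let ?Q = "factor_group G E A" and ?t = "factor_topology G T E A"
  interpret h: group_hom "G\<lparr>carrier := E\<rparr>" ?Q "\<lambda>y. A #> y"
    using F(1,2) subgroup_imp_group[OF csub_subgroup[OF E]] by (simp add: group_hom_def group_hom_axioms_def)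
  have top: "topspace ?t = carrier ?Q"
    using csub_carrier[OF E] F(8) by (simp add: factor_topology_def topspace_quotient_topology topspace_eq inf_absorb2)
  have gen_img: "generate ?Q {A #> x} = (\<lambda>y. A #> y) ` generate G {x}"
    using h.generate_img[of "{x}"] xE generate_consistent[OF _ csub_subgroup[OF E], of "{x}"] by simp
  have "c \<in> ?t closure_of generate ?Q {A #> x}" if c: "c \<in> carrier ?Q" for c
    unfolding in_closure_of
  proof (intro conjI allI impI)
    show "c \<in> topspace ?t" using c top by simp
    fix U assume U: "c \<in> U \<and> openin ?t U"
    obtain y where y: "y \<in> E" "c = A #> y" using c F(8) by auto
    have "openin (subtopology T E) {z \<in> topspace (subtopology T E). A #> z \<in> U}"
      using U unfolding factor_topology_def openin_quotient_topology by blast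
    then obtain W where W: "openin T W" "{z \<in> topspace (subtopology T E). A #> z \<in> U} = W \<inter> E"
      unfolding openin_subtopology by blast
    obtain g a where ga: "g \<in> gen x" "a \<in> A" "y = g \<otimes> a"
      using y(1) unfolding E_def set_mult_iff by blast
    have gE: "g \<in> E" using ga(1) set_mult_superset(1)[OF csub_subgroup[OF csub_gen[OF xG]] csub_subgroup[OF A]] unfolding E_def by blast
    have aG: "a \<in> carrier G" using ga(2) csub_carrier[OF A] by blast
    have "inv g \<otimes> y \<in> A" using ga EG[OF gE] aG by (simp add: cancel_left_inv)
    then have "A #> g = A #> y" using F(4)[OF gE y(1)] by blast
    then have "g \<in> {z \<in> topspace (subtopology T E). A #> z \<in> U}"
      using U y gE EG by (simp add: topspace_eq)
    then have gW: "g \<in> W" using W(2) by blast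
    have "\<forall>V. g \<in> V \<and> openin T V \<longrightarrow> (\<exists>s. s \<in> generate G {x} \<and> s \<in> V)"
      using ga(1) unfolding gen_def in_closure_of by (elim conjE)
    then obtain s where s: "s \<in> generate G {x}" "s \<in> W" using gW W(1) by blast
    have "s \<in> E" using s(1) generate_subgroup_incl[OF _ csub_subgroup[OF E], of "{x}"] xE by blast
    then have "A #> s \<in> U" using s(2) W(2) by blast
    then show "\<exists>d. d \<in> generate ?Q {A #> x} \<and> d \<in> U"
      using s(1) gen_img by blast
  qed
  moreover have "?t closure_of generate ?Q {A #> x} \<subseteq> carrier ?Q"
    using closure_of_subset_topspace top by metis
  moreover have "A #> x \<in> carrier ?Q" using F(8) xE by blast
  ultimately have "topologically_generates ?Q ?t {A #> x}"
    unfolding topologically_generates_def by blast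
  then show ?thesis unfolding procyclic_def E_def by blast
qed

text \<open>Guarantees that the choice in \<open>hirsch_length\<close> is made from a nonempty set,
  so that its value is the count of an actual series.\<close>

lemma polyprocyclic_of_tower:
  assumes "procyclic_tower E"
  shows "\<exists>n F. F 0 = {\<one>} \<and> F n = E \<and> (\<forall>i\<le>n. csub (F i)) \<and>
    (\<forall>i<n. F i \<lhd> G\<lparr>carrier := F (Suc i)\<rparr> \<and>
      procyclic (factor_group G (F (Suc i)) (F i)) (factor_topology G T (F (Suc i)) (F i)))"
  using assms
proof (induction rule: procyclic_tower.induct)
  case trivial
  show ?case by (intro exI[of _ 0] exI[of _ "\<lambda>_. {\<one>}"]) (simp add: csub_trivial)
next
  case (extend A x)
  from extend.IH obtain n F where "F 0 = {\<one>} \<and> F n = A \<and> (\<forall>i\<le>n. csub (F i)) \<and>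
    (\<forall>i<n. F i \<lhd> G\<lparr>carrier := F (Suc i)\<rparr> \<and>
      procyclic (factor_group G (F (Suc i)) (F i)) (factor_topology G T (F (Suc i)) (F i)))"
    by (elim exE)
  note F = conjunct1[OF this] conjunct1[OF conjunct2[OF this]]
    conjunct1[OF conjunct2[OF conjunct2[OF this]]] conjunct2[OF conjunct2[OF conjunct2[OF this]]]
  define F' where "F' = F(Suc n := gen x <#> A)"
  have xG: "x \<in> carrier G" using extend(3) normz_carrier by blast
  have F': "F' i = F i" if "i \<le> n" for i using that by (simp add: F'_def)
  have F'n: "F' (Suc n) = gen x <#> A" by (simp add: F'_def)
  have norm: "A \<lhd> G\<lparr>carrier := gen x <#> A\<rparr>"
    using normal_in_subgroup[OF csub_subgroup[OF csub_gen_mult[OF extend(2,3)]] csub_subgroup[OF extend(2)]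
        gen_mult_superset(1)[OF extend(2) xG]]
      gen_mult_subset_normz[OF extend(2,3)] normz_conj by blast
  have "F' i \<lhd> G\<lparr>carrier := F' (Suc i)\<rparr> \<and>
      procyclic (factor_group G (F' (Suc i)) (F' i)) (factor_topology G T (F' (Suc i)) (F' i))" if i: "i < Suc n" for i
  proof (cases "i = n")
    case True
    then show ?thesis
      using norm procyclic_factor[OF extend(2,3)] F(2) F'[of n] F'n by simp
  next
    case False
    then show ?thesis
      using F(4) i F'[of i] F'[of "Suc i"] by simp
  qed
  moreover have "csub (F' i)" if "i \<le> Suc n" for i
    using that F(3) F' F'n csub_gen_mult[OF extend(2,3)] by (cases "i = Suc n") auto
  moreover have "F' 0 = {\<one>}" using F'[of 0] F(1) by simp
  ultimately show ?case using F'n by (intro exI[of _ "Suc n"] exI[of _ F']) simp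
qed

lemma infinite_padic: "infinite (padic_carrier p)"
proof -
  have p2: "p \<ge> 2" using prime prime_ge_2_nat by blast
  \<comment> \<open>The natural number \<open>k\<close> as a compatible sequence of residues. At
    level \<open>j + k\<close> the modulus exceeds both \<open>j\<close> and \<open>k\<close>, so
    the residues are the numbers themselves.\<close>
  define f where "f k = (\<lambda>n. int k mod int p ^ n)" for k :: nat
  have "inj f"
  proof (rule injI)
    fix j k assume jk: "f j = f k"
    have less: "int m < int p ^ m" for m
      using power_gt_expt[of p m] p2 by (metis One_nat_def Suc_le_lessD numeral_2_eq_2 of_nat_less_iff of_nat_power)
    have *: "int m mod int p ^ (j + k) = int m" if "m \<le> j + k" for m
    proof (rule mod_pos_pos_trivial)
      show "int m < int p ^ (j + k)"
        using less[of "j + k"] that by linarith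
    qed simp
    show "j = k"
      using fun_cong[OF jk, of "j + k"] *[of j] *[of k] by (simp add: f_def)
  qed
  moreover have "range f \<subseteq> padic_carrier p"
  proof
    fix y assume "y \<in> range f"
    then obtain k where "y = f k" by blast
    then show "y \<in> padic_carrier p"
      using p_pos by (auto simp: padic_carrier_def f_def mod_mod_cancel)
  qed
  ultimately show ?thesis using range_inj_infinite infinite_super by blast
qed

text \<open>By pigeonhole: if \<open>E \<inter> N \<subseteq> A\<close>, two elements of
  \<open>E\<close> in one coset of \<open>N\<close> lie in one coset of \<open>A\<close>, and
  \<open>N\<close> has only finitely many cosets.\<close>

lemma infinite_factor_not_relopen:
  assumes E: "csub E" and A: "A \<lhd> G\<lparr>carrier := E\<rparr>" "csub A" "A \<subseteq> E"
    and inf: "infinite (carrier (factor_group G E A))"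
  shows "\<not> relopen A E"
proof
  assume "relopen A E"
  then obtain N where N: "onorm N" "E \<inter> N \<subseteq> A" by (auto simp: relopen_def)
  obtain R where R: "finite R" "R \<subseteq> carrier G" "\<forall>x\<in>carrier G. \<exists>f\<in>R. \<exists>n\<in>N. x = f \<otimes> n"
    using onorm_finite_cosets[OF N(1)] by blast
  have EG: "y \<in> carrier G" if "y \<in> E" for y using that csub_carrier[OF E] by blast
  have "\<forall>x\<in>E. \<exists>f. f \<in> R \<and> inv f \<otimes> x \<in> N"
  proof
    fix x assume "x \<in> E"
    then obtain f n where "f \<in> R" "n \<in> N" "x = f \<otimes> n" using R(3) EG by blast
    then show "\<exists>f. f \<in> R \<and> inv f \<otimes> x \<in> N"
      using R(2) csub_carrier[OF onorm_csub[OF N(1)]] by (intro exI[of _ f]) (auto simp: cancel_left_inv subsetD)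
  qed
  from bchoice[OF this] obtain r where r: "\<And>x. x \<in> E \<Longrightarrow> r x \<in> R \<and> inv (r x) \<otimes> x \<in> N" by blast
  have conj: "\<forall>y\<in>E. \<forall>b\<in>A. y \<otimes> b \<otimes> inv y \<in> A"
    using normal.inv_op_closed2[OF A(1)] csub_subgroup[OF E] by (auto simp: m_inv_consistent)
  note F = factor_group_facts[OF csub_subgroup[OF E] csub_subgroup[OF A(2)] A(3) conj]
  have key: "A #> x = A #> y" if xy: "x \<in> E" "y \<in> E" "r x = r y" for x y
  proof -
    have G: "r x \<in> carrier G" "x \<in> carrier G" "y \<in> carrier G" using r[OF xy(1)] R(2) xy EG by auto
    have "inv (inv (r x) \<otimes> x) \<otimes> (inv (r x) \<otimes> y) \<in> N"
      using r xy csub_mult[OF onorm_csub[OF N(1)]] csub_inv[OF onorm_csub[OF N(1)]] by metis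
    then have "inv x \<otimes> y \<in> N" using G by (simp add: group_word)
    moreover have "inv x \<otimes> y \<in> E" using csub_mult[OF E csub_inv[OF E]] xy by blast
    ultimately show ?thesis using F(4) xy N(2) by blast
  qed
  have "carrier (factor_group G E A) \<subseteq> (\<lambda>f. A #> (SOME x. x \<in> E \<and> r x = f)) ` R"
  proof
    fix c assume "c \<in> carrier (factor_group G E A)"
    then obtain x where x: "x \<in> E" "c = A #> x" using F(8) by auto
    define z where "z = (SOME z. z \<in> E \<and> r z = r x)"
    have "z \<in> E \<and> r z = r x"
      unfolding z_def using x(1) by (intro someI[of "\<lambda>z. z \<in> E \<and> r z = r x" x]) simp
    then have "c = A #> z"
      using key[OF x(1), of z] x(2) by simp
    then show "c \<in> (\<lambda>f. A #> (SOME x. x \<in> E \<and> r x = f)) ` R"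
      unfolding z_def using r[OF x(1)] by (intro image_eqI[of _ _ "r x"]) (rule refl | assumption | elim conjE)+
  qed
  from finite_surj[OF R(1) this] show False using inf by contradiction
qed

text \<open>In a series realizing the chosen count there are two infinite factors, at positions
  \<open>i < j\<close>. The member \<open>F (Suc i)\<close> is infinite because of the factor at
  \<open>i\<close>, and it is not open because the factor at \<open>j\<close> lies above it.\<close>

lemma hirsch_length_witness:
  assumes tower: "procyclic_tower (carrier G)" and h: "hirsch_length p G T > 1"
  shows "\<exists>A. csub A \<and> \<not> relopen {\<one>} A \<and> \<not> openin T A"
proof -
  obtain n F where "polyprocyclic_series G T n F"
    using polyprocyclic_of_tower[OF tower] unfolding polyprocyclic_series_def by (elim exE)
  then have ex: "\<exists>h n F. polyprocyclic_series G T n F \<and> h = padic_factor_count p G T n F"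
    by (intro exI[of _ "padic_factor_count p G T n F"] exI[of _ n] exI[of _ F]) simp
  have "\<exists>n F. polyprocyclic_series G T n F \<and> hirsch_length p G T = padic_factor_count p G T n F"
    unfolding hirsch_length_def using someI_ex[OF ex] .
  then obtain n F where F: "polyprocyclic_series G T n F" "hirsch_length p G T = padic_factor_count p G T n F"
    by (elim exE conjE)
  have cF: "csub (F i)" if "i \<le> n" for i using F(1) that by (simp add: polyprocyclic_series_def)
  have nF: "F i \<lhd> G\<lparr>carrier := F (Suc i)\<rparr>" if "i < n" for i using F(1) that by (simp add: polyprocyclic_series_def)
  have sub1: "F i \<subseteq> F (Suc i)" if "i < n" for i
    using subgroup.subset[OF normal_imp_subgroup[OF nF[OF that]]] by simp
  have sub: "i \<le> j \<Longrightarrow> j \<le> n \<Longrightarrow> F i \<subseteq> F j" for i j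
  proof (induction j rule: dec_induct)
    case (step k)
    then show ?case using sub1[of k] by auto
  qed simp
  define I where "I = {i. i < n \<and> topological_group_isomorphic
      (factor_group G (F (Suc i)) (F i)) (factor_topology G T (F (Suc i)) (F i))
      (padic_int p) (padic_topology p)}"
  have "card I > 1" using h F(2) by (simp add: padic_factor_count_def I_def)
  then obtain i j where ij0: "i \<in> I" "j \<in> I" "i \<noteq> j"
    using card_le_Suc0_iff_eq[of I] by (metis One_nat_def card.infinite not_less not_less_zero)
  then obtain i j where ij: "i \<in> I" "j \<in> I" "i < j" by (metis linorder_neqE_nat)
  have nrel: "\<not> relopen (F i) (F (Suc i))" if iI: "i \<in> I" for i
  proof (rule infinite_factor_not_relopen)
    have i: "i < n" using iI by (simp add: I_def)
    show "csub (F (Suc i))" "csub (F i)" using cF i by auto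
    show "F i \<lhd> G\<lparr>carrier := F (Suc i)\<rparr>" "F i \<subseteq> F (Suc i)" using nF sub1 i by auto
    obtain f where "f \<in> iso (factor_group G (F (Suc i)) (F i)) (padic_int p)"
      using iI unfolding I_def topological_group_isomorphic_def by blast
    then have "bij_betw f (carrier (factor_group G (F (Suc i)) (F i))) (padic_carrier p)"
      by (simp add: iso_def padic_int_def)
    then show "infinite (carrier (factor_group G (F (Suc i)) (F i)))"
      using infinite_padic bij_betw_finite by blast
  qed
  have lt: "j < n" using ij by (simp add: I_def)
  have A: "csub (F (Suc i))" using cF ij(3) lt by simp
  moreover have "\<not> relopen {\<one>} (F (Suc i))"
    using nrel[OF ij(1)] relopen_mono[of "{\<one>}" "F (Suc i)" "F i"] csub_one[OF cF[of i]] ij(3) lt by auto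
  moreover have "\<not> openin T (F (Suc i))"
  proof
    assume "openin T (F (Suc i))"
    then have "relopen (F (Suc i)) (carrier G)" using relopen_whole_iff[OF csub_subgroup[OF A]] by simp
    moreover have "F (Suc i) \<subseteq> F j" using sub[of "Suc i" j] ij(3) lt by simp
    moreover have "F (Suc j) \<subseteq> carrier G" using cF[of "Suc j"] lt csub_carrier by simp
    ultimately show False using nrel[OF ij(2)] relopen_mono by blast
  qed
  ultimately show ?thesis by blast
qed

end

section \<open>Closed subgroups of infinite index\<close>

text \<open>The commutator is only supposed to commute with \<open>x\<close>. Its powers are
  therefore collected on the left, where they never have to be moved past \<open>y\<close>.\<close>

lemma (in group) commut_pow:
  assumes "x \<in> carrier G" "y \<in> carrier G" and comm: "commut x y \<otimes> x = x \<otimes> commut x y"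
  shows "x [^] (m :: nat) \<otimes> y = commut x y [^] m \<otimes> (y \<otimes> x [^] m)"
proof (induction m)
  case (Suc m)
  define c where "c = commut x y"
  have G: "x \<in> carrier G" "y \<in> carrier G" "c \<in> carrier G"
    using assms by (auto simp: c_def)
  have xy: "x \<otimes> y = c \<otimes> (y \<otimes> x)"
    using assms by (simp add: c_def commut_def group_word)
  have cm: "c [^] m \<otimes> x = x \<otimes> c [^] m"
    using group_commutes_pow[of c x m] comm G by (simp add: c_def)
  have xm: "x [^] Suc m = x \<otimes> x [^] m"
    by (rule nat_pow_Suc2[OF G(1)])
  then have "x [^] Suc m \<otimes> y = x \<otimes> (x [^] m \<otimes> y)"
    by (simp only: m_assoc[OF G(1) nat_pow_closed[OF G(1)] G(2)])
  also have "\<dots> = (x \<otimes> c [^] m) \<otimes> (y \<otimes> x [^] m)"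
    using Suc G by (simp add: c_def m_assoc)
  also have "\<dots> = c [^] m \<otimes> ((x \<otimes> y) \<otimes> x [^] m)"
    using G by (simp add: cm[symmetric] m_assoc)
  also have "\<dots> = c [^] Suc m \<otimes> (y \<otimes> (x \<otimes> x [^] m))"
    using G by (simp add: xy m_assoc)
  also have "x \<otimes> x [^] m = x [^] Suc m"
    by (rule xm[symmetric])
  finally show ?case by (simp add: c_def)
qed (use assms in simp)

context pro_p_group
begin

text \<open>In \<open>Y / B\<close> the commutator of \<open>x\<close> and \<open>y\<close> commutes
  with \<open>x\<close>, so by \<open>commut_pow\<close> its \<open>m\<close>-th power is the
  commutator of \<open>x [^] m\<close> and \<open>y\<close>, which is trivial.\<close>

lemma commut_pow_mod:
  assumes Y: "csub Y" and B: "csub B" "B \<subseteq> Y" "Y \<subseteq> normz B" and xy: "x \<in> Y" "y \<in> Y"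
    and cx: "commut (commut x y) x \<in> B" and xm: "commut (x [^] m) y \<in> B"
  shows "commut x y [^] (m :: nat) \<in> B"
proof -
  have conj: "\<forall>y\<in>Y. \<forall>b\<in>B. y \<otimes> b \<otimes> inv y \<in> B" using B(3) normz_conj by blast
  note F = factor_group_facts[OF csub_subgroup[OF Y] csub_subgroup[OF B(1)] B(2) conj]
  interpret Q: group "factor_group G Y B" by (rule F(1))
  have cY: "commut a b \<in> Y" if "a \<in> Y" "b \<in> Y" for a b
    using csub_mult[OF Y csub_mult[OF Y csub_mult[OF Y that] csub_inv[OF Y that(1)]] csub_inv[OF Y that(2)]]
    by (simp add: commut_def)
  have Qc: "B #> a \<in> carrier (factor_group G Y B)" if "a \<in> Y" for a
    using that F(8) by blast
  have hc: "B #> commut a b = Q.commut (B #> a) (B #> b)" if ab: "a \<in> Y" "b \<in> Y" for a b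
    unfolding commut_def Q.commut_def
    using F(6)[OF csub_mult[OF Y csub_mult[OF Y ab] csub_inv[OF Y ab(1)]] csub_inv[OF Y ab(2)]]
      F(6)[OF csub_mult[OF Y ab] csub_inv[OF Y ab(1)]] F(6)[OF ab] F(7)[OF ab(1)] F(7)[OF ab(2)] by simp
  let ?x = "B #> x" and ?y = "B #> y" and ?Q = "factor_group G Y B"
  have xmY: "x [^] m \<in> Y" using csub_pow[OF Y xy(1)] .
  have "Q.commut (Q.commut ?x ?y) ?x = \<one>\<^bsub>?Q\<^esub>"
    using hc[OF cY[OF xy] xy(1)] hc[OF xy] F(3)[OF cY[OF cY[OF xy] xy(1)]] cx by simp
  then have c: "Q.commut ?x ?y \<otimes>\<^bsub>?Q\<^esub> ?x = ?x \<otimes>\<^bsub>?Q\<^esub> Q.commut ?x ?y"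
    using Q.commut_eq_one_iff Qc xy by (metis Q.commut_closed)
  have "Q.commut (?x [^]\<^bsub>?Q\<^esub> m) ?y = \<one>\<^bsub>?Q\<^esub>"
    using hc[OF xmY xy(2)] F(5)[OF xy(1), of m] F(3)[OF cY[OF xmY xy(2)]] xm by simp
  then have "?x [^]\<^bsub>?Q\<^esub> m \<otimes>\<^bsub>?Q\<^esub> ?y = ?y \<otimes>\<^bsub>?Q\<^esub> ?x [^]\<^bsub>?Q\<^esub> m"
    using Q.commut_eq_one_iff Qc xy by (metis Q.nat_pow_closed)
  moreover have "?x [^]\<^bsub>?Q\<^esub> m \<otimes>\<^bsub>?Q\<^esub> ?y = Q.commut ?x ?y [^]\<^bsub>?Q\<^esub> m \<otimes>\<^bsub>?Q\<^esub> (?y \<otimes>\<^bsub>?Q\<^esub> ?x [^]\<^bsub>?Q\<^esub> m)"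
    using Q.commut_pow[OF Qc[OF xy(1)] Qc[OF xy(2)] c] .
  ultimately have "Q.commut ?x ?y [^]\<^bsub>?Q\<^esub> m = \<one>\<^bsub>?Q\<^esub>"
    using Qc xy by (metis Q.commut_closed Q.m_closed Q.nat_pow_closed Q.r_cancel_one')
  then have "B #> (commut x y [^] m) = \<one>\<^bsub>?Q\<^esub>"
    using F(5)[OF cY[OF xy], of m] hc[OF xy] by simp
  then show ?thesis using F(3)[OF csub_pow[OF Y cY[OF xy]]] by blast
qed

text \<open>An element of \<open>X\<close> that is central and torsion modulo \<open>B\<close> generates with \<open>B\<close> an invariant
  subgroup in which \<open>B\<close> has finite index; by maximality it lies in \<open>B\<close>. Hence \<open>X / B\<close> turns out to
  be a central copy of \<open>\<int>\<^sub>p\<close>.\<close>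

context
  fixes Y X B
  assumes nilp: "nilpotent_group G"
    and Y: "csub Y" and X: "csub X" "X \<subseteq> Y" "Y \<subseteq> normz X" and B: "csub B" "B \<subseteq> X" "Y \<subseteq> normz B"
    and nrel: "\<not> relopen B X"
    and maximal: "\<And>C. \<lbrakk>csub C; B \<subseteq> C; C \<subseteq> X; Y \<subseteq> normz C; C \<noteq> B\<rbrakk> \<Longrightarrow> relopen C X"
begin

lemma central_torsion_free:
  assumes "x \<in> X" "\<forall>y\<in>Y. commut x y \<in> B" "x [^] (p ^ k) \<in> B" shows "x \<in> B"
proof (rule ccontr)
  assume nB: "x \<notin> B"
  have YG: "Y \<subseteq> carrier G" using csub_carrier[OF Y] .
  have xG: "x \<in> carrier G" and xn: "x \<in> normz B" using assms(1) X(2) YG B(3) by auto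
  have XB: "X \<subseteq> normz B" using X(2) B(3) by blast
  define Z where "Z = {x \<in> X. \<forall>y\<in>Y. commut x y \<in> B}"
  have Z: "csub Z" unfolding Z_def
    using csub_relative_center[OF X(1) B(1) XB YG] csub_one[OF Y] by blast
  have BZ: "B \<subseteq> Z" using B commut_mem_if_normz(1)[OF B(1)] by (auto simp: Z_def)
  have CZ: "gen x <#> B \<subseteq> Z" using gen_mult_minimal[OF Z _ BZ] assms by (simp add: Z_def)
  define C where "C = gen x <#> B"
  have C: "csub C" "B \<subseteq> C" "x \<in> C"
    using csub_gen_mult[OF B(1) xn] gen_mult_superset[OF B(1) xG] by (auto simp: C_def)
  have "Y \<subseteq> normz C"
  proof
    fix y assume y: "y \<in> Y"
    have "commut z c \<in> C" if "z \<in> Y" "c \<in> C" for z c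
    proof -
      have "commut c z \<in> C" using that CZ C(2) by (auto simp: Z_def C_def)
      then show ?thesis using commut_swap_mem[OF C(1)] that YG csub_carrier[OF C(1)] by blast
    qed
    then show "y \<in> normz C" using y YG csub_inv[OF Y] by (intro normz_if_commut[OF C(1)]) auto
  qed
  moreover have "C \<subseteq> X" using CZ by (auto simp: Z_def C_def)
  ultimately have "relopen C X" using maximal[OF C(1,2)] C(3) nB by blast
  moreover have "relopen B C" unfolding C_def using relopen_gen[OF B(1) xn assms(3)] p_pos by simp
  ultimately show False using relopen_trans nrel by blast
qed

text \<open>Let \<open>Z / B\<close> be the part of \<open>X / B\<close> that is central in
  \<open>Y / B\<close>. Nilpotency makes it nontrivial, so by maximality \<open>Z\<close> has finite
  index in \<open>X\<close> and contains the powers of \<open>X\<close> with some exponent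
  \<open>p ^ k\<close>. If \<open>X\<close> were larger, nilpotency modulo \<open>Z\<close> would
  give \<open>x\<close> outside \<open>Z\<close> with commutators in \<open>Z\<close>. Their powers
  with exponent \<open>p ^ k\<close> are commutators of a power of \<open>x\<close> that lies in
  \<open>Z\<close>, hence fall into \<open>B\<close>; as \<open>Z / B\<close> is torsion-free,
  \<open>x\<close> would be in \<open>Z\<close> after all.\<close>

lemma maximal_factor_central: "\<forall>x\<in>X. \<forall>y\<in>Y. commut x y \<in> B"
proof -
  have YG: "Y \<subseteq> carrier G" using csub_carrier[OF Y] .
  have XB: "X \<subseteq> normz B" using X(2) B(3) by blast
  define Z where "Z = {x \<in> X. \<forall>y\<in>Y. commut x y \<in> B}"
  have Z: "csub Z" unfolding Z_def
    using csub_relative_center[OF X(1) B(1) XB YG] csub_one[OF Y] by blast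
  have BZ: "B \<subseteq> Z" using B commut_mem_if_normz(1)[OF B(1)] by (auto simp: Z_def)
  have YZ: "Y \<subseteq> normz Z"
  proof
    fix y assume y: "y \<in> Y"
    have "commut z c \<in> Z" if "z \<in> Y" "c \<in> Z" for z c
    proof -
      have "commut c z \<in> Z" using that BZ by (auto simp: Z_def)
      then show ?thesis using commut_swap_mem[OF Z] that YG csub_carrier[OF Z] by blast
    qed
    then show "y \<in> normz Z" using y YG csub_inv[OF Y] by (intro normz_if_commut[OF Z]) auto
  qed
  have XG: "X \<subseteq> carrier G" using csub_carrier[OF X(1)] .
  have commX: "commut x y \<in> X" if "x \<in> X" "y \<in> Y" for x y
    using commut_mem_if_normz(1)[OF X(1) _ that(1)] X(3) that(2) by blast
  have "X \<subseteq> Z"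
  proof (rule ccontr)
    assume nXZ: "\<not> X \<subseteq> Z"
    have "relopen B B" unfolding relopen_def using onorm_whole by blast
    then have "\<not> X \<subseteq> B" using nrel B(2) by (metis subset_antisym)
    from nilpotent_step[OF nilp XG this csub_one[OF B(1)]]
    obtain z where z: "z \<in> X" "z \<notin> B" "\<forall>y\<in>carrier G. commut z y \<in> X \<longrightarrow> commut z y \<in> B" by auto
    have "z \<in> Z" using z commX YG by (auto simp: Z_def)
    then have "Z \<noteq> B" using z(2) by blast
    moreover have "Z \<subseteq> X" by (auto simp: Z_def)
    ultimately have "relopen Z X" using maximal[OF Z BZ _ YZ] by blast
    then obtain N where N: "onorm N" "X \<inter> N \<subseteq> Z" by (auto simp: relopen_def)
    obtain k where k: "\<forall>x\<in>carrier G. x [^] (p ^ k) \<in> N" using onorm_pow[OF N(1)] by blast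
    from nilpotent_step[OF nilp XG nXZ csub_one[OF Z]]
    obtain x where x: "x \<in> X" "x \<notin> Z" "\<forall>y\<in>carrier G. commut x y \<in> X \<longrightarrow> commut x y \<in> Z" by auto
    have xk: "x [^] (p ^ k) \<in> Z" using N(2) k x(1) XG csub_pow[OF X(1)] by blast
    have "commut x y \<in> B" if y: "y \<in> Y" for y
    proof -
      have c: "commut x y \<in> Z" using x commX[OF x(1) y] y YG by blast
      have "commut x y [^] (p ^ k) \<in> B"
      proof (rule commut_pow_mod[OF Y B(1) _ B(3) _ y])
        show "B \<subseteq> Y" "x \<in> Y" using B(2) X(2) x(1) by auto
        show "commut (commut x y) x \<in> B" using c X(2) x(1) by (auto simp: Z_def)
        show "commut (x [^] (p ^ k)) y \<in> B" using xk y by (auto simp: Z_def)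
      qed
      then show ?thesis using central_torsion_free c by (auto simp: Z_def)
    qed
    then show False using x(1,2) by (auto simp: Z_def)
  qed
  then show ?thesis by (auto simp: Z_def)
qed

lemma maximal_factor_torsion_free: "x \<in> X \<Longrightarrow> x [^] (p ^ k) \<in> B \<Longrightarrow> x \<in> B"
  using central_torsion_free maximal_factor_central by blast

text \<open>As \<open>X / B\<close> is central, invariance under \<open>Y\<close> is automatic, and
  maximality applies to all closed subgroups between \<open>B\<close> and \<open>X\<close>.\<close>

lemma maximal_factor_relopen:
  assumes "csub C" "B \<subseteq> C" "C \<subseteq> X" "C \<noteq> B" shows "relopen C X"
proof (rule maximal[OF assms(1-3) _ assms(4)])
  show "Y \<subseteq> normz C"
  proof
    fix y assume y: "y \<in> Y"
    have YG: "Y \<subseteq> carrier G" using csub_carrier[OF Y] .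
    have "commut z c \<in> C" if "z \<in> Y" "c \<in> C" for z c
    proof -
      have "commut c z \<in> C" using maximal_factor_central that assms by blast
      then show ?thesis using commut_swap_mem[OF assms(1)] that YG csub_carrier[OF assms(1)] by blast
    qed
    then show "y \<in> normz C" using y YG csub_inv[OF Y] by (intro normz_if_commut[OF assms(1)]) auto
  qed
qed

text \<open>Choose \<open>h\<close> in \<open>X\<close> that is not a \<open>p\<close>-th power
  modulo \<open>B\<close>; then \<open>E = gen h <#> B\<close> has finite index in \<open>X\<close>.
  If \<open>x [^] p\<close> lies in \<open>E\<close>, it is already the \<open>p\<close>-th power of
  an element of \<open>E\<close> modulo \<open>B\<close>, since otherwise it would generate
  \<open>h\<close> and make \<open>h\<close> a \<open>p\<close>-th power. Torsion-freeness lets the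
  root be cancelled, so \<open>x\<close> is in \<open>E\<close>. Descending from a power of
  \<open>x\<close> with exponent \<open>p ^ K\<close>, which lies in \<open>E\<close> by finiteness
  of the index, gives \<open>X = E\<close>.\<close>

lemma maximal_factor_procyclic: "\<exists>h\<in>X. X = gen h <#> B"
proof -
  have comm: "\<forall>x\<in>X. \<forall>y\<in>X. commut x y \<in> B" using maximal_factor_central X(2) by blast
  note PX = csub_power_set[OF X(1) B(1,2) comm] power_set_superset[OF X(1) B(1,2) comm]
    power_mem_power_set[OF X(1) B(1,2) comm] power_set_proper[OF X(1) B(1,2) comm]
  have "relopen B B" unfolding relopen_def using onorm_whole by blast
  then have "\<not> X \<subseteq> power_set X B" using PX(4) nrel by blast
  then obtain h where h: "h \<in> X" "h \<notin> power_set X B" by blast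
  have XG: "X \<subseteq> carrier G" using csub_carrier[OF X(1)] .
  have hG: "h \<in> carrier G" and hn: "h \<in> normz B" using h XG X(2) B(3) by auto
  define E where "E = gen h <#> B"
  have E: "csub E" "B \<subseteq> E" "h \<in> E" "E \<subseteq> X"
    using csub_gen_mult[OF B(1) hn] gen_mult_superset[OF B(1) hG] gen_mult_minimal[OF X(1) h(1) B(2)]
    by (auto simp: E_def)
  have "E \<noteq> B" using E(3) h(2) PX(2) by blast
  then have "relopen E X" using maximal_factor_relopen E by blast
  then obtain N where N: "onorm N" "X \<inter> N \<subseteq> E" by (auto simp: relopen_def)
  obtain K where K: "\<forall>x\<in>carrier G. x [^] (p ^ K) \<in> N" using onorm_pow[OF N(1)] by blast
  have commE: "\<forall>x\<in>E. \<forall>y\<in>E. commut x y \<in> B" using comm E(4) by blast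
  note PE = csub_power_set[OF E(1) B(1) E(2) commE] power_set_superset[OF E(1) B(1) E(2) commE]
    power_mem_power_set[OF E(1) B(1) E(2) commE]
  interpret Q: comm_group "factor_group G X B" by (rule abelian_factor[OF X(1) B(1,2) comm])
  note F = abelian_factor_facts[OF X(1) B(1,2) comm]
  have step: "x \<in> E" if x: "x \<in> X" "x [^] p \<in> E" for x
  proof -
    have "x [^] p \<in> gen (h [^] p) <#> B \<or> h \<in> gen (x [^] p) <#> B"
      using procyclic_dichotomy[OF B(1) hn] x(2) E_def by blast
    moreover have "h \<notin> gen (x [^] p) <#> B"
      using gen_mult_minimal[OF PX(1) PX(3)[OF x(1)] PX(2)] h(2) by blast
    moreover have "gen (h [^] p) <#> B \<subseteq> power_set E B"
      using gen_mult_minimal[OF PE(1) PE(3)[OF E(3)] PE(2)] .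
    ultimately have "x [^] p \<in> power_set E B" by blast
    then obtain y b where yb: "y \<in> E" "b \<in> B" "x [^] p = y [^] p \<otimes> b"
      by (auto simp: power_set_def set_mult_def)
    have yX: "y \<in> X" using yb(1) E(4) by blast
    have G: "x \<in> carrier G" "y \<in> carrier G" "b \<in> carrier G" using x yX yb(2) B(2) XG by auto
    have "inv (y [^] p) \<otimes> x [^] p = b"
      using yb(3) G by (simp add: cancel_left_inv)
    then have e: "B #> (y [^] p) = B #> (x [^] p)"
      using F(4)[OF csub_pow[OF X(1) yX] csub_pow[OF X(1) x(1)], of p p] yb(2) by simp
    have iyx: "inv y \<otimes> x \<in> X" using csub_mult[OF X(1) csub_inv[OF X(1) yX] x(1)] .
    have Qc: "B #> z \<in> carrier (factor_group G X B)" if "z \<in> X" for z using that F(8) by blast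
    have "B #> ((inv y \<otimes> x) [^] p) =
        (inv\<^bsub>factor_group G X B\<^esub> (B #> y) \<otimes>\<^bsub>factor_group G X B\<^esub> (B #> x)) [^]\<^bsub>factor_group G X B\<^esub> p"
      using F(5)[OF iyx, of p] F(6)[OF csub_inv[OF X(1) yX] x(1)] F(7)[OF yX] by simp
    also have "\<dots> = inv\<^bsub>factor_group G X B\<^esub> (B #> (y [^] p)) \<otimes>\<^bsub>factor_group G X B\<^esub> (B #> (x [^] p))"
      using Q.nat_pow_distrib[of "inv\<^bsub>factor_group G X B\<^esub> (B #> y)" "B #> x" p] Qc[OF yX] Qc[OF x(1)]
        Q.nat_pow_inv[OF Qc[OF yX], of p] F(5)[OF yX, of p] F(5)[OF x(1), of p] by simp
    also have "\<dots> = \<one>\<^bsub>factor_group G X B\<^esub>"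
      unfolding e using Q.l_inv[OF Qc[OF csub_pow[OF X(1) x(1)]]] .
    finally have "(inv y \<otimes> x) [^] p \<in> B" using F(3)[OF csub_pow[OF X(1) iyx]] by blast
    then have "inv y \<otimes> x \<in> B" using maximal_factor_torsion_free[OF iyx, of 1] by simp
    then have "y \<otimes> (inv y \<otimes> x) \<in> E" using csub_mult[OF E(1) yb(1)] E(2) by blast
    then show "x \<in> E" using G by (simp add: cancel_left)
  qed
  have desc: "x \<in> E" if "x \<in> X" "x [^] (p ^ k) \<in> E" for x k
    using that
  proof (induction k)
    case 0
    then show ?case using XG by (auto dest: subsetD)
  next
    case (Suc k)
    have "(x [^] (p ^ k)) [^] p \<in> E"
      using Suc.prems XG by (auto simp: nat_pow_pow mult.commute subset_iff)
    then have "x [^] (p ^ k) \<in> E" using step[OF csub_pow[OF X(1) Suc.prems(1)]] by blast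
    then show ?case using Suc by blast
  qed
  have "X \<subseteq> E"
  proof
    fix x assume x: "x \<in> X"
    then have "x [^] (p ^ K) \<in> E" using K N(2) XG csub_pow[OF X(1) x] by blast
    then show "x \<in> E" using desc x by blast
  qed
  then show ?thesis using E(4) h(1) E_def by blast
qed

end

text \<open>The conjugate \<open>n H inv n\<close>, written as a preimage under a continuous word so
  that closedness is immediate.\<close>

definition conj_subgroup :: "'a \<Rightarrow> 'a set \<Rightarrow> 'a set"
  where "conj_subgroup n H = {x \<in> carrier G. inv n \<otimes> x \<otimes> n \<in> H}"

lemma csub_conj_subgroup:
  assumes H: "csub H" and n: "n \<in> carrier G" shows "csub (conj_subgroup n H)"
  unfolding closed_subgroup_def
proof
  show "closedin T (conj_subgroup n H)"
    unfolding conj_subgroup_def using n csub_closedin[OF H] by (intro closedin_word continuous_word) auto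
  show "subgroup (conj_subgroup n H) G"
  proof (rule subgroupI)
    have "\<one> \<in> conj_subgroup n H" using n csub_one[OF H] by (simp add: conj_subgroup_def)
    then show "conj_subgroup n H \<noteq> {}" by blast
    show "inv a \<in> conj_subgroup n H" if "a \<in> conj_subgroup n H" for a
    proof -
      have "inv (inv n \<otimes> a \<otimes> n) \<in> H" "a \<in> carrier G" using that csub_inv[OF H] by (auto simp: conj_subgroup_def)
      then show ?thesis using n by (simp add: conj_subgroup_def group_word)
    qed
    show "a \<otimes> b \<in> conj_subgroup n H" if "a \<in> conj_subgroup n H" "b \<in> conj_subgroup n H" for a b
    proof -
      have "(inv n \<otimes> a \<otimes> n) \<otimes> (inv n \<otimes> b \<otimes> n) \<in> H" "a \<in> carrier G" "b \<in> carrier G"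
        using that csub_mult[OF H] by (auto simp: conj_subgroup_def)
      then show ?thesis using n by (simp add: conj_subgroup_def group_word)
    qed
  qed (auto simp: conj_subgroup_def)
qed

text \<open>If \<open>H\<close> were isolated, then \<open>N0\<close> would normalize \<open>H\<close> (consider conjugates), and every closed
  subgroup properly between \<open>H\<close> and \<open>L = H N0\<close> would be open. If \<open>H\<close> is finite, then all
  nontrivial closed subgroups of a small open subgroup are open, contrary to \<open>A0\<close>. Otherwise
  \<open>H\<close> is generated by some \<open>h\<close> modulo \<open>B\<close>, and replacing \<open>h\<close> by \<open>h n\<close> with \<open>n \<in> N0 - H\<close> yields
  another subgroup of infinite index.\<close>

lemma limit_subgroup_not_isolated:
  assumes tower: "procyclic_tower (carrier G)" and nilp: "nilpotent_group G"
    and A0: "csub A0" "\<not> relopen {\<one>} A0" "\<not> openin T A0"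
    and H: "csub H" "\<not> openin T H" and N0: "onorm N0"
  shows "\<exists>K. csub K \<and> K \<noteq> H \<and> \<not> openin T K \<and> K <#> N0 = H <#> N0"
proof (rule ccontr)
  assume neg: "\<not> ?thesis"
  have all: "openin T K" if "csub K" "K \<noteq> H" "K <#> N0 = H <#> N0" for K
    using neg that by auto
  have HG: "H \<subseteq> carrier G" and N0G: "N0 \<subseteq> carrier G" using csub_carrier H onorm_csub N0 by auto
  define L where "L = H <#> N0"
  have L: "csub L" "openin T L" using set_mult_onorm[OF csub_subgroup[OF H(1)] N0] by (auto simp: L_def)
  have HL: "H \<subseteq> L" and NL: "N0 \<subseteq> L"
    using set_mult_superset[OF csub_subgroup[OF H(1)] onorm_subgroup[OF N0]] by (auto simp: L_def)
  have conj_mem: "inv n \<otimes> h \<otimes> n \<in> H" if n: "n \<in> N0" and h: "h \<in> H" for n h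
  proof -
    have nG: "n \<in> carrier G" using n N0G by blast
    \<comment> \<open>A conjugate by an element of \<open>N0\<close> has the same product with
      \<open>N0\<close> as \<open>H\<close>, and it is open only if \<open>H\<close> is. The assumed
      isolation therefore identifies it with \<open>H\<close>.\<close>
    define K where "K = conj_subgroup n H"
    have K: "csub K" unfolding K_def using csub_conj_subgroup[OF H(1) nG] .
    have KG: "k \<in> carrier G" if "k \<in> K" for k using that by (simp add: K_def conj_subgroup_def)
    have 1: "K \<subseteq> H <#> N0"
    proof
      fix k assume k: "k \<in> K"
      define g where "g = inv n \<otimes> k \<otimes> n"
      have g: "g \<in> H" using k by (simp add: K_def conj_subgroup_def g_def)
      have "(inv g \<otimes> n \<otimes> g) \<otimes> inv n \<in> N0"
        using onorm_conj(2)[OF N0 _ n, of g] g HG csub_mult[OF onorm_csub[OF N0]] csub_inv[OF onorm_csub[OF N0] n] by blast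
      moreover have "k = g \<otimes> ((inv g \<otimes> n \<otimes> g) \<otimes> inv n)"
        using nG KG[OF k] by (simp add: g_def group_word)
      ultimately show "k \<in> H <#> N0" using g set_multI by metis
    qed
    have 2: "H \<subseteq> K <#> N0"
    proof
      fix g assume g: "g \<in> H"
      have gG: "g \<in> carrier G" using g HG by blast
      have "n \<otimes> g \<otimes> inv n \<in> K" using g gG nG by (simp add: K_def conj_subgroup_def group_word)
      moreover have "n \<otimes> (inv g \<otimes> inv n \<otimes> g) \<in> N0"
        using onorm_conj(2)[OF N0 gG csub_inv[OF onorm_csub[OF N0] n]] csub_mult[OF onorm_csub[OF N0] n] by blast
      moreover have "g = (n \<otimes> g \<otimes> inv n) \<otimes> (n \<otimes> (inv g \<otimes> inv n \<otimes> g))"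
        using nG gG by (simp add: group_word)
      ultimately show "g \<in> K <#> N0" using set_multI by metis
    qed
    have "K <#> N0 = H <#> N0"
    proof
      show "K <#> N0 \<subseteq> H <#> N0"
        using set_mult_minimal[OF csub_subgroup[OF L(1)]] 1 NL L_def by blast
      show "H <#> N0 \<subseteq> K <#> N0"
        using set_mult_minimal[OF set_mult_onorm(1)[OF csub_subgroup[OF K] N0] 2]
          set_mult_superset(2)[OF csub_subgroup[OF K] onorm_subgroup[OF N0]] by blast
    qed
    moreover have "\<not> openin T K"
    proof
      assume "openin T K"
      then have "openin T {x \<in> carrier G. n \<otimes> x \<otimes> inv n \<in> K}"
        using nG by (intro openin_word continuous_word) auto
      moreover have "{x \<in> carrier G. n \<otimes> x \<otimes> inv n \<in> K} = H"
        using nG HG by (auto simp: K_def conj_subgroup_def group_word)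
      ultimately show False using H(2) by simp
    qed
    ultimately have "K = H" using all[OF K] by blast
    then show ?thesis using h by (auto simp: K_def conj_subgroup_def)
  qed
  have NH: "N0 \<subseteq> normz H"
  proof
    fix n assume n: "n \<in> N0"
    have "inv (inv n) \<otimes> h \<otimes> inv n \<in> H" if "h \<in> H" for h
      using conj_mem[OF csub_inv[OF onorm_csub[OF N0] n] that] .
    then show "n \<in> normz H" using conj_mem[OF n] n N0G by (auto simp: normz_def)
  qed
  have LH: "L \<subseteq> normz H"
    unfolding L_def using set_mult_minimal[OF csub_subgroup[OF csub_normz[OF H(1)]]]
      subgroup_subset_normz[OF csub_subgroup[OF H(1)]] NH by blast
  have above: "openin T K" if K: "csub K" "H \<subseteq> K" "K \<noteq> H" "K \<subseteq> L" for K
  proof (rule all[OF K(1,3)])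
    show "K <#> N0 = H <#> N0"
      using set_mult_minimal[OF csub_subgroup[OF L(1)] K(4) NL] mono_set_mult[OF K(2) order_refl, of G N0] L_def by blast
  qed
  have Hinf: "\<not> relopen {\<one>} H"
  proof
    assume "relopen {\<one>} H"
    then obtain M1 where M1: "onorm M1" "H \<inter> M1 \<subseteq> {\<one>}" by (auto simp: relopen_def)
    define M where "M = M1 \<inter> N0"
    have M: "onorm M" "H \<inter> M \<subseteq> {\<one>}" "M \<subseteq> N0" using onorm_Int[OF M1(1) N0] M1 by (auto simp: M_def)
    \<comment> \<open>\<open>C\<close> is nontrivial because \<open>A0\<close> is infinite; it
      normalizes \<open>H\<close> and meets it trivially. So \<open>C <#> H\<close> lies properly
      above \<open>H\<close> and is open, \<open>C\<close> has finite index in it, and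
      \<open>A0\<close> would be open.\<close>
    define C where "C = A0 \<inter> M"
    have C: "csub C" "C \<subseteq> M" using csub_Int[OF A0(1) onorm_csub[OF M(1)]] by (auto simp: C_def)
    have "\<not> C \<subseteq> {\<one>}" using A0(2) M(1) unfolding relopen_def C_def by blast
    then obtain c where c: "c \<in> C" "c \<noteq> \<one>" by blast
    have CH: "C \<subseteq> normz H" using C M NH by blast
    have K: "csub (C <#> H)" using csub_set_mult[OF C(1) H(1) CH] .
    have sup: "C \<subseteq> C <#> H" "H \<subseteq> C <#> H" using set_mult_superset csub_subgroup C H by auto
    have "c \<notin> H" using c C(2) M(2) by blast
    then have "C <#> H \<noteq> H" using sup(1) c by blast
    moreover have "C <#> H \<subseteq> L"
      using set_mult_minimal[OF csub_subgroup[OF L(1)]] C(2) M(3) NL HL by blast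
    ultimately have "openin T (C <#> H)" using above K sup(2) by blast
    then have "relopen (C <#> H) (carrier G)" using relopen_whole_iff[OF csub_subgroup[OF K]] by blast
    moreover have "relopen C (C <#> H)"
      unfolding relopen_def
    proof (intro exI conjI subsetI)
      show "onorm M" by fact
      fix x assume x: "x \<in> (C <#> H) \<inter> M"
      then obtain d h where dh: "d \<in> C" "h \<in> H" "x = d \<otimes> h" by (auto simp: set_mult_def)
      have G: "d \<in> carrier G" "h \<in> carrier G" using dh csub_carrier C(1) HG by blast+
      have "d \<in> M" "x \<in> M" using dh(1) C(2) x by auto
      then have "inv d \<otimes> x \<in> M"
        using csub_mult[OF onorm_csub[OF M(1)]] csub_inv[OF onorm_csub[OF M(1)]] by simp
      then have "h \<in> M" using dh(3) G by (simp add: cancel_left_inv)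
      then have "h = \<one>" using M(2) dh(2) by blast
      then show "x \<in> C" using dh G by simp
    qed
    ultimately have "relopen C (carrier G)" using relopen_trans by blast
    then have "relopen A0 (carrier G)" by (rule relopen_mono) (auto simp: C_def)
    then show False using A0(3) relopen_whole_iff[OF csub_subgroup[OF A0(1)]] by blast
  qed
  \<comment> \<open>The candidates for \<open>B\<close>; the trivial group is one because
    \<open>H\<close> is infinite. For a maximal candidate every larger closed subgroup of
    \<open>H\<close> invariant under \<open>L\<close> has finite index in \<open>H\<close>, as
    \<open>maximal_factor_procyclic\<close> demands.\<close>
  define \<X> where "\<X> = {B. csub B \<and> B \<subseteq> H \<and> L \<subseteq> normz B \<and> \<not> relopen B H}"
  have "normz {\<one>} = carrier G" by (auto simp: normz_def)
  then have "{\<one>} \<in> \<X>" using csub_trivial csub_one[OF H(1)] Hinf csub_carrier[OF L(1)] by (simp add: \<X>_def)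
  then have "\<exists>B\<in>\<X>. \<forall>K\<in>\<X>. B \<subseteq> K \<longrightarrow> K = B"
    using HG by (intro procyclic_tower_noetherian[OF tower]) (auto simp: \<X>_def)
  then obtain B where BX: "B \<in> \<X>" and Bmax: "\<And>K. K \<in> \<X> \<Longrightarrow> B \<subseteq> K \<Longrightarrow> K = B" by blast
  then have B: "csub B" "B \<subseteq> H" "L \<subseteq> normz B" "\<not> relopen B H" by (auto simp: \<X>_def)
  have max: "relopen C H" if "csub C" "B \<subseteq> C" "C \<subseteq> H" "L \<subseteq> normz C" "C \<noteq> B" for C
    using Bmax[of C] that by (auto simp: \<X>_def)
  obtain h where h: "h \<in> H" "H = gen h <#> B"
    using maximal_factor_procyclic[OF nilp L(1) H(1) HL LH B max] by blast
  have "\<not> N0 \<subseteq> H" using H(2) subgroup_open_if_contains[OF csub_subgroup[OF H(1)] N0] by blast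
  then obtain n where n: "n \<in> N0" "n \<notin> H" by blast
  have hnL: "h \<otimes> n \<in> L" using csub_mult[OF L(1)] h(1) HL n(1) NL by blast
  have G: "h \<in> carrier G" "n \<in> carrier G" using h(1) HG n(1) N0G by auto
  have hnn: "h \<otimes> n \<in> normz B" using hnL B(3) by blast
  define K where "K = gen (h \<otimes> n) <#> B"
  have K: "csub K" unfolding K_def using csub_gen_mult[OF B(1) hnn] .
  have BK: "B \<subseteq> K" and hnK: "h \<otimes> n \<in> K"
    unfolding K_def using gen_mult_superset[OF B(1)] G by auto
  have KL: "K \<subseteq> L" unfolding K_def using gen_mult_minimal[OF L(1) hnL] B(2) HL by blast
  have KN: "csub (K <#> N0)" using set_mult_onorm(3)[OF csub_subgroup[OF K] N0] .
  have supK: "K \<subseteq> K <#> N0" "N0 \<subseteq> K <#> N0"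
    using set_mult_superset[OF csub_subgroup[OF K] onorm_subgroup[OF N0]] by auto
  have "(h \<otimes> n) \<otimes> inv n \<in> K <#> N0"
    using hnK csub_inv[OF onorm_csub[OF N0] n(1)] by (rule set_multI)
  then have "h \<in> K <#> N0" using G by (simp add: m_assoc)
  then have "H \<subseteq> K <#> N0" using gen_mult_minimal[OF KN, of h B] BK supK(1) h(2) by blast
  then have "K <#> N0 = H <#> N0"
    using set_mult_minimal[OF csub_subgroup[OF KN] _ supK(2)] set_mult_minimal[OF csub_subgroup[OF L(1)] KL NL] L_def by blast
  moreover have "K \<noteq> H"
  proof
    assume "K = H"
    then have "inv h \<otimes> (h \<otimes> n) \<in> H" using csub_mult[OF H(1) csub_inv[OF H(1) h(1)]] hnK by blast
    then show False using n(2) G by (simp add: cancel_left_inv)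
  qed
  ultimately have "openin T K" using all[OF K] by blast
  then have Kr: "relopen K (carrier G)" using relopen_whole_iff[OF csub_subgroup[OF K]] by blast
  \<comment> \<open>Were \<open>K\<close> open, \<open>A\<close> would have finite index in
    \<open>H\<close> and hence differ from \<open>B\<close>. Nontrivial closed subgroups of the
    procyclic group \<open>K / B\<close> have finite index, so \<open>A\<close>, and with it
    \<open>H\<close>, would be of finite index in \<open>G\<close>.\<close>
  define A where "A = H \<inter> K"
  have A: "csub A" "B \<subseteq> A" "A \<subseteq> K" using csub_Int[OF H(1) K] B(2) BK by (auto simp: A_def)
  have "relopen A H" using Kr HG unfolding relopen_def A_def by blast
  then have "A \<noteq> B" using B(4) by blast
  then have "relopen A K" using relopen_procyclic[OF B(1) hnn A(1,2)] A(3) K_def by blast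
  then have "relopen A (carrier G)" using relopen_trans Kr by blast
  then have "relopen H (carrier G)" by (rule relopen_mono) (auto simp: A_def)
  then show False using H(2) relopen_whole_iff[OF csub_subgroup[OF H(1)]] by blast
qed

end

section \<open>The space of closed subgroups\<close>

context profinite_group
begin

lemma set_mult_onorm_coarsen:
  assumes K: "csub K" and H: "csub H" and N: "onorm N" and M: "onorm M" "M \<subseteq> N"
    and eq: "K <#> M = H <#> M"
  shows "K <#> N = H <#> N"
proof -
  have *: "K <#> N \<subseteq> H <#> N" if K: "csub K" and H: "csub H" and eq: "K <#> M = H <#> M" for K H
  proof (rule set_mult_minimal)
    show "subgroup (H <#> N) G" using set_mult_onorm(1)[OF csub_subgroup[OF H] N] .
    have "K \<subseteq> H <#> M" using set_mult_superset(1)[OF csub_subgroup[OF K] onorm_subgroup[OF M(1)]] eq by simp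
    also have "\<dots> \<subseteq> H <#> N" using M(2) by (intro mono_set_mult) auto
    finally show "K \<subseteq> H <#> N" .
    show "N \<subseteq> H <#> N" using set_mult_superset(2)[OF csub_subgroup[OF H] onorm_subgroup[OF N]] .
  qed
  show ?thesis using *[OF K H eq] *[OF H K eq[symmetric]] by blast
qed

lemma set_mult_onorm_idem:
  assumes H: "csub H" and N: "onorm N" and M: "onorm M" "M \<subseteq> N"
  shows "(H <#> M) <#> N = H <#> N"
proof
  have HN: "subgroup (H <#> N) G" using set_mult_onorm(1)[OF csub_subgroup[OF H] N] .
  have "H <#> M \<subseteq> H <#> N" using M(2) by (intro mono_set_mult) auto
  then show "(H <#> M) <#> N \<subseteq> H <#> N"
    using set_mult_minimal[OF HN] set_mult_superset(2)[OF csub_subgroup[OF H] onorm_subgroup[OF N]] by blast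
  show "H <#> N \<subseteq> (H <#> M) <#> N"
    using set_mult_superset(1)[OF csub_subgroup[OF H] onorm_subgroup[OF M(1)]] by (intro mono_set_mult) auto
qed

abbreviation SG where "SG \<equiv> subgroup_space G T"
abbreviation nbhd where "nbhd \<equiv> subgroup_nbhd G T"

lemma topspace_SG: "topspace SG = {K. csub K}"
  unfolding subgroup_space_def topology_generated_by_topspace
  using onorm_whole by (auto simp: subgroup_nbhd_def)

lemma openin_SG_iff: "openin SG \<U> \<longleftrightarrow> \<U> \<subseteq> {K. csub K} \<and> (\<forall>H\<in>\<U>. \<exists>N. onorm N \<and> nbhd H N \<subseteq> \<U>)"
proof
  assume "openin SG \<U>"
  then have "generate_topology_on {nbhd H N | H N. csub H \<and> onorm N} \<U>"
    unfolding subgroup_space_def openin_topology_generated_by_iff .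
  then show "\<U> \<subseteq> {K. csub K} \<and> (\<forall>H\<in>\<U>. \<exists>N. onorm N \<and> nbhd H N \<subseteq> \<U>)"
  proof (induction rule: generate_topology_on.induct)
    case (Int a b)
    have "\<exists>N. onorm N \<and> nbhd H N \<subseteq> a \<inter> b" if H: "H \<in> a \<inter> b" for H
    proof -
      obtain N M where NM: "onorm N" "nbhd H N \<subseteq> a" "onorm M" "nbhd H M \<subseteq> b" using Int H by blast
      have cH: "csub H" using Int H by blast
      have "nbhd H (N \<inter> M) \<subseteq> nbhd H N \<inter> nbhd H M"
        using set_mult_onorm_coarsen[OF _ cH NM(1) onorm_Int[OF NM(1,3)]]
          set_mult_onorm_coarsen[OF _ cH NM(3) onorm_Int[OF NM(1,3)]] by (auto simp: subgroup_nbhd_def)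
      then show ?thesis using NM onorm_Int[OF NM(1,3)] by blast
    qed
    then show ?case using Int by blast
  next
    case (UN K)
    then show ?case by (meson Union_iff Sup_least Sup_upper order_trans)
  next
    case (Basis s)
    then obtain H N where "s = nbhd H N" "onorm N" by blast
    then show ?case by (auto simp: subgroup_nbhd_def)
  qed simp
next
  assume *: "\<U> \<subseteq> {K. csub K} \<and> (\<forall>H\<in>\<U>. \<exists>N. onorm N \<and> nbhd H N \<subseteq> \<U>)"
  show "openin SG \<U>"
  proof (subst openin_subopen, intro ballI)
    fix H assume H: "H \<in> \<U>"
    then obtain N where N: "onorm N" "nbhd H N \<subseteq> \<U>" using * by blast
    have cH: "csub H" using H * by blast
    have "openin SG (nbhd H N)"
      unfolding subgroup_space_def using N(1) cH by (intro topology_generated_by_Basis) blast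
    moreover have "H \<in> nbhd H N" using cH by (simp add: subgroup_nbhd_def)
    ultimately show "\<exists>V. openin SG V \<and> H \<in> V \<and> V \<subseteq> \<U>" using N(2) by blast
  qed
qed

text \<open>A basic neighbourhood indexed by the product \<open>M\<close> instead of by one of its
  members. For fixed \<open>N\<close> the nonempty fibres partition the space, which makes them
  clopen.\<close>

definition fibre :: "'a set \<Rightarrow> 'a set \<Rightarrow> 'a set set"
  where "fibre N M = {K. csub K \<and> K <#> N = M}"

lemma openin_fibre: "onorm N \<Longrightarrow> openin SG (fibre N M)"
  unfolding openin_SG_iff by (auto simp: fibre_def subgroup_nbhd_def)

lemma closedin_fibre:
  assumes "onorm N" shows "closedin SG (fibre N M)"
proof -
  have "openin SG (topspace SG - fibre N M)"
    unfolding openin_SG_iff topspace_SG using assms by (auto simp: fibre_def subgroup_nbhd_def)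
  moreover have "fibre N M \<subseteq> topspace SG" by (auto simp: topspace_SG fibre_def)
  ultimately show ?thesis by (simp add: closedin_def)
qed

lemma fibre_separates:
  assumes "csub H" "csub K" "H \<noteq> K"
  shows "\<exists>N. onorm N \<and> H <#> N \<noteq> K <#> N"
proof -
  have *: "\<exists>N. onorm N \<and> H <#> N \<noteq> K <#> N" if HK: "csub H" "csub K" "\<not> H \<subseteq> K" for H K
  proof -
    obtain x where x: "x \<in> H" "x \<notin> K" using HK(3) by blast
    then obtain N where N: "onorm N" "x \<notin> K <#> N"
      using closed_separation[OF csub_closedin[OF HK(2)], of x] csub_carrier[OF HK(1)] by blast
    have "x \<in> H <#> N"
      using set_mult_superset(1)[OF csub_subgroup[OF HK(1)] onorm_subgroup[OF N(1)]] x by blast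
    then show ?thesis using N by blast
  qed
  show ?thesis
  proof (cases "H \<subseteq> K")
    case True
    then have "\<not> K \<subseteq> H" using assms(3) by blast
    then show ?thesis using *[OF assms(2,1)] by metis
  qed (use * assms in blast)
qed

lemma Hausdorff_SG: "Hausdorff_space SG"
  unfolding Hausdorff_space_def
proof (intro allI impI)
  fix H K assume "H \<in> topspace SG \<and> K \<in> topspace SG \<and> H \<noteq> K"
  then have HK: "csub H" "csub K" "H \<noteq> K" by (auto simp: topspace_SG)
  then obtain N where N: "onorm N" "H <#> N \<noteq> K <#> N" using fibre_separates by blast
  show "\<exists>U V. openin SG U \<and> openin SG V \<and> H \<in> U \<and> K \<in> V \<and> disjnt U V"
    using N HK openin_fibre[OF N(1)]
    by (intro exI[of _ "fibre N (H <#> N)"] exI[of _ "fibre N (K <#> N)"]) (auto simp: fibre_def disjnt_iff)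
qed

end

section \<open>Finiteness, countability and compactness in the space of closed subgroups\<close>

context pro_p_group
begin

text \<open>A product \<open>H <#> N\<close> is a union of cosets of \<open>N\<close>, so it is
  determined by the representatives it contains from a fixed finite set \<open>R\<close>.\<close>

lemma finite_products:
  assumes N: "onorm N" shows "finite {H <#> N | H. csub H}"
proof -
  obtain R where R: "finite R" "R \<subseteq> carrier G" "\<forall>x\<in>carrier G. \<exists>f\<in>R. \<exists>n\<in>N. x = f \<otimes> n"
    using onorm_finite_cosets[OF N] by blast
  have eq: "(H <#> N) = ((H <#> N) \<inter> R) <#> N" if H: "csub H" for H
  proof
    have HN: "csub (H <#> N)" using set_mult_onorm(3)[OF csub_subgroup[OF H] N] .
    have NHN: "N \<subseteq> H <#> N" using set_mult_superset(2)[OF csub_subgroup[OF H] onorm_subgroup[OF N]] .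
    show "((H <#> N) \<inter> R) <#> N \<subseteq> H <#> N"
      using set_mult_minimal[OF csub_subgroup[OF HN] _ NHN] by blast
    show "H <#> N \<subseteq> ((H <#> N) \<inter> R) <#> N"
    proof
      fix x assume x: "x \<in> H <#> N"
      have xG: "x \<in> carrier G" using x csub_carrier[OF HN] by blast
      then obtain f n where fn: "f \<in> R" "n \<in> N" "x = f \<otimes> n" using R(3) by blast
      have G: "f \<in> carrier G" "n \<in> carrier G" using fn R(2) csub_carrier[OF onorm_csub[OF N]] by auto
      have "inv n \<in> H <#> N" using csub_inv[OF onorm_csub[OF N] fn(2)] NHN by blast
      then have "x \<otimes> inv n \<in> H <#> N" by (rule csub_mult[OF HN x])
      then have "f \<in> H <#> N" using fn(3) G by (simp add: m_assoc)
      then have "f \<in> (H <#> N) \<inter> R" using fn(1) by blast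
      from set_multI[OF this fn(2)] show "x \<in> ((H <#> N) \<inter> R) <#> N" using fn(3) by simp
    qed
  qed
  have "{H <#> N | H. csub H} \<subseteq> (\<lambda>Q. Q <#> N) ` Pow R"
  proof
    fix M assume "M \<in> {H <#> N | H. csub H}"
    then obtain H where H: "csub H" "M = H <#> N" by auto
    show "M \<in> (\<lambda>Q. Q <#> N) ` Pow R"
      using eq[OF H(1)] H(2) by (intro image_eqI[of _ _ "(H <#> N) \<inter> R"]) auto
  qed
  then show ?thesis using R(1) finite_surj[of "Pow R"] by auto
qed

lemma countable_generate:
  assumes "countable S" "S \<subseteq> carrier G" shows "countable (generate G S)"
proof -
  define W where "W = S \<union> (\<lambda>x. inv x) ` S"
  have W: "countable W" "W \<subseteq> carrier G" using assms by (auto simp: W_def)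
  define f where "f l = foldr (\<lambda>a b. a \<otimes> b) l \<one>" for l
  have fc: "f l \<in> carrier G" if "l \<in> lists W" for l
    using that by induction (use W(2) in \<open>auto simp: f_def\<close>)
  have fapp: "f (l @ m) = f l \<otimes> f m" if "l \<in> lists W" "m \<in> lists W" for l m
    using that(1)
  proof induction
    case Nil
    then show ?case using fc[OF that(2)] by (simp add: f_def)
  next
    case (Cons a l)
    then show ?case using fc[OF that(2)] fc[of l] W(2) by (auto simp: f_def m_assoc)
  qed
  have "generate G S \<subseteq> f ` lists W"
  proof
    fix x assume "x \<in> generate G S"
    then show "x \<in> f ` lists W"
    proof induction
      case one
      show ?case by (intro image_eqI[of _ _ "[]"]) (auto simp: f_def)
    next
      case (incl h)
      then show ?case using assms(2) by (intro image_eqI[of _ _ "[h]"]) (auto simp: f_def W_def)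
    next
      case (inv h)
      then show ?case using assms(2) by (intro image_eqI[of _ _ "[inv h]"]) (auto simp: f_def W_def)
    next
      case (eng h1 h2)
      then obtain l m where "l \<in> lists W" "h1 = f l" "m \<in> lists W" "h2 = f m" by blast
      then show ?case using fapp by (intro image_eqI[of _ _ "l @ m"]) auto
    qed
  qed
  then show ?thesis using W(1) countable_subset countable_lists countable_image by metis
qed

text \<open>All open subgroups are topologically generated by finite subsets of one countable dense
  subgroup \<open>D\<close>. By the Frattini argument it is enough that the generated subgroup
  together with \<open>N\<close> covers \<open>U\<close>, and for this one element of
  \<open>D \<inter> U\<close> per coset of \<open>N\<close> suffices.\<close>

lemma countable_open_subgroups:
  assumes tower: "procyclic_tower (carrier G)" and nilp: "nilpotent_group G"
    and fg: "topologically_fin_gen G T"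
  shows "countable {U. subgroup U G \<and> openin T U}"
proof -
  obtain S where S: "finite S" "S \<subseteq> carrier G" "cl (generate G S) = carrier G"
    using fg by (auto simp: topologically_fin_gen_def topologically_generates_def)
  define D where "D = generate G S"
  have D: "countable D" "D \<subseteq> carrier G" "cl D = carrier G"
    using countable_generate[OF countable_finite[OF S(1)] S(2)] S generate_incl[OF S(2)] by (auto simp: D_def)
  have "U \<in> (\<lambda>X. cl (generate G X)) ` {X. finite X \<and> X \<subseteq> D}" if U: "subgroup U G" "openin T U" for U
  proof -
    have cU: "csub U" using U open_subgroup_closed by (simp add: closed_subgroup_def)
    obtain N where N: "onorm N" "\<forall>K. csub K \<and> K \<subseteq> U \<and> U \<subseteq> K <#> N \<longrightarrow> K = U"
      using isolated_in_subgroups[OF tower nilp cU] by blast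
    obtain N' where N': "onorm N'" "N' \<subseteq> U"
      using open_normal_nbhd[OF U(2) subgroup.one_closed[OF U(1)]] by blast
    have cN: "csub N" using onorm_csub[OF N(1)] .
    obtain R where R: "finite R" "R \<subseteq> carrier G" "\<forall>x\<in>carrier G. \<exists>f\<in>R. \<exists>n\<in>N. x = f \<otimes> n"
      using onorm_finite_cosets[OF N(1)] by blast
    \<comment> \<open>A sample of \<open>D \<inter> U\<close> from the coset of \<open>f\<close>;
      \<open>Q\<close> collects the representatives whose coset has such a sample, and only there is
      the choice meaningful.\<close>
    define pick where "pick f = (SOME d. d \<in> D \<inter> U \<and> inv f \<otimes> d \<in> N)" for f
    define Q where "Q = {f \<in> R. \<exists>d. d \<in> D \<inter> U \<and> inv f \<otimes> d \<in> N}"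
    have pick: "pick f \<in> D \<inter> U \<and> inv f \<otimes> pick f \<in> N" if "f \<in> Q" for f
      unfolding pick_def using that by (intro someI_ex[of "\<lambda>d. d \<in> D \<inter> U \<and> inv f \<otimes> d \<in> N"]) (simp add: Q_def)
    define X where "X = pick ` Q"
    have X: "finite X" "X \<subseteq> D" "X \<subseteq> U" using R(1) pick by (auto simp: X_def Q_def)
    have XG: "X \<subseteq> carrier G" using X(2) D(2) by blast
    define K where "K = cl (generate G X)"
    have K: "csub K" unfolding K_def using csub_closure[OF generate_is_subgroup[OF XG]] .
    have KU: "K \<subseteq> U" unfolding K_def
      using closure_minimal[OF generate_subgroup_incl[OF X(3) U(1)] csub_closedin[OF cU]] .
    have "u \<in> K <#> N" if u: "u \<in> U" for u
    proof -
      have uG: "u \<in> carrier G" using u csub_carrier[OF cU] by blast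
      obtain d where d: "d \<in> D" "inv d \<otimes> u \<in> N \<inter> N'"
        using closure_approx[of u D "N \<inter> N'"] uG D onorm_Int[OF N(1) N'(1)] by blast
      have dG: "d \<in> carrier G" using d D by blast
      have "u \<otimes> inv (inv d \<otimes> u) \<in> U"
        using d(2) N'(2) csub_mult[OF cU u] csub_inv[OF cU] by blast
      then have dU: "d \<in> U" using uG dG by (simp add: group_word)
      obtain f n where f: "f \<in> R" "n \<in> N" "d = f \<otimes> n" using R(3) dG by blast
      have G: "f \<in> carrier G" "n \<in> carrier G" using f R(2) csub_carrier[OF cN] by auto
      have fd: "inv f \<otimes> d \<in> N" using f G by (simp add: cancel_left_inv)
      then have fQ: "f \<in> Q" using f d dU by (auto simp: Q_def)
      define x where "x = pick f"
      have x: "x \<in> X" "inv f \<otimes> x \<in> N" "x \<in> carrier G" using pick[OF fQ] fQ D(2) by (auto simp: x_def X_def)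
      have "inv (inv f \<otimes> x) \<otimes> (inv f \<otimes> d) \<in> N" using csub_mult[OF cN csub_inv[OF cN x(2)] fd] .
      then have "(inv (inv f \<otimes> x) \<otimes> (inv f \<otimes> d)) \<otimes> (inv d \<otimes> u) \<in> N" using csub_mult[OF cN] d(2) by blast
      then have "inv x \<otimes> u \<in> N" using G x dG uG by (simp add: group_word)
      moreover have "u = x \<otimes> (inv x \<otimes> u)" using x uG by (simp add: cancel_left)
      moreover have "x \<in> K"
        unfolding K_def using closure_superset[OF generate_incl[OF XG]] generate.incl[OF x(1), of G] by blast
      ultimately show ?thesis unfolding set_mult_iff by blast
    qed
    then have "K = U" using N(2) K KU by blast
    then show ?thesis using X by (auto simp: K_def)
  qed
  then have "{U. subgroup U G \<and> openin T U} \<subseteq> (\<lambda>X. cl (generate G X)) ` {X. finite X \<and> X \<subseteq> D}" by blast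
  then show ?thesis
    using countable_subset countable_image countable_Collect_finite_subset[OF D(1)] by metis
qed

text \<open>Every neighbourhood of \<open>H\<close> contains some open \<open>H <#> N\<close>, so an
  isolated \<open>H\<close> is of this form. Conversely, for open \<open>H\<close>, a subgroup that
  agrees with \<open>H\<close> modulo a small enough open normal subgroup is contained in
  \<open>H\<close> and supplements the Frattini subgroup, hence is \<open>H\<close>.\<close>

lemma isolated_SG_iff:
  assumes tower: "procyclic_tower (carrier G)" and nilp: "nilpotent_group G" and H: "csub H"
  shows "openin SG {H} \<longleftrightarrow> openin T H"
proof
  assume "openin SG {H}"
  then obtain N where N: "onorm N" "nbhd H N \<subseteq> {H}" unfolding openin_SG_iff by blast
  have "H <#> N \<in> nbhd H N"
    using set_mult_onorm(3)[OF csub_subgroup[OF H] N(1)] set_mult_onorm_idem[OF H N(1) N(1)]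
    by (simp add: subgroup_nbhd_def)
  then have "H <#> N = H" using N(2) by blast
  then show "openin T H" using set_mult_onorm(2)[OF csub_subgroup[OF H] N(1)] by simp
next
  assume op: "openin T H"
  obtain N where N: "onorm N" "\<forall>K. csub K \<and> K \<subseteq> H \<and> H \<subseteq> K <#> N \<longrightarrow> K = H"
    using isolated_in_subgroups[OF tower nilp H] by blast
  obtain N' where N': "onorm N'" "N' \<subseteq> H" using open_normal_nbhd[OF op csub_one[OF H]] by blast
  have M: "onorm (N \<inter> N')" using onorm_Int[OF N(1) N'(1)] .
  have "nbhd H (N \<inter> N') \<subseteq> {H}"
  proof
    fix K assume "K \<in> nbhd H (N \<inter> N')"
    then have K: "csub K" "K <#> (N \<inter> N') = H <#> (N \<inter> N')" by (auto simp: subgroup_nbhd_def)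
    have "K \<subseteq> H <#> (N \<inter> N')"
      using set_mult_superset(1)[OF csub_subgroup[OF K(1)] onorm_subgroup[OF M]] K(2) by simp
    also have "\<dots> \<subseteq> H" using set_mult_minimal[OF csub_subgroup[OF H] order_refl] N'(2) by blast
    finally have "K \<subseteq> H" .
    moreover have "H \<subseteq> K <#> N"
      using set_mult_superset(1)[OF csub_subgroup[OF H] onorm_subgroup[OF M]] K(2)
        mono_set_mult[of K K "N \<inter> N'" N G] by blast
    ultimately show "K \<in> {H}" using N(2) K(1) by blast
  qed
  then show "openin SG {H}" unfolding openin_SG_iff using H M by blast
qed

text \<open>Countability turns the open normal subgroups into a decreasing cofinal sequence
  \<open>N n\<close>, and each \<open>N n\<close> has finitely many nonempty fibres. Koenig's lemma
  selects compatible fibres none of which is finitely covered. The intersection of the associated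
  subgroups is a point all of whose neighbourhoods contain such a fibre, a contradiction.\<close>

lemma compact_SG:
  assumes cnt: "countable {N. onorm N}"
  shows "compact_space SG"
  unfolding compact_space
proof (intro allI impI, rule ccontr)
  fix \<U> assume U: "(\<forall>U\<in>\<U>. openin SG U) \<and> \<Union>\<U> = topspace SG"
    and no: "\<nexists>\<F>. finite \<F> \<and> \<F> \<subseteq> \<U> \<and> \<Union>\<F> = topspace SG"
  define e where "e = from_nat_into {N. onorm N}"
  have e: "onorm (e n)" for n
    using from_nat_into[of "{N. onorm N}" n] onorm_whole by (auto simp: e_def)
  define N where "N n = (\<Inter>i\<le>n. e i)" for n
  have N0: "N 0 = e 0" and NSuc: "N (Suc n) = N n \<inter> e (Suc n)" for n by (auto simp: N_def atMost_Suc)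
  have N: "onorm (N n)" for n by (induction n) (auto simp: N0 NSuc e onorm_Int)
  have Ndec: "N (Suc n) \<subseteq> N n" for n by (auto simp: NSuc)
  have Ncof: "\<exists>n. N n \<subseteq> M" if M: "onorm M" for M
  proof -
    obtain n where "e n = M" unfolding e_def using from_nat_into_surj[OF cnt, of M] M by blast
    then have "N n \<subseteq> M" by (auto simp: N_def)
    then show ?thesis ..
  qed
  define covered where "covered \<V> \<longleftrightarrow> (\<exists>\<F>. finite \<F> \<and> \<F> \<subseteq> \<U> \<and> \<V> \<subseteq> \<Union>\<F>)" for \<V>
  have covered_UN: "covered (\<Union>\<W>)" if "finite \<W>" "\<And>V. V \<in> \<W> \<Longrightarrow> covered V" for \<W>
  proof -
    have "\<forall>V\<in>\<W>. \<exists>\<F>. finite \<F> \<and> \<F> \<subseteq> \<U> \<and> V \<subseteq> \<Union>\<F>" using that(2) by (simp add: covered_def)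
    from bchoice[OF this] obtain F where F: "\<forall>V\<in>\<W>. finite (F V) \<and> F V \<subseteq> \<U> \<and> V \<subseteq> \<Union>(F V)" by blast
    have "finite (\<Union>V\<in>\<W>. F V)" using F that(1) by simp
    moreover have "(\<Union>V\<in>\<W>. F V) \<subseteq> \<U>" using F by blast
    moreover have "\<Union>\<W> \<subseteq> \<Union>(\<Union>V\<in>\<W>. F V)" using F by fastforce
    ultimately show ?thesis unfolding covered_def by blast
  qed
  have covered_mono: "covered \<W>" if cv: "covered \<V>" "\<W> \<subseteq> \<V>" for \<V> \<W>
  proof -
    obtain \<F> where "finite \<F>" "\<F> \<subseteq> \<U>" "\<V> \<subseteq> \<Union>\<F>"
      using cv(1) unfolding covered_def by (elim exE conjE)
    then show ?thesis
      unfolding covered_def using cv(2) by (intro exI[of _ \<F>]) simp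
  qed
  have not_cov: "\<not> covered (topspace SG)"
  proof
    assume "covered (topspace SG)"
    then obtain \<F> where "finite \<F>" "\<F> \<subseteq> \<U>" "topspace SG \<subseteq> \<Union>\<F>"
      unfolding covered_def by (elim exE conjE)
    moreover have "\<Union>\<F> \<subseteq> topspace SG" using U \<open>\<F> \<subseteq> \<U>\<close> by blast
    ultimately have "finite \<F> \<and> \<F> \<subseteq> \<U> \<and> \<Union>\<F> = topspace SG"
      by (simp add: subset_antisym)
    then show False using no by (elim notE) (rule exI)
  qed
  \<comment> \<open>Only finitely many fibres of \<open>N n\<close> are nonempty, so a set without a
    finite subcover meets one of them in a set without a finite subcover.\<close>
  have refine: "\<exists>M. \<not> covered (\<V> \<inter> fibre (N n) M)" if "\<not> covered \<V>" "\<V> \<subseteq> topspace SG" for \<V> n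
  proof (rule ccontr)
    assume "\<nexists>M. \<not> covered (\<V> \<inter> fibre (N n) M)"
    then have "covered (\<Union>((\<lambda>M. \<V> \<inter> fibre (N n) M) ` {H <#> N n | H. csub H}))"
      using finite_products[OF N] by (intro covered_UN) auto
    moreover have "\<V> \<subseteq> \<Union>((\<lambda>M. \<V> \<inter> fibre (N n) M) ` {H <#> N n | H. csub H})"
      using that(2) by (auto simp: topspace_SG fibre_def)
    ultimately have "covered \<V>" by (rule covered_mono)
    then show False using that(1) by contradiction
  qed
  have empty_cov: "covered {}" unfolding covered_def by (intro exI[of _ "{}"]) simp
  have fib_top: "fibre (N n) M \<subseteq> topspace SG" for n M by (auto simp: fibre_def topspace_SG)
  have "\<exists>m. \<forall>n. \<not> covered (fibre (N n) (m n)) \<and> m (Suc n) <#> N n = m n"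
  proof (rule dependent_nat_choice)
    obtain M where "\<not> covered (topspace SG \<inter> fibre (N 0) M)" using refine[OF not_cov order_refl] by blast
    then show "\<exists>M. \<not> covered (fibre (N 0) M)" using fib_top[of 0 M] by (metis inf_absorb2)
  next
    fix M n assume "\<not> covered (fibre (N n) M)"
    then obtain M' where M': "\<not> covered (fibre (N n) M \<inter> fibre (N (Suc n)) M')"
      using refine[OF _ fib_top] by blast
    then have "fibre (N n) M \<inter> fibre (N (Suc n)) M' \<noteq> {}" using empty_cov by metis
    then obtain K where K: "csub K" "K <#> N n = M" "K <#> N (Suc n) = M'" by (auto simp: fibre_def)
    have "M' <#> N n = M" using set_mult_onorm_idem[OF K(1) N[of n] N[of "Suc n"] Ndec[of n]] unfolding K(2,3) .
    moreover have "\<not> covered (fibre (N (Suc n)) M')"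
      using M' covered_mono[OF _ inf_le2] by blast
    ultimately show "\<exists>M'. \<not> covered (fibre (N (Suc n)) M') \<and> M' <#> N n = M" by blast
  qed
  then obtain m where "\<forall>n. \<not> covered (fibre (N n) (m n)) \<and> m (Suc n) <#> N n = m n"
    by (elim exE)
  then have m: "\<And>n. \<not> covered (fibre (N n) (m n))" "\<And>n. m (Suc n) <#> N n = m n" by simp_all
  have mc: "csub (m n) \<and> N n \<subseteq> m n" for n
  proof -
    have "fibre (N n) (m n) \<noteq> {}" using m(1)[of n] empty_cov by metis
    then obtain K where K: "csub K" "K <#> N n = m n" by (auto simp: fibre_def)
    then show ?thesis
      using set_mult_onorm(3)[OF csub_subgroup[OF K(1)] N, of n]
        set_mult_superset(2)[OF csub_subgroup[OF K(1)] onorm_subgroup[OF N], of n] by simp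
  qed
  have mdec: "m (Suc n) \<subseteq> m n" for n
    using set_mult_superset(1)[OF csub_subgroup onorm_subgroup[OF N], of "m (Suc n)" n] mc[of "Suc n"] m(2)[of n] by simp
  have mmono: "i \<le> j \<Longrightarrow> m j \<subseteq> m i" for i j using lift_Suc_antimono_le[of m i j] mdec by blast
  have mN: "m (k + j) <#> N k = m k" for k j
  proof (induction j)
    case 0
    show ?case
      using set_mult_minimal[OF csub_subgroup order_refl, of "m k" "N k"] mc[of k]
        set_mult_superset(1)[OF csub_subgroup onorm_subgroup[OF N], of "m k" k] by auto
  next
    case (Suc j)
    have Nkj: "N (k + j) \<subseteq> N k" using lift_Suc_antimono_le[of N k "k + j"] Ndec by simp
    have "m (k + Suc j) <#> N k = (m (k + Suc j) <#> N (k + j)) <#> N k"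
      using set_mult_onorm_idem[OF _ N N Nkj] mc[of "k + Suc j"] by simp
    then show ?case using m(2)[of "k + j"] Suc by simp
  qed
  define H where "H = (\<Inter>n. m n)"
  have H: "csub H" unfolding H_def using mc by (intro csub_INT) auto
  have HN: "H <#> N k = m k" for k
  proof
    show "H <#> N k \<subseteq> m k"
      using set_mult_minimal[OF csub_subgroup, of "m k" H "N k"] mc[of k] by (auto simp: H_def)
    show "m k \<subseteq> H <#> N k"
    proof
      fix x assume x: "x \<in> m k"
      have xG: "x \<in> carrier G" using x mc[of k] csub_carrier by blast
      \<comment> \<open>The elements of \<open>m (k + j)\<close> congruent to \<open>x\<close>
        modulo \<open>N k\<close>. There are some at every depth by \<open>mN\<close>, and
        compactness of \<open>G\<close> yields one that lies in all \<open>m j\<close>, that is, in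
        \<open>H\<close>.\<close>
      define C where "C j = m (k + j) \<inter> {y \<in> carrier G. inv x \<otimes> y \<in> N k}" for j
      have "closedin T (C j)" for j
        unfolding C_def using mc[of "k + j"] csub_closedin xG csub_closedin[OF onorm_csub[OF N]]
        by (intro closedin_Int closedin_word continuous_word) auto
      moreover have "C j \<noteq> {}" for j
      proof -
        obtain y n where yn: "y \<in> m (k + j)" "n \<in> N k" "x = y \<otimes> n"
          using x mN[of k j] unfolding set_mult_iff[symmetric] by (metis set_mult_iff)
        have G: "y \<in> carrier G" "n \<in> carrier G"
          using yn mc[of "k + j"] csub_carrier onorm_csub[OF N] by blast+
        have "inv x \<otimes> y = inv n" using yn(3) G by (simp add: group_word)
        then show ?thesis using yn G csub_inv[OF onorm_csub[OF N] yn(2)] by (auto simp: C_def)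
      qed
      moreover have "decseq C" unfolding decseq_Suc_iff C_def using mdec by auto
      ultimately have "(\<Inter>j. C j) \<noteq> {}" by (intro compact_space_imp_nest[OF compact])
      then obtain y where y: "\<And>j. y \<in> C j" by blast
      have "y \<in> m j" for j using y[of j] mmono[of j "k + j"] by (auto simp: C_def)
      then have yH: "y \<in> H" by (simp add: H_def)
      have yN: "inv x \<otimes> y \<in> N k" and yG: "y \<in> carrier G" using y[of 0] by (auto simp: C_def)
      have "x = y \<otimes> inv (inv x \<otimes> y)" using xG yG by (simp add: group_word)
      then show "x \<in> H <#> N k"
        using set_multI[OF yH csub_inv[OF onorm_csub[OF N] yN]] by simp
    qed
  qed
  have "H \<in> \<Union>\<U>" using U H by (simp add: topspace_SG)
  then obtain W where W: "W \<in> \<U>" "H \<in> W" by blast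
  then have "openin SG W" using U by blast
  then obtain M where M: "onorm M" "nbhd H M \<subseteq> W" using W(2) unfolding openin_SG_iff by blast
  obtain k where k: "N k \<subseteq> M" using Ncof[OF M(1)] by blast
  have "fibre (N k) (m k) \<subseteq> nbhd H M"
    using set_mult_onorm_coarsen[OF _ H M(1) N k] HN[of k] by (auto simp: fibre_def subgroup_nbhd_def)
  then have "covered (fibre (N k) (m k))"
    unfolding covered_def using W(1) M(2) by (intro exI[of _ "{W}"]) auto
  then show False using m(1) by blast
qed

lemma subgroup_space_scheme:
  assumes fg: "topologically_fin_gen G T" and nilp: "nilpotent_group G" and h: "hirsch_length p G T > 1"
  shows "\<exists>U d. pelczynski_scheme SG U d" "compact_space SG"
proof -
  have tower: "procyclic_tower (carrier G)" using procyclic_tower_nilpotent[OF fg nilp] .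
  obtain A0 where A0: "csub A0" "\<not> relopen {\<one>} A0" "\<not> openin T A0"
    using hirsch_length_witness[OF tower h] by blast
  have cO: "countable {U. subgroup U G \<and> openin T U}"
    using countable_open_subgroups[OF tower nilp fg] .
  have cN: "countable {N. onorm N}"
    by (rule countable_subset[OF _ cO]) (auto simp: open_normal_def normal_imp_subgroup)
  show comp: "compact_space SG" using compact_SG[OF cN] .
  \<comment> \<open>The second index may be confined to open subgroups because
    \<open>H <#> N\<close> is always one; so the family is countable and still separates.\<close>
  define \<C> where "\<C> = (\<lambda>(N, M). fibre N M) ` ({N. onorm N} \<times> {U. subgroup U G \<and> openin T U})"
  have cC: "countable \<C>" using cO cN by (simp add: \<C>_def)
  have neC: "\<C> \<noteq> {}"
    using onorm_whole subgroup_self openin_topspace[of T] by (auto simp: \<C>_def topspace_eq)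
  have C: "openin SG V \<and> closedin SG V" if "V \<in> \<C>" for V
    using that openin_fibre closedin_fibre by (auto simp: \<C>_def)
  have fr: "from_nat_into \<C> n \<in> \<C>" for n using from_nat_into[OF neC] .
  interpret isolated_dense_space SG "from_nat_into \<C>"
  proof
    show "compact_space SG" "Hausdorff_space SG" by (fact comp Hausdorff_SG)+
    show "openin SG (from_nat_into \<C> n)" "closedin SG (from_nat_into \<C> n)" for n using C[OF fr] by auto
    show "\<exists>n. (H \<in> from_nat_into \<C> n) \<noteq> (K \<in> from_nat_into \<C> n)"
      if HK: "H \<in> topspace SG" "K \<in> topspace SG" "H \<noteq> K" for H K
    proof -
      have c: "csub H" "csub K" using HK by (auto simp: topspace_SG)
      obtain N where N: "onorm N" "H <#> N \<noteq> K <#> N" using fibre_separates[OF c HK(3)] by blast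
      have "fibre N (H <#> N) \<in> \<C>"
        using N(1) set_mult_onorm(1,2)[OF csub_subgroup[OF c(1)] N(1)] by (auto simp: \<C>_def)
      then obtain n where n: "from_nat_into \<C> n = fibre N (H <#> N)"
        using from_nat_into_surj[OF cC] by blast
      have "H \<in> fibre N (H <#> N)" "K \<notin> fibre N (H <#> N)" using c N by (auto simp: fibre_def)
      then show ?thesis using n by (intro exI[of _ n]) simp
    qed
    show "\<exists>H\<in>W. openin SG {H}" if W: "openin SG W" "W \<noteq> {}" for W
    proof -
      obtain H where H: "H \<in> W" using W(2) by blast
      have cH: "csub H" using H W(1) unfolding openin_SG_iff by blast
      obtain N where N: "onorm N" "nbhd H N \<subseteq> W" using H W(1) unfolding openin_SG_iff by blast
      note HN = set_mult_onorm[OF csub_subgroup[OF cH] N(1)]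
      \<comment> \<open>Each basic neighbourhood of \<open>H\<close> contains the open subgroup
        \<open>H <#> N\<close>, which is an isolated point.\<close>
      have "H <#> N \<in> nbhd H N"
        using HN(3) set_mult_onorm_idem[OF cH N(1) N(1)] by (simp add: subgroup_nbhd_def)
      then show ?thesis using isolated_SG_iff[OF tower nilp HN(3)] HN(2) N(2) by blast
    qed
    show "\<exists>K\<in>W. K \<noteq> H \<and> \<not> openin SG {K}" if W: "openin SG W" "H \<in> W" "\<not> openin SG {H}" for W H
    proof -
      have cH: "csub H" using W unfolding openin_SG_iff by blast
      obtain N where N: "onorm N" "nbhd H N \<subseteq> W" using W unfolding openin_SG_iff by blast
      have "\<not> openin T H" using W(3) isolated_SG_iff[OF tower nilp cH] by blast
      then obtain K where K: "csub K" "K \<noteq> H" "\<not> openin T K" "K <#> N = H <#> N"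
        using limit_subgroup_not_isolated[OF tower nilp A0 cH _ N(1)] by blast
      then have "K \<in> W" using N(2) by (auto simp: subgroup_nbhd_def)
      then show ?thesis using K isolated_SG_iff[OF tower nilp K(1)] by blast
    qed
    show "\<exists>H\<in>topspace SG. \<not> openin SG {H}"
      using A0 isolated_SG_iff[OF tower nilp A0(1)] by (auto simp: topspace_SG)
  qed
  show "\<exists>U d. pelczynski_scheme SG U d" using scheme_exists by blast
qed

end

theorem proposition4p5:
  fixes G :: "('a, 'b) monoid_scheme" and T :: "'a topology" and p :: nat
  assumes "pro_p_group G T p"
    and "topologically_fin_gen G T"
    and "nilpotent_group G"
    and "hirsch_length p G T > 1"
  shows "subgroup_space G T homeomorphic_space pelczynski_space"
proof -
  interpret pro_p_group G T p by fact
  obtain U d where U: "pelczynski_scheme SG U d"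
    using subgroup_space_scheme(1)[OF assms(2-4)] by blast
  have P: "pelczynski_space = top_of_set pelczynski_set"
    by (simp add: pelczynski_space_def pelczynski_set_def)
  have "compact_space pelczynski_space"
    unfolding P using compact_pelczynski_set by (simp add: compact_space_subtopology)
  moreover have "Hausdorff_space pelczynski_space"
    unfolding P by (simp add: Hausdorff_space_subtopology)
  ultimately show ?thesis
    using pelczynski_scheme_unique[OF U subgroup_space_scheme(2)[OF assms(2-4)] pelczynski_space_scheme] by blast
qed

end
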